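(* Let $0<r\le1$, $0<\lambda<\infty$, $\ell\ge0$, and $m,\beta\in\mathbb{R}$. Assume $\psi\in L^1(\mathbb{R}^n)$ with $(1+|\cdot|)^\ell\psi\in L^1$ satisfies the Tauberian condition. Suppose moreover that $\widehat\psi\in C^{\max\{n+1+[\ell],[\lambda]+1\}}(\mathbb{R}^n\setminus\{0\})$ and that for every $|\kappa|\le\max\{[\ell],[\lambda]\}+1$ $$\partial^\kappa\widehat\psi(\xi)=\mathcal{O}\big(|\xi|^{-\max\{m,\beta\}}\big)\quad\text{as }|\xi|\to\infty.$$ Let $f$ be a distribution of growth $\ell$ such that for every $j\in\mathbb{Z}$ the distribution $\psi_j*f$ is a locally integrable function with $M_{\ell,m}(x,j)<\infty$. Then we have the pointwise inequality $$\big(\psi_j^*f(x)\big)^r\lesssim\sum_{k=j}^\infty2^{(j-k)(\beta-\lambda)r}\int_{\mathbb{R}^n}\frac{|\psi_k*f(x-y)|^r}{(1+2^k|y|)^{\lambda r}}\,2^{kn}\,dy$$ with constant independent of $f$, $j$, $m$, $\ell$ and $x$.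
   Context: $[a]$ is the integer part of $a$. For an integer index $j$, $h_j(x)=2^{jn}h(2^jx)$. $A\lesssim B$ means $A\le CB$ for a constant $C>0$; right-hand sides may be $+\infty$. Growth: $f\in\mathcal{S}'(\mathbb{R}^n)$ is a distribution of growth $\ell\ge0$ if $\phi*f=\mathcal{O}(|x|^\ell)$ as $|x|\to\infty$ for every Schwartz function $\phi$. If $f$ has growth $\ell$ and $(1+|\cdot|)^\ell\psi\in L^1$, then $\psi*f\in\mathcal{S}'$ is defined by $\psi*f(\phi)=\int\psi(x)(\widetilde\phi*f)(x)dx$, $\phi\in\mathcal{S}$, where $\widetilde\phi(x)=\phi(-x)$. Tauberian condition: for every $\xi\in\mathbb{S}^{n-1}$ there exist $a,b\in\mathbb{R}$ (depending on $\xi$) with $0<2a\le b$ such that $|\widehat\psi(t\xi)|>0$ for every $a\le t\le b$. Maximal functions: $\psi_j^*f(x)=\sup_{y\in\mathbb{R}^n}\frac{|\psi_j*f(x-y)|}{(1+2^j|y|)^\lambda}$ (with the given $\lambda$), and $M_{\ell,m}(x,j)=\sup_{y\in\mathbb{R}^n,\,k\ge j}\frac{|\psi_k*f(y)|}{(1+2^j|x-y|)^\ell}2^{(j-k)m}$. (If $M_{\ell,m}(x_0,j)<\infty$ for one $x_0$ then it is finite for all $x$.) Suprema over $y$ of functions defined only almost everywhere are essential suprema. *)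

theory Defs
  imports "HOL-Probability.Essential_Supremum" "HOL-Library.Landau_Symbols"
begin

subsection \<open>Iterated partial derivatives\<close>

definition partial_deriv :: "'n \<Rightarrow> (real ^ 'n \<Rightarrow> complex) \<Rightarrow> real ^ 'n \<Rightarrow> complex" where
  "partial_deriv i g x = vector_derivative (\<lambda>t. g (x + t *\<^sub>R axis i 1)) (at 0)"

text \<open>A derivative of order \<open>k\<close> is indexed by the list \<open>[i1, \<dots>, ik]\<close> of its directions. On functions
  of class \<open>C^k\<close> the order of the list is irrelevant, so lists of length \<open>k\<close> give the same
  derivatives as multi-indices \<open>\<kappa>\<close> with \<open>|\<kappa>| = k\<close>.\<close>

fun pderivs :: "'n list \<Rightarrow> (real ^ 'n \<Rightarrow> complex) \<Rightarrow> real ^ 'n \<Rightarrow> complex" where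
  "pderivs [] g = g"
| "pderivs (i # is) g = partial_deriv i (pderivs is g)"

text \<open>Class \<open>C^N\<close> on a set \<open>S\<close>, which is meant to be open. The differentiability clause is needed
  because \<^const>\<open>vector_derivative\<close> is total.\<close>

definition C_on :: "nat \<Rightarrow> (real ^ 'n) set \<Rightarrow> (real ^ 'n \<Rightarrow> complex) \<Rightarrow> bool" where
  "C_on N S g \<longleftrightarrow>
     (\<forall>is i. length is < N \<longrightarrow>
        (\<forall>x\<in>S. (\<lambda>t::real. pderivs is g (x + t *\<^sub>R axis i 1)) differentiable (at 0))) \<and>
     (\<forall>is. length is \<le> N \<longrightarrow> continuous_on S (pderivs is g))"

subsection \<open>Schwartz functions and tempered distributions\<close>

definition schwartz :: "(real ^ 'n \<Rightarrow> complex) \<Rightarrow> bool" where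
  "schwartz \<phi> \<longleftrightarrow>
     (\<forall>N. C_on N UNIV \<phi>) \<and>
     (\<forall>N is. bounded (range (\<lambda>x. (1 + norm x) ^ N *\<^sub>R pderivs is \<phi> x)))"

definition test_function :: "(real ^ 'n \<Rightarrow> complex) \<Rightarrow> bool" where
  "test_function \<phi> \<longleftrightarrow> (\<forall>N. C_on N UNIV \<phi>) \<and> (\<exists>K. compact K \<and> (\<forall>x. x \<notin> K \<longrightarrow> \<phi> x = 0))"

definition schwartz_seminorm :: "nat \<Rightarrow> (real ^ 'n \<Rightarrow> complex) \<Rightarrow> real" where
  "schwartz_seminorm N \<phi> =
     (SUP (is, x) \<in> {is. length is \<le> N} \<times> UNIV. (1 + norm x) ^ N * norm (pderivs is \<phi> x))"

text \<open>Functionals are total HOL functions; their values off the Schwartz space are irrelevant.\<close>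

definition tempered_distribution :: "((real ^ 'n \<Rightarrow> complex) \<Rightarrow> complex) \<Rightarrow> bool" where
  "tempered_distribution f \<longleftrightarrow>
     (\<forall>\<phi> \<eta>. schwartz \<phi> \<longrightarrow> schwartz \<eta> \<longrightarrow> f (\<lambda>x. \<phi> x + \<eta> x) = f \<phi> + f \<eta>) \<and>
     (\<forall>c \<phi>. schwartz \<phi> \<longrightarrow> f (\<lambda>x. c * \<phi> x) = c * f \<phi>) \<and>
     (\<exists>C N. \<forall>\<phi>. schwartz \<phi> \<longrightarrow> norm (f \<phi>) \<le> C * schwartz_seminorm N \<phi>)"

text \<open>\<open>\<phi> * f\<close> for a Schwartz function \<open>\<phi>\<close>, as a function.\<close>

definition schwartz_conv ::
    "(real ^ 'n \<Rightarrow> complex) \<Rightarrow> ((real ^ 'n \<Rightarrow> complex) \<Rightarrow> complex) \<Rightarrow> real ^ 'n \<Rightarrow> complex" where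
  "schwartz_conv \<phi> f x = f (\<lambda>y. \<phi> (x - y))"

definition has_growth :: "((real ^ 'n \<Rightarrow> complex) \<Rightarrow> complex) \<Rightarrow> real \<Rightarrow> bool" where
  "has_growth f l \<longleftrightarrow> tempered_distribution f \<and>
     (\<forall>\<phi>. schwartz \<phi> \<longrightarrow> (\<lambda>x. norm (schwartz_conv \<phi> f x)) \<in> O[at_infinity](\<lambda>x. norm x powr l))"

definition reflect :: "(real ^ 'n \<Rightarrow> complex) \<Rightarrow> real ^ 'n \<Rightarrow> complex" where
  "reflect \<phi> x = \<phi> (- x)"

text \<open>\<open>\<psi> * f\<close> as a distribution, for \<open>f\<close> of growth \<open>l\<close> and \<open>(1 + |x|)^l \<psi>\<close> integrable. The argument of
  \<open>reflect \<phi> * f\<close> is \<open>x\<close>, not \<open>- x\<close>: for a Schwartz function \<open>\<psi>\<close> this functional is integration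
  against \<^term>\<open>schwartz_conv (reflect \<psi>) f\<close>. The two conventions are exchanged by
  replacing \<open>\<psi>\<close> with \<^term>\<open>reflect \<psi>\<close>.\<close>

definition dist_conv ::
    "(real ^ 'n \<Rightarrow> complex) \<Rightarrow> ((real ^ 'n \<Rightarrow> complex) \<Rightarrow> complex) \<Rightarrow> (real ^ 'n \<Rightarrow> complex) \<Rightarrow> complex" where
  "dist_conv \<psi> f \<phi> = (\<integral>x. \<psi> x * schwartz_conv (reflect \<phi>) f x \<partial>lborel)"

definition locally_integrable :: "(real ^ 'n \<Rightarrow> complex) \<Rightarrow> bool" where
  "locally_integrable g \<longleftrightarrow> (\<forall>K. compact K \<longrightarrow> set_integrable lborel K g)"

text \<open>The distribution \<open>T\<close> is the locally integrable function \<open>g\<close>. Testing is against compactly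
  supported smooth functions, because the product of a locally integrable function with a Schwartz
  function need not be integrable.\<close>

definition is_loc_int_function ::
    "((real ^ 'n \<Rightarrow> complex) \<Rightarrow> complex) \<Rightarrow> (real ^ 'n \<Rightarrow> complex) \<Rightarrow> bool" where
  "is_loc_int_function T g \<longleftrightarrow> locally_integrable g \<and>
     (\<forall>\<phi>. test_function \<phi> \<longrightarrow> T \<phi> = (\<integral>x. g x * \<phi> x \<partial>lborel))"

subsection \<open>Kernels\<close>

definition fourier :: "(real ^ 'n \<Rightarrow> complex) \<Rightarrow> real ^ 'n \<Rightarrow> complex" where
  "fourier \<psi> \<xi> = (\<integral>x. exp (- \<i> * complex_of_real (x \<bullet> \<xi>)) * \<psi> x \<partial>lborel)"

definition tauberian :: "(real ^ 'n \<Rightarrow> complex) \<Rightarrow> bool" where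
  "tauberian \<psi> \<longleftrightarrow>
     (\<forall>\<xi>. norm \<xi> = 1 \<longrightarrow>
        (\<exists>a b. 0 < 2 * a \<and> 2 * a \<le> b \<and> (\<forall>t. a \<le> t \<and> t \<le> b \<longrightarrow> norm (fourier \<psi> (t *\<^sub>R \<xi>)) > 0)))"

definition dilate :: "int \<Rightarrow> (real ^ 'n \<Rightarrow> complex) \<Rightarrow> real ^ 'n \<Rightarrow> complex" where
  "dilate j h x = (2 powi (j * int CARD('n)) :: real) *\<^sub>R h ((2 powi j) *\<^sub>R x)"

subsection \<open>Maximal functions\<close>

text \<open>In the next three definitions \<open>F k\<close> stands for a representative of the function \<open>\<psi>\<^sub>k * f\<close>.
  All of them only depend on the almost everywhere classes of the \<open>F k\<close>.\<close>

definition peetre_max :: "real \<Rightarrow> (int \<Rightarrow> real ^ 'n \<Rightarrow> complex) \<Rightarrow> int \<Rightarrow> real ^ 'n \<Rightarrow> ennreal" where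
  "peetre_max lam F j x =
     esssup lborel (\<lambda>y. ennreal (norm (F j (x - y)) / (1 + 2 powi j * norm y) powr lam))"

definition M_max ::
    "real \<Rightarrow> real \<Rightarrow> (int \<Rightarrow> real ^ 'n \<Rightarrow> complex) \<Rightarrow> real ^ 'n \<Rightarrow> int \<Rightarrow> ennreal" where
  "M_max l m F x j =
     (SUP k\<in>{j..}. esssup lborel (\<lambda>y. ennreal
        (norm (F k y) / (1 + 2 powi j * norm (x - y)) powr l * 2 powr (real_of_int (j - k) * m))))"

text \<open>The sum over the integers \<open>k \<ge> j\<close> is indexed by \<open>i = k - j\<close>.\<close>

definition mean_sum ::
    "real \<Rightarrow> real \<Rightarrow> real \<Rightarrow> (int \<Rightarrow> real ^ 'n \<Rightarrow> complex) \<Rightarrow> int \<Rightarrow> real ^ 'n \<Rightarrow> ennreal" where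
  "mean_sum r lam \<beta> F j x =
     (\<Sum>i. let k = j + int i in
        ennreal (2 powr (real_of_int (j - k) * (\<beta> - lam) * r)) *
        (\<integral>\<^sup>+ y. ennreal (norm (F k (x - y)) powr r / (1 + 2 powi k * norm y) powr (lam * r)
                  * 2 powi (k * int CARD('n))) \<partial>lborel))"

text \<open>Real powers on \<open>[0, \<infinity>]\<close>, for exponents \<open>r > 0\<close>.\<close>

definition ennreal_powr :: "ennreal \<Rightarrow> real \<Rightarrow> ennreal" where
  "ennreal_powr a r = (if a = top then top else ennreal (enn2real a powr r))"

end

theory Submission
  imports Defs "HOL-Probability.Characteristic_Functions"
begin

text \<open>
  The idea is a discrete Calderon reproducing formula with a kernel that need not be smooth. Let
  \<open>cutoff\<close> be a smooth bump that is 1 near the origin and \<open>shell \<xi> = cutoff \<xi> - cutoff (2 \<xi>)\<close>. By the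
  Tauberian condition and compactness, \<open>shell \<xi> = \<Sum>\<^bsub>|k| \<le> L\<^esub> u\<^sub>k(\<xi>) \<psi>^(2\<^sup>k \<xi>)\<close> with
  \<open>u\<^sub>k\<close> as regular as \<open>\<psi>^\<close> and supported in an annulus. Telescoping writes an approximate identity
  applied to \<open>\<psi>\<^sub>j * f\<close> as its value at scale \<open>j + L\<close> plus terms in which \<open>\<psi>\<^sub>j\<close> and \<open>\<psi>\<^sub>k\<close> have been exchanged,
  i.e. convolutions of \<open>\<psi>\<^sub>k * f\<close>, \<open>k > j\<close>, with kernels whose transforms are dilates of \<open>\<psi>^ u\<close>. Integration
  by parts bounds these kernels by the decay of the derivatives of \<open>\<psi>^\<close>, hence almost everywhere
  \<open>|\<psi>\<^sub>j * f(x)| \<lesssim> \<Sum>\<^bsub>k \<ge> j\<^esub> 2\<^bsup>(j-k)\<beta>\<^esup> \<integral> 2\<^bsup>kn\<^esup> |\<psi>\<^sub>k * f(x-y)| (1 + 2\<^sup>j|y|)\<^sup>-\<^sup>\<lambda> dy\<close>.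
  Splitting \<open>|\<psi>\<^sub>k * f| = |\<psi>\<^sub>k * f|\<^bsup>1-r\<^esup> |\<psi>\<^sub>k * f|\<^sup>r\<close> and absorbing the first factor gives the claim as soon as
  the maximal function in \<open>(\<lambda>, \<beta>)\<close> is finite. That is first known only for
  \<open>(max \<ell> \<lambda>, max m \<beta>)\<close>; the inequality for these parameters, whose constant depends on \<open>\<ell>\<close> and \<open>m\<close>,
  yields finiteness for \<open>(\<lambda>, \<beta>)\<close>, and a second pass gives the constant that does not depend on them.
\<close>


subsection \<open>Affine changes of variables and weights\<close>

text \<open>\<open>f\<close> cannot be applied to \<psi>, which is only integrable against a weight.
  So the exchange of \<psi>_j and \<psi>_k is not an identity between values of \<open>f\<close>: it
  is obtained almost everywhere, by pairing both sides with test functions. Likewise \<psi>_j * f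
  has no continuity, so the approximate identity is shown to converge in a weighted L1 space and
  then almost everywhere along a subsequence. The transform of \<psi> is regular only away from the
  origin. The low frequencies are therefore carried by \<open>cutoff\<close> alone, and the
  quotients defining u_k live on an annulus. Starting the telescoping at scale j + L rather than j
  keeps every exchanged scale above j, whichever index k with |k| \<le> L occurs. The constant has
  to be chosen before \<ell> and m. It is built from [\<lambda>] + 1 derivatives and the decay
  exponent \<beta> only, both of which follow from the hypotheses for every pair (\<ell>, m). The n
  + 1 + [\<ell>] derivatives enter qualitatively: they make the kernels integrable against the
  growth of \<open>f\<close>, and no constant of that step survives.\<close>

lemma nn_integral_lborel_affine:
  fixes f :: "'a::euclidean_space \<Rightarrow> ennreal"
  assumes [measurable]: "f \<in> borel_measurable borel" and c: "c \<noteq> 0"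
  shows "(\<integral>\<^sup>+x. f x \<partial>lborel) = ennreal (\<bar>c\<bar> ^ DIM('a)) * (\<integral>\<^sup>+x. f (t + c *\<^sub>R x) \<partial>lborel)"
  by (subst lborel_affine[OF c, of t])
     (simp add: nn_integral_density nn_integral_distr nn_integral_cmult)

lemma integrable_lborel_affine:
  fixes f :: "'a::euclidean_space \<Rightarrow> 'b :: {banach, second_countable_topology}"
  assumes f: "integrable lborel f" and c: "c \<noteq> 0"
  shows "integrable lborel (\<lambda>x. f (t + c *\<^sub>R x))"
proof -
  have m[measurable]: "f \<in> borel_measurable borel"
    using borel_measurable_integrable[OF f] by simp
  have "(\<integral>\<^sup>+x. norm (f x) \<partial>lborel) < \<infinity>"
    using f unfolding integrable_iff_bounded by auto
  then have "ennreal (\<bar>c\<bar> ^ DIM('a)) * (\<integral>\<^sup>+x. norm (f (t + c *\<^sub>R x)) \<partial>lborel) < \<infinity>"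
    by (subst (asm) nn_integral_lborel_affine[OF _ c, where t=t]) auto
  then have "(\<integral>\<^sup>+x. norm (f (t + c *\<^sub>R x)) \<partial>lborel) < \<infinity>"
    using c by (auto simp: ennreal_mult_less_top)
  then show ?thesis unfolding integrable_iff_bounded by auto
qed

lemma integrable_lborel_affine_iff:
  fixes f :: "'a::euclidean_space \<Rightarrow> 'b :: {banach, second_countable_topology}"
  assumes c: "c \<noteq> 0"
  shows "integrable lborel (\<lambda>x. f (t + c *\<^sub>R x)) \<longleftrightarrow> integrable lborel f"
  using integrable_lborel_affine[of f c t]
    integrable_lborel_affine[of "\<lambda>x. f (t + c *\<^sub>R x)" "1/c" "(-1/c) *\<^sub>R t"] c
  by (auto simp: algebra_simps)

lemma integral_lborel_affine:
  fixes f :: "'a::euclidean_space \<Rightarrow> 'b :: {banach, second_countable_topology}"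
  assumes c: "c \<noteq> 0"
  shows "(\<integral>x. f x \<partial>lborel) = (\<bar>c\<bar> ^ DIM('a)) *\<^sub>R (\<integral>x. f (t + c *\<^sub>R x) \<partial>lborel)"
proof cases
  assume f: "integrable lborel f"
  have [measurable]: "f \<in> borel_measurable borel" using borel_measurable_integrable[OF f] by simp
  show ?thesis
    using c f integrable_lborel_affine[OF f c, of t]
    by (subst lborel_affine[OF c, of t]) (simp add: integral_density integral_distr)
next
  assume "\<not> integrable lborel f" with c show ?thesis
    by (simp add: integrable_lborel_affine_iff not_integrable_integral_eq)
qed

lemma AE_lborel_affine:
  fixes P :: "'a::euclidean_space \<Rightarrow> bool"
  assumes c: "c \<noteq> 0" and "AE x in lborel. P x"
  shows "AE x in lborel. P (t + c *\<^sub>R x)"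
proof -
  obtain N where N: "N \<in> null_sets lborel" "{x. \<not> P x} \<subseteq> N"
    using assms(2) by (auto simp: eventually_ae_filter)
  have [measurable]: "N \<in> sets borel" using N by auto
  have "(\<integral>\<^sup>+x. indicator N x \<partial>lborel) = ennreal (\<bar>c\<bar> ^ DIM('a)) * (\<integral>\<^sup>+x. indicator N (t + c *\<^sub>R x) \<partial>lborel)"
    by (rule nn_integral_lborel_affine[OF _ c]) simp
  moreover have "(\<integral>\<^sup>+x. indicator N x \<partial>lborel) = 0" using N by auto
  ultimately have "(\<integral>\<^sup>+x. indicator N (t + c *\<^sub>R x) \<partial>lborel) = 0" using c by auto
  then have "AE x in lborel. (indicator N (t + c *\<^sub>R x)::ennreal) = 0"
    by (subst (asm) nn_integral_0_iff_AE) auto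
  then show ?thesis
    by (rule AE_mp) (use N in \<open>auto simp: indicator_def split: if_splits\<close>)
qed

lemma nn_integral_lborel_shift:
  fixes f :: "'a::euclidean_space \<Rightarrow> ennreal"
  assumes "f \<in> borel_measurable borel"
  shows "(\<integral>\<^sup>+x. f (t + x) \<partial>lborel) = (\<integral>\<^sup>+x. f x \<partial>lborel)"
  using nn_integral_lborel_affine[OF assms, of 1 t] by simp

lemma integral_lborel_shift:
  fixes f :: "'a::euclidean_space \<Rightarrow> 'b :: {banach, second_countable_topology}"
  shows "(\<integral>x. f (t + x) \<partial>lborel) = (\<integral>x. f x \<partial>lborel)"
  using integral_lborel_affine[of 1 f t] by simp

lemma integrable_lborel_shift:
  fixes f :: "'a::euclidean_space \<Rightarrow> 'b :: {banach, second_countable_topology}"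
  shows "integrable lborel (\<lambda>x. f (t + x)) \<longleftrightarrow> integrable lborel f"
  using integrable_lborel_affine_iff[of 1 f t] by simp

lemma AE_lborel_shift:
  fixes P :: "'a::euclidean_space \<Rightarrow> bool"
  assumes "AE x in lborel. P x"
  shows "AE x in lborel. P (t + x)"
  using AE_lborel_affine[of 1 P t] assms by simp

lemma nn_integral_lborel_reflect:
  fixes f :: "'a::euclidean_space \<Rightarrow> ennreal"
  assumes "f \<in> borel_measurable borel"
  shows "(\<integral>\<^sup>+x. f (t - x) \<partial>lborel) = (\<integral>\<^sup>+x. f x \<partial>lborel)"
  using nn_integral_lborel_affine[OF assms, of "-1" t] by simp

lemma AE_lborel_reflect:
  fixes P :: "'a::euclidean_space \<Rightarrow> bool"
  assumes "AE x in lborel. P x"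
  shows "AE x in lborel. P (t - x)"
  using AE_lborel_affine[of "-1" P t] assms by simp

lemma integrable_dominated:
  fixes f :: "'a \<Rightarrow> 'b::{banach, second_countable_topology}" and g :: "'a \<Rightarrow> real"
  assumes "integrable M g" "f \<in> borel_measurable M" "\<And>x. norm (f x) \<le> g x"
  shows "integrable M f"
  by (rule Bochner_Integration.integrable_bound[OF assms(1,2)])
    (use assms(3) in \<open>auto intro: order_trans[OF _ abs_ge_self]\<close>)

section \<open>The weights (1 + |x|)^p\<close>

definition wgt :: "real \<Rightarrow> 'a::real_normed_vector \<Rightarrow> real" where
  "wgt p x = (1 + norm x) powr p"

lemma wgt_pos[simp]: "0 < wgt p x" and wgt_nonneg[simp]: "0 \<le> wgt p x" and wgt_neq0[simp]: "wgt p x \<noteq> 0"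
  by (auto simp: wgt_def add_pos_nonneg) (smt (verit) norm_ge_zero)+

lemma wgt_measurable[measurable]: "wgt p \<in> borel_measurable borel"
  unfolding wgt_def by measurable

lemma wgt_0[simp]: "wgt p 0 = 1" "wgt 0 x = 1"
  using norm_ge_zero[of x] by (auto simp: wgt_def simp del: norm_ge_zero)

lemma wgt_minus[simp]: "wgt p (- x) = wgt p x"
  by (simp add: wgt_def)

lemma wgt_mult: "wgt p x * wgt q x = wgt (p + q) x"
  by (simp add: wgt_def powr_add)

lemma wgt_inverse: "inverse (wgt p x) = wgt (- p) x"
  by (simp add: wgt_def powr_minus)

lemma wgt_mono: "p \<le> q \<Longrightarrow> wgt p x \<le> wgt q x"
  by (simp add: wgt_def powr_mono)

lemma wgt_ge1: "0 \<le> p \<Longrightarrow> 1 \<le> wgt p x"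
  by (simp add: wgt_def ge_one_powr_ge_zero)

lemma wgt_norm_mono: "norm x \<le> norm y \<Longrightarrow> 0 \<le> p \<Longrightarrow> wgt p x \<le> wgt p y"
  unfolding wgt_def by (rule powr_mono2) auto

lemma wgt_norm_anti: "norm x \<le> norm y \<Longrightarrow> p \<le> 0 \<Longrightarrow> wgt p y \<le> wgt p x"
  unfolding wgt_def by (rule powr_mono2') (auto intro: add_pos_nonneg)

lemma wgt_add: "0 \<le> p \<Longrightarrow> wgt p (x + y) \<le> wgt p x * wgt p y"
proof -
  assume p: "0 \<le> p"
  have "1 + norm (x + y) \<le> (1 + norm x) * (1 + norm y)"
    using norm_triangle_ineq[of x y] mult_nonneg_nonneg[OF norm_ge_zero[of x] norm_ge_zero[of y]]
    by (auto simp: algebra_simps intro: order_trans)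
  then have "wgt p (x + y) \<le> ((1 + norm x) * (1 + norm y)) powr p"
    unfolding wgt_def using p by (intro powr_mono2) auto
  then show ?thesis by (simp add: wgt_def powr_mult)
qed

text \<open>Peetre's inequality for negative exponents: apply \<open>wgt_add\<close> to y = -x + (x
  + y) and pass to inverses.\<close>

lemma wgt_shift: "0 \<le> p \<Longrightarrow> wgt (- p) (x + y) \<le> wgt p x * wgt (- p) y"
proof -
  assume p: "0 \<le> p"
  have "wgt p y \<le> wgt p (- x) * wgt p (x + y)"
    using wgt_add[OF p, of "-x" "x + y"] by simp
  then show ?thesis
    unfolding wgt_inverse[symmetric] by (simp add: field_simps)
qed

lemma wgt_powr: "wgt p x powr q = wgt (p * q) x"
  by (simp add: wgt_def powr_powr)

lemma nn_integral_inverse_powr_finite: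
  assumes q: "1 < q"
  shows "(\<integral>\<^sup>+(x::real). ennreal (wgt (- q) x) \<partial>lborel) < \<infinity>"
proof -
  have half: "(\<integral>\<^sup>+(x::real). ennreal ((1 + x) powr (- q)) * indicator {0..} x \<partial>lborel) = ennreal (0 - (- (1 / (q - 1))))"
  proof (rule nn_integral_FTC_atLeast[where F="\<lambda>x. (1 + x) powr (1 - q) / (1 - q)", THEN trans])
    fix x :: real assume "0 \<le> x"
    then show "((\<lambda>x. (1 + x) powr (1 - q) / (1 - q)) has_real_derivative (1 + x) powr (- q)) (at x)"
      using q by (auto intro!: derivative_eq_intros simp: divide_simps)
  next
    have "((\<lambda>x. (1 + x) powr (1 - q)) \<longlongrightarrow> 0) at_top"
      by (rule tendsto_neg_powr) (use q in \<open>auto intro: filterlim_tendsto_add_at_top filterlim_ident\<close>)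
    then show "((\<lambda>x. (1 + x) powr (1 - q) / (1 - q)) \<longlongrightarrow> 0) at_top"
      by (auto dest: tendsto_divide[OF _ tendsto_const, of _ _ _ "1 - q"] simp: q less_imp_neq[OF q])
  qed (use q in \<open>auto simp: divide_simps\<close>)
  have "(\<integral>\<^sup>+(x::real). ennreal (wgt (- q) x) \<partial>lborel) \<le>
     (\<integral>\<^sup>+(x::real). ennreal ((1 + x) powr (- q)) * indicator {0..} x + ennreal ((1 + (0 - x)) powr (- q)) * indicator {0..} (0 - x) \<partial>lborel)"
    by (rule nn_integral_mono) (auto simp: wgt_def indicator_def)
  also have "\<dots> = (\<integral>\<^sup>+(x::real). ennreal ((1 + x) powr (- q)) * indicator {0..} x \<partial>lborel) +
    (\<integral>\<^sup>+(x::real). ennreal ((1 + (0 - x)) powr (- q)) * indicator {0..} (0 - x) \<partial>lborel)"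
    by (rule nn_integral_add) auto
  also have "(\<integral>\<^sup>+(x::real). ennreal ((1 + (0 - x)) powr (- q)) * indicator {0..} (0 - x) \<partial>lborel)
      = (\<integral>\<^sup>+(x::real). ennreal ((1 + x) powr (- q)) * indicator {0..} x \<partial>lborel)"
    by (rule nn_integral_lborel_reflect[of "\<lambda>x. ennreal ((1 + x) powr (- q)) * indicator {0..} x"]) simp
  finally show ?thesis unfolding half by (simp add: less_le_trans top.not_eq_extremum order_le_less_trans)
qed

text \<open>Every coordinate is at most |x| in modulus, so the weight is dominated by a product of
  one-dimensional weights of exponent p / n > 1, to which Tonelli applies.\<close>

lemma wgt_integrable:
  assumes p: "real DIM('a) < p"
  shows "integrable lborel (wgt (- p) :: 'a::euclidean_space \<Rightarrow> real)"
proof -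
  define n where "n = DIM('a)"
  have n: "0 < n" by (simp add: n_def)
  define q where "q = p / n"
  have q: "1 < q" using p n by (simp add: q_def n_def)
  have le: "wgt (- p) x \<le> (\<Prod>b\<in>Basis. wgt (- q) (x \<bullet> b))" for x :: 'a
  proof -
    have "(\<Prod>b\<in>(Basis::'a set). wgt (- q) x) \<le> (\<Prod>b\<in>Basis. wgt (- q) (x \<bullet> b))"
      using q by (intro prod_mono conjI wgt_nonneg) (auto intro!: powr_mono2' simp: wgt_def Basis_le_norm add_pos_nonneg)
    moreover have "(\<Prod>b\<in>(Basis::'a set). wgt (- q) x) = wgt (- p) x"
      using n by (simp add: wgt_def n_def[symmetric] powr_power q_def add_pos_nonneg[THEN less_imp_neq, symmetric])
    ultimately show ?thesis by simp
  qed
  have "(\<integral>\<^sup>+(x::'a). ennreal (wgt (- p) x) \<partial>lborel) \<le> (\<integral>\<^sup>+(x::'a). (\<Prod>b\<in>Basis. ennreal (wgt (- q) (x \<bullet> b))) \<partial>lborel)"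
    using le by (intro nn_integral_mono) (simp add: prod_ennreal ennreal_leI)
  also have "\<dots> = (\<Prod>b\<in>(Basis::'a set). (\<integral>\<^sup>+(x::real). ennreal (wgt (- q) x) \<partial>lborel))"
    by (rule nn_integral_lborel_prod) auto
  also have "\<dots> < \<infinity>"
    using nn_integral_inverse_powr_finite[OF q] by (simp add: power_less_top_ennreal)
  finally show ?thesis
    by (auto simp: integrable_iff_bounded)
qed


subsection \<open>Functions of class \<open>C^k\<close>\<close>

abbreviation has_partial :: "'n \<Rightarrow> (real ^ 'n \<Rightarrow> complex) \<Rightarrow> complex \<Rightarrow> real ^ 'n \<Rightarrow> bool" where
  "has_partial i g d x \<equiv> ((\<lambda>t::real. g (x + t *\<^sub>R axis i 1)) has_vector_derivative d) (at 0)"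

text \<open>\<open>C_on\<close> quantifies over whole lists of directions. This recursion peels off
  the innermost derivative, the last entry of the list, so that closure under sums, products and
  inverses follows by induction on the order.\<close>

fun Ck :: "nat \<Rightarrow> (real ^ 'n) set \<Rightarrow> (real ^ 'n \<Rightarrow> complex) \<Rightarrow> bool" where
  "Ck 0 S g \<longleftrightarrow> continuous_on S g"
| "Ck (Suc N) S g \<longleftrightarrow> continuous_on S g \<and>
     (\<forall>i. (\<forall>x\<in>S. (\<lambda>t::real. g (x + t *\<^sub>R axis i 1)) differentiable (at 0)) \<and> Ck N S (partial_deriv i g))"

lemma pderivs_append: "pderivs (is @ js) g = pderivs is (pderivs js g)"
  by (induction "is") auto

lemma C_on_Suc:
  "C_on (Suc N) S g \<longleftrightarrow> continuous_on S g \<and>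
     (\<forall>i. (\<forall>x\<in>S. (\<lambda>t::real. g (x + t *\<^sub>R axis i 1)) differentiable (at 0)) \<and> C_on N S (partial_deriv i g))"
  (is "?L \<longleftrightarrow> ?R")
proof
  assume L: ?L
  have "pderivs is (partial_deriv i g) = pderivs (is @ [i]) g" for "is" i
    by (simp add: pderivs_append)
  then show ?R using L unfolding C_on_def
    apply (intro conjI allI impI ballI)
    subgoal by (metis le0 list.size(3) pderivs.simps(1))
    subgoal by (metis list.size(3) pderivs.simps(1) zero_less_Suc)
    subgoal for i "is" j x by (metis Suc_less_eq length_append_singleton)
    subgoal for i "is" by (metis Suc_le_mono length_append_singleton)
    done
next
  assume R: ?R
  have d: "(\<lambda>t::real. pderivs is g (x + t *\<^sub>R axis i 1)) differentiable (at 0)"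
    if "length is < Suc N" "x \<in> S" for "is" i x
  proof (cases "is" rule: rev_cases)
    case Nil then show ?thesis using R that by simp
  next
    case (snoc ys y) then show ?thesis using R that unfolding C_on_def
      by (auto simp: pderivs_append)
  qed
  have c: "continuous_on S (pderivs is g)"
    if "length is \<le> Suc N" for "is"
  proof (cases "is" rule: rev_cases)
    case Nil then show ?thesis using R that by simp
  next
    case (snoc ys y) then show ?thesis using R that unfolding C_on_def
      by (auto simp: pderivs_append)
  qed
  show ?L unfolding C_on_def using c d by auto
qed

lemma C_on_iff_Ck: "C_on N S g \<longleftrightarrow> Ck N S g"
proof (induction N arbitrary: g)
  case 0 then show ?case by (auto simp: C_on_def)
next
  case (Suc N) then show ?case unfolding C_on_Suc by simp
qed

lemma has_partial_imp: "has_partial i g d x \<Longrightarrow> partial_deriv i g x = d"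
  unfolding partial_deriv_def by (rule vector_derivative_at)

lemma partial_deriv_works:
  "(\<lambda>t::real. g (x + t *\<^sub>R axis i 1)) differentiable (at 0) \<Longrightarrow> has_partial i g (partial_deriv i g x) x"
  unfolding partial_deriv_def by (simp add: vector_derivative_works)

lemma has_partial_cong:
  assumes "open S" "x \<in> S" "\<And>y. y \<in> S \<Longrightarrow> f y = g y" "has_partial i f d x"
  shows "has_partial i g d x"
proof -
  have "open ((\<lambda>t::real. x + t *\<^sub>R axis i 1) -` S)"
    by (rule open_vimage[OF assms(1)]) (intro continuous_intros)
  then show ?thesis
    using assms by (intro has_vector_derivative_transform_within_open[OF assms(4)]) auto
qed

lemma Ck_cong:
  assumes "open S" "\<And>y. y \<in> S \<Longrightarrow> f y = g y" "Ck N S f"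
  shows "Ck N S g"
  using assms(2,3)
proof (induction N arbitrary: f g)
  case 0 then show ?case using continuous_on_cong[of S S f g] by simp
next
  case (Suc N)
  have hp: "has_partial i g (partial_deriv i f x) x" if "x \<in> S" for i x
    using Suc.prems that by (intro has_partial_cong[OF assms(1) that Suc.prems(1)] partial_deriv_works) auto
  have "Ck N S (partial_deriv i g)" for i
    by (rule Suc.IH[of "partial_deriv i f"]) (use Suc.prems hp has_partial_imp in \<open>metis Ck.simps(2)\<close>)+
  moreover have "continuous_on S g" using Suc.prems continuous_on_cong[of S S f g] by simp
  moreover have "(\<lambda>t::real. g (x + t *\<^sub>R axis i 1)) differentiable (at 0)" if "x \<in> S" for i x
    by (rule differentiableI_vector) (rule hp[OF that])
  ultimately show ?case by auto
qed

text \<open>Openness of S lets the candidates g' be exchanged for \<open>partial_deriv\<close>, with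
  which they are known to agree only on S.\<close>

lemma Ck_SucI:
  assumes "open S" "continuous_on S g" "\<And>i x. x \<in> S \<Longrightarrow> has_partial i g (g' i x) x" "\<And>i. Ck N S (g' i)"
  shows "Ck (Suc N) S g"
proof -
  have "Ck N S (partial_deriv i g)" for i
    by (rule Ck_cong[OF assms(1) _ assms(4)[of i]]) (use assms(3) has_partial_imp in metis)
  then show ?thesis using assms by (auto intro!: differentiableI_vector)
qed

lemma Ck_SucD:
  assumes "Ck (Suc N) S g"
  shows "continuous_on S g" "\<And>i x. x \<in> S \<Longrightarrow> has_partial i g (partial_deriv i g x) x" "\<And>i. Ck N S (partial_deriv i g)"
  using assms by (auto intro: partial_deriv_works)

lemma Ck_continuous: "Ck N S g \<Longrightarrow> continuous_on S g"
  by (cases N) auto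

lemma Ck_less: "Ck (Suc N) S g \<Longrightarrow> Ck N S g"
proof (induction N arbitrary: g)
  case (Suc N)
  have "Ck N S (partial_deriv i g)" for i
    by (rule Suc.IH) (use Suc.prems in simp)
  then show ?case using Suc.prems by simp
qed simp

lemma Ck_mono: "M \<le> N \<Longrightarrow> Ck N S g \<Longrightarrow> Ck M S g"
  by (induction N rule: nat_induct) (auto simp: le_Suc_eq intro: Ck_less simp del: Ck.simps(2))

lemma Ck_subset: "Ck N S g \<Longrightarrow> T \<subseteq> S \<Longrightarrow> Ck N T g"
  by (induction N arbitrary: g) (auto intro: continuous_on_subset)

lemma Ck_Un:
  assumes "open S" "open T"
  shows "Ck N S g \<Longrightarrow> Ck N T g \<Longrightarrow> Ck N (S \<union> T) g"
  by (induction N arbitrary: g) (auto intro: continuous_on_open_Un[OF assms])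

lemma partial_deriv_const: "partial_deriv i (\<lambda>x. c) = (\<lambda>x. 0)"
  by (rule ext, rule has_partial_imp) simp

lemma Ck_const: "Ck N S (\<lambda>x. c)"
proof (induction N arbitrary: c)
  case (Suc N)
  then show ?case using Suc[of 0] by (simp add: partial_deriv_const)
qed simp

lemma Ck_add: "open S \<Longrightarrow> Ck N S f \<Longrightarrow> Ck N S g \<Longrightarrow> Ck N S (\<lambda>x. f x + g x)"
proof (induction N arbitrary: f g)
  case 0 then show ?case by (auto intro: continuous_intros)
next
  case (Suc N)
  note f = Ck_SucD[OF Suc.prems(2)] and g = Ck_SucD[OF Suc.prems(3)]
  show ?case
    by (rule Ck_SucI[where g'="\<lambda>i x. partial_deriv i f x + partial_deriv i g x"])
      (use f g Suc in \<open>auto intro!: continuous_intros derivative_eq_intros\<close>)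
qed

lemma has_partial_mult:
  assumes "has_partial i f a x" "has_partial i g b x"
  shows "has_partial i (\<lambda>x. f x * g x) (f x * b + a * g x) x"
  using has_vector_derivative_mult[OF assms] by simp

lemma Ck_mult: "open S \<Longrightarrow> Ck N S f \<Longrightarrow> Ck N S g \<Longrightarrow> Ck N S (\<lambda>x. f x * g x)"
proof (induction N arbitrary: f g)
  case 0 then show ?case by (auto intro: continuous_intros)
next
  case (Suc N)
  note f = Ck_SucD[OF Suc.prems(2)] and g = Ck_SucD[OF Suc.prems(3)]
  have c: "continuous_on S (\<lambda>x. f x * g x)" using f g by (auto intro!: continuous_intros)
  have *: "Ck N S (\<lambda>x. f x * partial_deriv i g x + partial_deriv i f x * g x)" for i
    using Suc f g Ck_less by (intro Ck_add Suc.IH) blast+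
  show ?case
    using * f g
    by (intro Ck_SucI[OF Suc.prems(1) c, where g'="\<lambda>i x. f x * partial_deriv i g x + partial_deriv i f x * g x"] has_partial_mult) auto
qed

lemma Ck_sum: "open S \<Longrightarrow> (\<And>k. k \<in> A \<Longrightarrow> Ck N S (f k)) \<Longrightarrow> Ck N S (\<lambda>x. \<Sum>k\<in>A. f k x)"
  by (induction A rule: infinite_finite_induct) (auto intro: Ck_const Ck_add)

lemma Ck_prod: "open S \<Longrightarrow> (\<And>k. k \<in> A \<Longrightarrow> Ck N S (f k)) \<Longrightarrow> Ck N S (\<lambda>x. \<Prod>k\<in>A. f k x)"
  by (induction A rule: infinite_finite_induct) (auto intro: Ck_const Ck_mult)

lemma Ck_cnj: "open S \<Longrightarrow> Ck N S f \<Longrightarrow> Ck N S (\<lambda>x. cnj (f x))"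
proof (induction N arbitrary: f)
  case 0 then show ?case by (auto intro: continuous_intros)
next
  case (Suc N)
  note f = Ck_SucD[OF Suc.prems(2)]
  show ?case
    by (rule Ck_SucI[where g'="\<lambda>i x. cnj (partial_deriv i f x)"])
      (use f Suc in \<open>auto intro!: continuous_intros has_vector_derivative_cnj\<close>)
qed

text \<open>The derivative -f' / f^2 again involves only f' and 1 / f, and the induction hypothesis
  covers 1 / f at the lower order.\<close>

lemma Ck_inverse:
  "open S \<Longrightarrow> (\<And>x. x \<in> S \<Longrightarrow> f x \<noteq> 0) \<Longrightarrow> Ck N S f \<Longrightarrow> Ck N S (\<lambda>x. inverse (f x))"
proof (induction N)
  case 0 then show ?case by (auto intro: continuous_intros)
next
  case (Suc N)
  note f = Ck_SucD[OF Suc.prems(3)]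
  have I: "Ck N S (\<lambda>x. inverse (f x))" using Suc Ck_less by blast
  have c: "continuous_on S (\<lambda>x. inverse (f x))" using f Suc.prems by (auto intro!: continuous_intros)
  have hp: "has_partial i (\<lambda>x. inverse (f x)) ((- 1) * (partial_deriv i f x * (inverse (f x) * inverse (f x)))) x"
    if "x \<in> S" for i x
  proof -
    have "((\<lambda>t. inverse (f (x + t *\<^sub>R axis i 1))) has_vector_derivative
       (partial_deriv i f x * (- (inverse (f x) * inverse (f x))))) (at 0)"
      using field_vector_diff_chain_at[OF f(2)[OF that, of i], of inverse "- (inverse (f x) * inverse (f x))"]
        DERIV_inverse[of "f x" UNIV] Suc.prems(2)[OF that]
      by (simp add: o_def power2_eq_square)
    then show ?thesis by simp
  qed
  have "Ck N S (\<lambda>x. (- 1) * (partial_deriv i f x * (inverse (f x) * inverse (f x))))" for i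
    using Suc.prems f I by (intro Ck_mult Ck_const) auto
  then show ?case by (intro Ck_SucI[OF Suc.prems(1) c hp])
qed

lemma has_partial_affine:
  assumes "has_partial i f d (a + c *\<^sub>R x)"
  shows "has_partial i (\<lambda>x. f (a + c *\<^sub>R x)) (c *\<^sub>R d) x"
proof -
  have "((\<lambda>t. f (a + c *\<^sub>R x + (c * t) *\<^sub>R axis i 1)) has_vector_derivative c *\<^sub>R d) (at 0)"
    using vector_diff_chain_at[of "\<lambda>t. c * t" c 0 "\<lambda>t. f (a + c *\<^sub>R x + t *\<^sub>R axis i 1)" d] assms
      has_vector_derivative_mult_right[OF has_vector_derivative_id, of c "at 0"]
    by (simp add: o_def)
  then show ?thesis by (simp add: algebra_simps)
qed

lemma Ck_affine:
  assumes "open T" "\<And>x. x \<in> T \<Longrightarrow> a + c *\<^sub>R x \<in> S"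
  shows "Ck N S f \<Longrightarrow> Ck N T (\<lambda>x. f (a + c *\<^sub>R x))"
proof (induction N arbitrary: f)
  case 0 then show ?case using assms by (auto intro!: continuous_on_compose2[of S f] continuous_intros)
next
  case (Suc N)
  note f = Ck_SucD[OF Suc.prems(1)]
  have c: "continuous_on T (\<lambda>x. f (a + c *\<^sub>R x))"
    using f assms by (auto intro!: continuous_on_compose2[of S f] continuous_intros)
  have "Ck N T (\<lambda>x. c *\<^sub>R partial_deriv i f (a + c *\<^sub>R x))" for i
    using Suc.IH[OF f(3)] assms(1) Ck_mult[of T N "\<lambda>x. of_real c" "\<lambda>x. partial_deriv i f (a + c *\<^sub>R x)"]
    by (auto simp: scaleR_conv_of_real Ck_const)
  then show ?case using f assms
    by (intro Ck_SucI[OF assms(1) c, where g'="\<lambda>i x. c *\<^sub>R partial_deriv i f (a + c *\<^sub>R x)"] has_partial_affine) auto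
qed

lemma Ck_scaled:
  assumes "open T" "\<And>x. x \<in> T \<Longrightarrow> c *\<^sub>R x \<in> S" "Ck N S f"
  shows "Ck N T (\<lambda>x. f (c *\<^sub>R x))"
  using Ck_affine[of T 0 c S N f] assms by simp

lemma pderivs_affine:
  assumes "\<And>N. Ck N UNIV f"
  shows "pderivs is (\<lambda>x. f (a + c *\<^sub>R x)) = (\<lambda>x. c ^ length is *\<^sub>R pderivs is f (a + c *\<^sub>R x))"
proof (induction "is")
  case (Cons i "is")
  have "has_partial i (pderivs is f) (pderivs (i # is) f y) y" for y
    using assms[of "Suc (length is)"] unfolding C_on_iff_Ck[symmetric] C_on_def
    by (auto intro!: partial_deriv_works)
  from has_vector_derivative_scaleR[OF DERIV_const[of "c ^ length is"] has_partial_affine[OF this]]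
  have "has_partial i (\<lambda>x. c ^ length is *\<^sub>R pderivs is f (a + c *\<^sub>R x)) (c ^ length (i # is) *\<^sub>R pderivs (i # is) f (a + c *\<^sub>R x)) x" for x
    by (simp add: mult.commute)
  from has_partial_imp[OF this] show ?case unfolding pderivs.simps Cons by (simp add: fun_eq_iff)
qed simp

lemma pderivs_diff:
  assumes "\<And>N. Ck N UNIV f" "\<And>N. Ck N UNIV g"
  shows "pderivs is (\<lambda>x. f x - g x) = (\<lambda>x. pderivs is f x - pderivs is g x)"
proof (induction "is")
  case (Cons i "is")
  have "has_partial i (pderivs is f) (pderivs (i # is) f y) y" "has_partial i (pderivs is g) (pderivs (i # is) g y) y" for y
    using assms[of "Suc (length is)"] unfolding C_on_iff_Ck[symmetric] C_on_def
    by (auto intro!: partial_deriv_works)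
  from has_partial_imp[OF has_vector_derivative_diff[OF this]]
  show ?case unfolding pderivs.simps Cons by (simp add: fun_eq_iff)
qed simp

subsection \<open>Bounds on derivatives\<close>

fun Bk :: "nat \<Rightarrow> (real ^ 'n) set \<Rightarrow> real \<Rightarrow> (real ^ 'n \<Rightarrow> complex) \<Rightarrow> bool" where
  "Bk 0 S B g \<longleftrightarrow> (\<forall>x\<in>S. norm (g x) \<le> B)"
| "Bk (Suc N) S B g \<longleftrightarrow> (\<forall>x\<in>S. norm (g x) \<le> B) \<and> (\<forall>i. Bk N S B (partial_deriv i g))"

lemma BkI:
  fixes g :: "real ^ 'n \<Rightarrow> complex"
  shows "(\<And>is x. length is \<le> N \<Longrightarrow> x \<in> S \<Longrightarrow> norm (pderivs is g x) \<le> B) \<Longrightarrow> Bk N S B g"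
proof (induction N arbitrary: g)
  case 0 then show ?case using "0.prems"[of "[]"] by simp
next
  case (Suc N)
  have "Bk N S B (partial_deriv i g)" for i
  proof (rule Suc.IH)
    fix "is" :: "'n list" and x assume "length is \<le> N" "x \<in> S"
    then show "norm (pderivs is (partial_deriv i g) x) \<le> B"
      using Suc.prems[of "is @ [i]" x] by (simp add: pderivs_append)
  qed
  then show ?case using Suc.prems[of "[]"] by simp
qed

lemma Bk_bound: "Bk N S B g \<Longrightarrow> x \<in> S \<Longrightarrow> norm (g x) \<le> B"
  by (cases N) auto

lemma Bk_le: "Bk N S B g \<Longrightarrow> B \<le> B' \<Longrightarrow> Bk N S B' g"
  by (induction N arbitrary: g) force+

lemma Bk_less: "Bk (Suc N) S B g \<Longrightarrow> Bk N S B g"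
  by (induction N arbitrary: g) auto

lemma Bk_cong:
  assumes "open S" "\<And>y. y \<in> S \<Longrightarrow> f y = g y" "Ck N S f" "Bk N S B f"
  shows "Bk N S B g"
  using assms(2-4)
proof (induction N arbitrary: f g)
  case (Suc N)
  have "Bk N S B (partial_deriv i g)" for i
  proof (rule Suc.IH[of "partial_deriv i f"])
    fix y assume y: "y \<in> S"
    show "partial_deriv i f y = partial_deriv i g y"
      using has_partial_cong[OF assms(1) y Suc.prems(1) Ck_SucD(2)[OF Suc.prems(2) y, of i]]
      by (simp add: has_partial_imp)
  qed (use Suc.prems in auto)
  then show ?case using Suc.prems by auto
qed simp

lemma Bk_add:
  "open S \<Longrightarrow> Ck N S f \<Longrightarrow> Ck N S g \<Longrightarrow> Bk N S A f \<Longrightarrow> Bk N S B g \<Longrightarrow> Bk N S (A + B) (\<lambda>x. f x + g x)"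
proof (induction N arbitrary: f g)
  case 0 then show ?case by (auto intro: norm_triangle_mono)
next
  case (Suc N)
  note f = Ck_SucD[OF Suc.prems(2)] and g = Ck_SucD[OF Suc.prems(3)]
  have "Bk N S (A + B) (partial_deriv i (\<lambda>x. f x + g x))" for i
  proof (rule Bk_cong[OF Suc.prems(1)])
    show "Bk N S (A + B) (\<lambda>x. partial_deriv i f x + partial_deriv i g x)"
      using Suc f g by (intro Suc.IH) auto
    show "Ck N S (\<lambda>x. partial_deriv i f x + partial_deriv i g x)"
      using Suc f g by (intro Ck_add) auto
    show "partial_deriv i f y + partial_deriv i g y = partial_deriv i (\<lambda>x. f x + g x) y" if "y \<in> S" for y
      using f(2)[OF that] g(2)[OF that] by (intro has_partial_imp[symmetric] has_vector_derivative_add) auto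
  qed
  then show ?case using Suc.prems by (auto intro: norm_triangle_mono)
qed

text \<open>Each derivative turns a product into two products, so N derivatives give at most 2^N
  terms, each bounded by A * B.\<close>

lemma Bk_mult:
  "open S \<Longrightarrow> Ck N S f \<Longrightarrow> Ck N S g \<Longrightarrow> Bk N S A f \<Longrightarrow> Bk N S B g \<Longrightarrow> 0 \<le> A \<Longrightarrow> 0 \<le> B \<Longrightarrow>
    Bk N S (2 ^ N * (A * B)) (\<lambda>x. f x * g x)"
proof (induction N arbitrary: f g)
  case 0 then show ?case by (auto simp: norm_mult intro: mult_mono)
next
  case (Suc N)
  note f = Ck_SucD[OF Suc.prems(2)] and g = Ck_SucD[OF Suc.prems(3)]
  have "Bk N S (2 ^ N * (A * B) + 2 ^ N * (A * B)) (partial_deriv i (\<lambda>x. f x * g x))" for i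
  proof (rule Bk_cong[OF Suc.prems(1)])
    have *: "Ck N S (\<lambda>x. f x * partial_deriv i g x)" "Ck N S (\<lambda>x. partial_deriv i f x * g x)"
      using Suc.prems f g Ck_less by (blast intro: Ck_mult)+
    have **: "Bk N S B (partial_deriv i g)" "Bk N S A (partial_deriv i f)"
      using Suc.prems by auto
    show "Bk N S (2 ^ N * (A * B) + 2 ^ N * (A * B)) (\<lambda>x. f x * partial_deriv i g x + partial_deriv i f x * g x)"
      using Suc.prems f g
      by (intro Bk_add * Suc.IH **) (blast intro: Ck_less Bk_less)+
    show "Ck N S (\<lambda>x. f x * partial_deriv i g x + partial_deriv i f x * g x)"
      using * Suc by (intro Ck_add) auto
    show "f y * partial_deriv i g y + partial_deriv i f y * g y = partial_deriv i (\<lambda>x. f x * g x) y" if "y \<in> S" for y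
      using f(2)[OF that] g(2)[OF that] by (intro has_partial_imp[symmetric] has_partial_mult) auto
  qed
  moreover have "norm (f x * g x) \<le> 2 ^ Suc N * (A * B)" if "x \<in> S" for x
  proof -
    have "norm (f x * g x) \<le> 1 * (A * B)"
      using Bk_bound[OF Suc.prems(4) that] Bk_bound[OF Suc.prems(5) that] Suc.prems
      by (simp add: norm_mult mult_mono)
    also have "\<dots> \<le> 2 ^ Suc N * (A * B)"
      using Suc.prems one_le_power[of "2::real" "Suc N"] by (intro mult_right_mono) auto
    finally show ?thesis .
  qed
  ultimately show ?case by (simp add: algebra_simps)
qed

text \<open>Every derivative contributes a chain-rule factor c. Since c is at least 1, the power of
  highest order also bounds the lower ones.\<close>

lemma Bk_scaled:
  assumes "open S" "open T" "\<And>x. x \<in> T \<Longrightarrow> c *\<^sub>R x \<in> S" "1 \<le> c" "0 \<le> B"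
  shows "Ck N S f \<Longrightarrow> Bk N S B f \<Longrightarrow> Bk N T (c ^ N * B) (\<lambda>x. f (c *\<^sub>R x))"
proof (induction N arbitrary: f)
  case 0 then show ?case using assms by auto
next
  case (Suc N)
  note f = Ck_SucD[OF Suc.prems(1)]
  have b: "norm (f (c *\<^sub>R x)) \<le> c ^ Suc N * B" if "x \<in> T" for x
  proof -
    have "norm (f (c *\<^sub>R x)) \<le> 1 * B" using Suc.prems assms that by simp
    also have "\<dots> \<le> c ^ Suc N * B" using assms one_le_power[of c "Suc N"] by (intro mult_right_mono) auto
    finally show ?thesis .
  qed
  have "Bk N T (c * (c ^ N * B)) (partial_deriv i (\<lambda>x. f (c *\<^sub>R x)))" for i
  proof (rule Bk_cong[OF assms(2)])
    have B: "Bk N T (c ^ N * B) (\<lambda>x. partial_deriv i f (c *\<^sub>R x))"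
      using Suc f by simp
    have C: "Ck N T (\<lambda>x. partial_deriv i f (c *\<^sub>R x))"
      using assms f(3) by (intro Ck_scaled[of T c S]) auto
    \<comment> \<open>The chain rule leaves a scalar c in front of the derivative; pulling it
      through all remaining derivatives takes an induction of its own.\<close>
    have scale: "Bk N T (c * D) (\<lambda>x. c *\<^sub>R h x)" if "Ck N T h" "Bk N T D h" for D h
      using that
    proof (induction N arbitrary: h)
      case 0 then show ?case using assms by auto
    next
      case (Suc N)
      note h = Ck_SucD[OF Suc.prems(1)]
      have "Bk N T (c * D) (partial_deriv i (\<lambda>x. c *\<^sub>R h x))" for i
        by (rule Bk_cong[OF assms(2), of "\<lambda>x. c *\<^sub>R partial_deriv i h x"])
          (use Suc h Ck_mult[OF assms(2) Ck_const[of N T "of_real c"] h(3)[of i]] in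
            \<open>auto simp: scaleR_conv_of_real intro!: has_partial_imp[symmetric] derivative_eq_intros\<close>)
      then show ?case using Suc.prems assms by auto
    qed
    show "Bk N T (c * (c ^ N * B)) (\<lambda>x. c *\<^sub>R partial_deriv i f (c *\<^sub>R x))"
      by (rule scale[OF C B])
    show "Ck N T (\<lambda>x. c *\<^sub>R partial_deriv i f (c *\<^sub>R x))"
      using Ck_mult[OF assms(2) Ck_const[of N T "of_real c"] C] by (simp add: scaleR_conv_of_real)
    show "c *\<^sub>R partial_deriv i f (c *\<^sub>R y) = partial_deriv i (\<lambda>x. f (c *\<^sub>R x)) y" if "y \<in> T" for y
      using f(2) assms(3)[OF that] by (intro has_partial_imp[symmetric] has_partial_affine[where a=0, simplified]) auto
  qed
  then show ?case using b by (simp add: mult.assoc)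
qed

lemma Bk_compact:
  assumes "compact K" "open S" "K \<subseteq> S" "Ck N S f"
  obtains B where "0 \<le> B" "\<And>T. T \<subseteq> K \<Longrightarrow> Bk N T B f"
proof -
  have "\<exists>B\<ge>0. \<forall>T\<subseteq>K. Bk N T B f"
    using assms(4)
  proof (induction N arbitrary: f)
    case 0
    then have "compact (f ` K)" using assms by (intro compact_continuous_image) (auto intro: continuous_on_subset)
    then obtain B where "\<And>x. x \<in> K \<Longrightarrow> norm (f x) \<le> B" by (fastforce dest: compact_imp_bounded simp: bounded_iff)
    then show ?case by (intro exI[of _ "max 0 B"]) force
  next
    case (Suc N)
    from Suc.prems have "continuous_on S f" by simp
    then have "compact (f ` K)" using assms by (intro compact_continuous_image) (auto intro: continuous_on_subset)
    then obtain B where B: "\<And>x. x \<in> K \<Longrightarrow> norm (f x) \<le> B" by (fastforce dest: compact_imp_bounded simp: bounded_iff)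
    have "\<forall>i. \<exists>B\<ge>0. \<forall>T\<subseteq>K. Bk N T B (partial_deriv i f)"
      using Suc by simp
    then obtain D where D: "\<And>i. D i \<ge> 0" "\<And>i T. T \<subseteq> K \<Longrightarrow> Bk N T (D i) (partial_deriv i f)" by metis
    let ?B = "max 0 B + (\<Sum>i\<in>UNIV. D i)"
    have "D i \<le> ?B" for i using D(1) member_le_sum[of i UNIV D] by (simp add: add_increasing)
    then have "Bk N T ?B (partial_deriv i f)" if "T \<subseteq> K" for T i using D(2)[OF that] Bk_le by blast
    moreover have "norm (f x) \<le> ?B" if "x \<in> T" "T \<subseteq> K" for x T
      using B[of x] that sum_nonneg[of UNIV D] D(1) by force
    moreover have "?B \<ge> 0" using sum_nonneg[of UNIV D] D(1) by force
    ultimately show ?case by (intro exI[of _ ?B]) auto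
  qed
  then show ?thesis using that by blast
qed


subsection \<open>Bump functions\<close>

fun smooth_upto :: "nat \<Rightarrow> (real \<Rightarrow> real) \<Rightarrow> bool" where
  "smooth_upto 0 f \<longleftrightarrow> continuous_on UNIV f"
| "smooth_upto (Suc N) f \<longleftrightarrow> (\<exists>f'. (\<forall>x. (f has_real_derivative f' x) (at x)) \<and> smooth_upto N f')"

lemma smooth_upto_less: "smooth_upto (Suc N) f \<Longrightarrow> smooth_upto N f"
proof (induction N arbitrary: f)
  case 0 then show ?case by (auto simp: continuous_on_eq_continuous_within intro: DERIV_isCont)
next
  case (Suc N)
  then obtain f' where "\<forall>x. (f has_real_derivative f' x) (at x)" "smooth_upto (Suc N) f'" by auto
  with Suc.IH[of f'] show ?case by auto
qed

lemma smooth_upto_const: "smooth_upto N (\<lambda>x. c)"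
proof (induction N arbitrary: c)
  case (Suc N) from Suc[of 0] show ?case by (auto intro!: exI[of _ "\<lambda>x. 0"])
qed simp

lemma smooth_upto_add: "smooth_upto N f \<Longrightarrow> smooth_upto N g \<Longrightarrow> smooth_upto N (\<lambda>x. f x + g x)"
proof (induction N arbitrary: f g)
  case (Suc N)
  then obtain f' g' where *: "\<forall>x. (f has_real_derivative f' x) (at x)" "smooth_upto N f'"
    "\<forall>x. (g has_real_derivative g' x) (at x)" "smooth_upto N g'" by auto
  with Suc.IH[OF *(2,4)] show ?case
    by (auto intro!: exI[of _ "\<lambda>x. f' x + g' x"] derivative_intros)
qed (auto intro: continuous_intros)

lemma smooth_upto_mult: "smooth_upto N f \<Longrightarrow> smooth_upto N g \<Longrightarrow> smooth_upto N (\<lambda>x. f x * g x)"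
proof (induction N arbitrary: f g)
  case (Suc N)
  then obtain f' g' where *: "\<forall>x. (f has_real_derivative f' x) (at x)" "smooth_upto N f'"
    "\<forall>x. (g has_real_derivative g' x) (at x)" "smooth_upto N g'" by auto
  have "smooth_upto N f" "smooth_upto N g" using Suc.prems smooth_upto_less by blast+
  then have "smooth_upto N (\<lambda>x. f' x * g x + g' x * f x)"
    using * by (intro smooth_upto_add Suc.IH) auto
  with * show ?case
    by (auto intro!: exI[of _ "\<lambda>x. f' x * g x + g' x * f x"] DERIV_mult)
qed (auto intro: continuous_intros)

lemma smooth_upto_inverse:
  "smooth_upto N f \<Longrightarrow> (\<And>x. f x \<noteq> 0) \<Longrightarrow> smooth_upto N (\<lambda>x. inverse (f x))"
proof (induction N)
  case 0 then show ?case by (auto intro: continuous_intros)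
next
  case (Suc N)
  then obtain f' where *: "\<forall>x. (f has_real_derivative f' x) (at x)" "smooth_upto N f'" by auto
  have I: "smooth_upto N (\<lambda>x. inverse (f x))" using Suc smooth_upto_less by blast
  have "smooth_upto N (\<lambda>x. (- 1) * (f' x * (inverse (f x) * inverse (f x))))"
    using * I by (intro smooth_upto_mult smooth_upto_const)
  with * Suc.prems show ?case
    by (auto intro!: exI[of _ "\<lambda>x. (- 1) * (f' x * (inverse (f x) * inverse (f x)))"] derivative_eq_intros)
qed

lemma smooth_upto_affine: "smooth_upto N f \<Longrightarrow> smooth_upto N (\<lambda>x. f (a + b * x))"
proof (induction N arbitrary: f)
  case 0 then show ?case by (auto intro!: continuous_on_compose2[of UNIV f] continuous_intros)
next
  case (Suc N)
  then obtain f' where *: "\<And>x. (f has_real_derivative f' x) (at x)" "smooth_upto N f'" by auto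
  have "((\<lambda>x. f (a + b * x)) has_real_derivative f' (a + b * x) * b) (at x)" for x
    by (rule DERIV_chain2[where f=f, OF *(1)]) (auto intro!: derivative_eq_intros)
  moreover have "smooth_upto N (\<lambda>x. f' (a + b * x) * b)"
    using Suc.IH[OF *(2)] by (intro smooth_upto_mult smooth_upto_const)
  ultimately show ?case unfolding smooth_upto.simps by (intro exI[of _ "\<lambda>x. f' (a + b * x) * b"] conjI allI)
qed

text \<open>The polynomial factor in 1 / t makes this family closed under differentiation, so
  smoothness at 0 to all orders becomes one induction that ranges over the polynomial.\<close>

definition flatexp :: "real poly \<Rightarrow> real \<Rightarrow> real" where
  "flatexp p t = (if 0 < t then poly p (1 / t) * exp (- (1 / t)) else 0)"

lemma flatexp_tendsto_0: "((\<lambda>t. poly p (1 / t) * exp (- (1 / t))) \<longlongrightarrow> 0) (at_right (0::real))"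
proof -
  have "((\<lambda>s. poly p s * exp (- s)) \<longlongrightarrow> 0) at_top"
  proof -
    have "((\<lambda>s. \<Sum>i\<le>degree p. coeff p i * (s ^ i / exp s)) \<longlongrightarrow> (\<Sum>i\<le>degree p. coeff p i * 0)) at_top"
      by (intro tendsto_intros tendsto_power_div_exp_0)
    then show ?thesis
      by (simp add: poly_altdef sum_distrib_right exp_minus divide_inverse mult.assoc)
  qed
  from filterlim_compose[OF this filterlim_inverse_at_top_right]
  show ?thesis by (simp add: inverse_eq_divide)
qed

text \<open>With s = 1 / t one has ds/dt = -s^2, so differentiating p(s) exp(-s) yields the
  polynomial s^2 (p - p').\<close>

lemma flatexp_has_derivative: "(flatexp p has_real_derivative flatexp ([:0, 0, 1:] * (p - pderiv p)) t) (at t)"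
proof (cases t "0::real" rule: linorder_cases)
  case less
  have "((\<lambda>x. 0) has_real_derivative 0) (at t)" by simp
  then have "(flatexp p has_real_derivative 0) (at t)"
    by (rule DERIV_cong_ev[OF refl _ refl, THEN iffD1, rotated])
      (use less in \<open>auto simp: flatexp_def eventually_nhds intro!: exI[of _ "{..<0}"]\<close>)
  then show ?thesis using less by (simp add: flatexp_def)
next
  case greater
  have "((\<lambda>t. poly p (1 / t) * exp (- (1 / t))) has_real_derivative
     poly p (1 / t) * (exp (- (1 / t)) * (1 / t\<^sup>2)) + poly (pderiv p) (1 / t) * (- (1 / t\<^sup>2)) * exp (- (1 / t))) (at t)"
    using greater
    by (auto intro!: derivative_eq_intros DERIV_chain2[OF poly_DERIV] simp: power2_eq_square field_simps)
  then have "(flatexp p has_real_derivative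
     poly p (1 / t) * (exp (- (1 / t)) * (1 / t\<^sup>2)) + poly (pderiv p) (1 / t) * (- (1 / t\<^sup>2)) * exp (- (1 / t))) (at t)"
    by (rule DERIV_cong_ev[OF refl _ refl, THEN iffD1, rotated])
      (use greater in \<open>auto simp: flatexp_def eventually_nhds intro!: exI[of _ "{0<..}"]\<close>)
  moreover have "poly p (1 / t) * (exp (- (1 / t)) * (1 / t\<^sup>2)) + poly (pderiv p) (1 / t) * (- (1 / t\<^sup>2)) * exp (- (1 / t))
      = flatexp ([:0, 0, 1:] * (p - pderiv p)) t"
    using greater by (simp add: flatexp_def power2_eq_square field_simps)
  ultimately show ?thesis by simp
next
  case equal
  have "((\<lambda>h. (flatexp p (0 + h) - flatexp p 0) / h) \<longlongrightarrow> 0) (at 0)"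
  proof (rule filterlim_split_at)
    show "((\<lambda>h. (flatexp p (0 + h) - flatexp p 0) / h) \<longlongrightarrow> 0) (at_left 0)"
      by (rule tendsto_eventually) (auto simp: flatexp_def eventually_at_filter)
    \<comment> \<open>Dividing by h multiplies the polynomial by 1 / h, that is, replaces p by
      \<open>pCons 0 p\<close>.\<close>
    show "((\<lambda>h. (flatexp p (0 + h) - flatexp p 0) / h) \<longlongrightarrow> 0) (at_right 0)"
      by (rule Lim_transform_eventually[OF flatexp_tendsto_0[of "pCons 0 p"]])
        (auto simp: flatexp_def eventually_at_filter)
  qed
  then show ?thesis using equal by (simp add: DERIV_def flatexp_def)
qed

lemma smooth_upto_flatexp: "smooth_upto N (flatexp p)"
proof (induction N arbitrary: p)
  case 0 then show ?case using flatexp_has_derivative by (auto intro!: DERIV_continuous_on intro: has_field_derivative_at_within)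
next
  case (Suc N) then show ?case using flatexp_has_derivative by auto
qed

definition smooth_step :: "real \<Rightarrow> real" where
  "smooth_step x = flatexp 1 x / (flatexp 1 x + flatexp 1 (1 - x))"

lemma flatexp_pos: "0 < t \<Longrightarrow> 0 < flatexp 1 t" and flatexp_nonneg: "0 \<le> flatexp 1 t" and flatexp_zero: "t \<le> 0 \<Longrightarrow> flatexp p t = 0"
  by (auto simp: flatexp_def)

lemma flatexp_denom_pos: "0 < flatexp 1 x + flatexp 1 (1 - x)"
  using flatexp_pos[of x] flatexp_pos[of "1 - x"] flatexp_nonneg[of x] flatexp_nonneg[of "1 - x"] by (cases "0 < x") auto

lemma smooth_upto_smooth_step: "smooth_upto N smooth_step"
proof -
  have "smooth_upto N (\<lambda>x. flatexp 1 x * inverse (flatexp 1 x + flatexp 1 (1 + (- 1) * x)))"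
    by (intro smooth_upto_mult smooth_upto_flatexp smooth_upto_inverse smooth_upto_add smooth_upto_affine)
      (use flatexp_denom_pos in \<open>auto simp: less_imp_neq[symmetric]\<close>)
  then show ?thesis by (simp add: smooth_step_def[abs_def] divide_inverse)
qed

lemma smooth_step_eq_0: "x \<le> 0 \<Longrightarrow> smooth_step x = 0" and smooth_step_eq_1: "1 \<le> x \<Longrightarrow> smooth_step x = 1"
  using flatexp_pos[of x] by (auto simp: smooth_step_def flatexp_zero)

lemma Ck_component:
  fixes S :: "(real ^ 'n) set"
  assumes S: "open S"
  shows "smooth_upto N f \<Longrightarrow> Ck N S (\<lambda>x. complex_of_real (f (x $ i)))"
proof (induction N arbitrary: f)
  case 0 then show ?case by (auto intro!: continuous_intros continuous_on_compose2[of UNIV f])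
next
  case (Suc N)
  then obtain f' where f': "\<And>x. (f has_real_derivative f' x) (at x)" "smooth_upto N f'" by auto
  have cf: "continuous_on UNIV f"
    using f' by (auto intro!: DERIV_continuous_on intro: has_field_derivative_at_within)
  define g' :: "'n \<Rightarrow> real ^ 'n \<Rightarrow> complex" where "g' = (\<lambda>j x. complex_of_real (f' (x $ i)) * (if j = i then 1 else 0))"
  have hp: "has_partial j (\<lambda>x. complex_of_real (f (x $ i))) (g' j x) x" for j x
  proof (cases "j = i")
    case True
    have "((\<lambda>t. f (x $ i + 1 * t)) has_real_derivative f' (x $ i + 1 * 0) * 1) (at 0)"
      by (rule DERIV_chain2[where f=f, OF f'(1)]) (auto intro!: derivative_eq_intros)
    then have "((\<lambda>t. complex_of_real (f (x $ i + t))) has_vector_derivative complex_of_real (f' (x $ i))) (at 0)"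
      by (intro has_vector_derivative_of_real) simp
    then show ?thesis using True by (simp add: g'_def axis_def)
  next
    case False then show ?thesis by (simp add: g'_def axis_def)
  qed
  have "Ck N S (g' j)" for j
    unfolding g'_def by (intro Ck_mult S Suc.IH f' Ck_const)
  moreover have "continuous_on S (\<lambda>x. complex_of_real (f (x $ i)))"
    using cf by (auto intro!: continuous_intros continuous_on_compose2[of UNIV f])
  ultimately show ?case by (intro Ck_SucI[OF S _ hp]) auto
qed

text \<open>As c grows, these smooth functions, all bounded by 1 and supported in the closed box,
  converge pointwise to the indicator of the open box; they carry identities from test functions to
  indicators.\<close>

definition box_bump :: "real ^ 'n \<Rightarrow> real ^ 'n \<Rightarrow> real \<Rightarrow> real ^ 'n \<Rightarrow> complex" where
  "box_bump a b c x = (\<Prod>i\<in>UNIV. complex_of_real (flatexp 1 (- c * a $ i + c * x $ i) * flatexp 1 (c * b $ i + (- c) * x $ i)))"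

lemma box_bump_eq_0:
  assumes "0 < c" "x \<notin> box a b"
  shows "box_bump a b c x = 0"
proof -
  from assms(2) obtain i where "x $ i \<le> a $ i \<or> b $ i \<le> x $ i" by (auto simp: mem_box_cart not_less)
  then have "- c * a $ i + c * x $ i \<le> 0 \<or> c * b $ i + (- c) * x $ i \<le> 0"
    using assms(1) by auto
  then have "complex_of_real (flatexp 1 (- c * a $ i + c * x $ i) * flatexp 1 (c * b $ i + (- c) * x $ i)) = 0"
    using flatexp_zero by auto
  then show ?thesis unfolding box_bump_def by (intro prod_zero) auto
qed

lemma test_function_box_bump: "0 < c \<Longrightarrow> test_function (box_bump a b c)"
  unfolding test_function_def
proof (intro conjI allI)
  fix N
  have "Ck N UNIV (\<lambda>x. \<Prod>i\<in>UNIV. complex_of_real (flatexp 1 (- c * a $ i + c * x $ i) * flatexp 1 (c * b $ i + (- c) * x $ i)))"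
    by (intro Ck_prod Ck_component[where f="\<lambda>t. flatexp 1 (- c * a $ i + c * t) * flatexp 1 (c * b $ i + (- c) * t)" for i]
       open_UNIV smooth_upto_mult smooth_upto_affine smooth_upto_flatexp)
  then show "C_on N UNIV (box_bump a b c)" by (simp add: C_on_iff_Ck box_bump_def[abs_def])
next
  assume c: "0 < c"
  then have "box_bump a b c x = 0" if "x \<notin> cbox a b" for x
    by (rule box_bump_eq_0) (use that box_subset_cbox in blast)
  then show "\<exists>K. compact K \<and> (\<forall>x. x \<notin> K \<longrightarrow> box_bump a b c x = 0)"
    by (intro exI[of _ "cbox a b"]) auto
qed

lemma norm_box_bump_le: "norm (box_bump a b c x) \<le> 1"
proof -
  have "\<bar>flatexp 1 t\<bar> \<le> 1" for t by (auto simp: flatexp_def)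
  then show ?thesis unfolding box_bump_def prod_norm[symmetric]
    by (intro prod_le_1) (auto simp: norm_mult abs_mult intro!: mult_le_one)
qed

lemma box_bump_tendsto: "(\<lambda>m. box_bump a b (real (Suc m)) x) \<longlonglongrightarrow> indicator (box a b) x"
proof (cases "x \<in> box a b")
  case True
  have f: "(\<lambda>m. flatexp 1 (real (Suc m) * t)) \<longlonglongrightarrow> 1" if t: "0 < t" for t
  proof -
    have "(\<lambda>m. exp (- (1 / t) * inverse (real (Suc m)))) \<longlonglongrightarrow> exp (- (1 / t) * 0)"
      by (intro tendsto_intros LIMSEQ_inverse_real_of_nat)
    then show ?thesis using t by (simp add: flatexp_def divide_inverse mult.commute)
  qed
  have "(\<lambda>m. \<Prod>i\<in>UNIV. complex_of_real (flatexp 1 (real (Suc m) * (x $ i - a $ i)) * flatexp 1 (real (Suc m) * (b $ i - x $ i))))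
    \<longlonglongrightarrow> (\<Prod>i\<in>(UNIV::'a set). complex_of_real (1 * 1))"
    using True by (intro tendsto_intros f) (auto simp: mem_box_cart)
  then show ?thesis using True by (simp add: box_bump_def algebra_simps)
next
  case False
  then have "box_bump a b (real (Suc m)) x = 0" for m by (intro box_bump_eq_0) simp_all
  then show ?thesis using False by simp
qed

section \<open>Locally integrable functions are determined by test functions\<close>

lemma locally_integrable_measurable:
  assumes "locally_integrable h"
  shows "h \<in> borel_measurable borel"
proof (rule borel_measurable_LIMSEQ_metric)
  fix n :: nat
  have "set_integrable lborel (cball 0 (real n)) h" using assms by (simp add: locally_integrable_def)
  then show "(\<lambda>x. indicator (cball 0 (real n)) x *\<^sub>R h x) \<in> borel_measurable borel"
    unfolding set_integrable_def using borel_measurable_integrable by fastforce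
next
  fix x :: "real ^ 'a"
  obtain N :: nat where N: "norm x \<le> N" using real_arch_simple by blast
  have "\<forall>\<^sub>F n in sequentially. indicator (cball 0 (real n)) x *\<^sub>R h x = h x"
    using eventually_ge_at_top[of N] by eventually_elim (use N in auto)
  then show "(\<lambda>n. indicator (cball 0 (real n)) x *\<^sub>R h x) \<longlonglongrightarrow> h x"
    by (rule tendsto_eventually)
qed

lemma AE_zero_if_set_integrals_zero:
  fixes f :: "'a \<Rightarrow> real"
  assumes f: "integrable M f" and z: "\<And>A. A \<in> sets M \<Longrightarrow> (LINT x:A|M. f x) = 0"
  shows "AE x in M. f x = 0"
proof -
  have [measurable]: "f \<in> borel_measurable M" using f by auto
  \<comment> \<open>For s = 1 and s = -1 these are the positive and the negative part of f:
    nonnegative functions with integral 0.\<close>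
  have *: "AE x in M. indicator {x\<in>space M. 0 \<le> s * f x} x *\<^sub>R (s * f x) = 0" for s
  proof -
    have "(LINT x|M. indicator {x\<in>space M. 0 \<le> s * f x} x *\<^sub>R (s * f x)) = s * (LINT x:{x\<in>space M. 0 \<le> s * f x}|M. f x)"
      unfolding set_lebesgue_integral_def by (subst integral_mult_right_zero[symmetric]) (simp add: mult_ac)
    also have "\<dots> = 0" by (subst z) auto
    finally show ?thesis
      by (subst (asm) integral_nonneg_eq_0_iff_AE)
        (use integrable_mult_indicator[of "{x\<in>space M. 0 \<le> s * f x}" M "\<lambda>x. s * f x"] f in \<open>auto simp: indicator_def\<close>)
  qed
  show ?thesis using *[of 1] *[of "-1"] AE_space
    by eventually_elim (auto simp: indicator_def split: if_splits)
qed

text \<open>The fundamental lemma of the calculus of variations. Dominated convergence of bumps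
  handles open boxes, and the pi-lambda theorem passes from boxes to Borel sets.\<close>

lemma test_functions_separate:
  fixes h :: "real ^ 'n \<Rightarrow> complex"
  assumes h: "locally_integrable h"
    and z: "\<And>g. test_function g \<Longrightarrow> (\<integral>x. h x * g x \<partial>lborel) = 0"
  shows "AE x in lborel. h x = 0"
proof -
  have hm[measurable]: "h \<in> borel_measurable borel" by (rule locally_integrable_measurable[OF h])
  have hi: "set_integrable lborel A h" if "A \<subseteq> K" "compact K" "A \<in> sets lborel" for A K
    using h that set_integrable_subset[of lborel K h A] by (simp add: locally_integrable_def)
  have box: "(LINT x:box a b|lborel. h x) = 0" for a b
  proof -
    have "(\<lambda>m. \<integral>x. h x * box_bump a b (real (Suc m)) x \<partial>lborel) \<longlonglongrightarrow> (\<integral>x. h x * indicator (box a b) x \<partial>lborel)"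
    proof (rule integral_dominated_convergence[where w="\<lambda>x. norm (indicator (cbox a b) x *\<^sub>R h x)"])
      have "continuous_on UNIV (box_bump a b (real (Suc m)))" for m
        using test_function_box_bump[of "real (Suc m)" a b] by (auto simp: test_function_def C_on_iff_Ck dest: spec[of _ 0])
      then have [measurable]: "box_bump a b (real (Suc m)) \<in> borel_measurable borel" for m
        by (rule borel_measurable_continuous_onI)
      show "(\<lambda>x. h x * box_bump a b (real (Suc m)) x) \<in> borel_measurable lborel" for m
        by measurable
      show "integrable lborel (\<lambda>x. norm (indicator (cbox a b) x *\<^sub>R h x))"
        by (rule integrable_norm) (use hi[of "cbox a b" "cbox a b"] in \<open>simp add: set_integrable_def\<close>)
      show "AE x in lborel. norm (h x * box_bump a b (real (Suc m)) x) \<le> norm (indicator (cbox a b) x *\<^sub>R h x)" for m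
      proof (rule AE_I2)
        fix x
        have "box_bump a b (real (Suc m)) x = 0" if "x \<notin> cbox a b"
          by (rule box_bump_eq_0) (use that box_subset_cbox in auto)
        then show "norm (h x * box_bump a b (real (Suc m)) x) \<le> norm (indicator (cbox a b) x *\<^sub>R h x)"
          using norm_box_bump_le[of a b "real (Suc m)" x]
          by (cases "x \<in> cbox a b") (auto simp: norm_mult mult_left_le)
      qed
      show "AE x in lborel. (\<lambda>m. h x * box_bump a b (real (Suc m)) x) \<longlonglongrightarrow> h x * indicator (box a b) x"
        by (intro AE_I2 tendsto_intros box_bump_tendsto)
    qed simp
    moreover have "(\<integral>x. h x * box_bump a b (real (Suc m)) x \<partial>lborel) = 0" for m
      by (rule z) (simp add: test_function_box_bump)
    ultimately have "(\<integral>x. h x * indicator (box a b) x \<partial>lborel) = 0"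
      by (simp add: LIMSEQ_const_iff)
    moreover have "h x * indicator (box a b) x = indicator (box a b) x *\<^sub>R h x" for x
      by (simp add: indicator_def)
    ultimately show ?thesis unfolding set_lebesgue_integral_def by simp
  qed
  \<comment> \<open>Complements must be taken inside a set on which h is integrable. An open box is
    used because its intersections with boxes are boxes again.\<close>
  define K :: "nat \<Rightarrow> (real ^ 'n) set" where "K n = box (- (real n *\<^sub>R One)) (real n *\<^sub>R One)" for n
  have K: "K n \<in> sets lborel" "set_integrable lborel (A \<inter> K n) h" if "A \<in> sets borel" for n A
  proof -
    show "K n \<in> sets lborel" unfolding K_def by simp
    show "set_integrable lborel (A \<inter> K n) h"
      by (rule hi[of _ "cbox (- (real n *\<^sub>R One)) (real n *\<^sub>R One)"])
        (use that in \<open>simp_all add: K_def box_subset_cbox le_infI2\<close>)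
  qed
  have all: "(LINT x:A \<inter> K n|lborel. h x) = 0" if A: "A \<in> sets borel" for n A
  proof -
    have sig: "sigma_sets UNIV (range (\<lambda>(a, b). box a b)) = (sets borel :: (real^'n) set set)"
      unfolding borel_eq_box by (rule sets_measure_of[symmetric]) simp
    have A': "A \<in> sigma_sets UNIV (range (\<lambda>(a, b). box a b))"
      using A unfolding sig .
    have "Int_stable (range (\<lambda>(a, b). box a (b::real^'n)))"
      unfolding Int_stable_def by (auto simp: box_Int_box image_iff)
    moreover have "range (\<lambda>(a, b). box a (b::real^'n)) \<subseteq> Pow UNIV" by simp
    ultimately show ?thesis using A'
    proof (induction rule: sigma_sets_induct_disjoint)
      case (basic A)
      then obtain a b where A: "A = box a b" by auto
      have "A \<inter> K n = box (\<Sum>i\<in>Basis. max (a \<bullet> i) ((- (real n *\<^sub>R One)) \<bullet> i) *\<^sub>R i) (\<Sum>i\<in>Basis. min (b \<bullet> i) ((real n *\<^sub>R One) \<bullet> i) *\<^sub>R i)"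
        unfolding A K_def by (rule box_Int_box)
      then show ?case by (simp only: box)
    next
      case empty then show ?case by (simp add: set_lebesgue_integral_def)
    next
      case (compl A)
      have Ab: "A \<in> sets borel" using compl sig by auto
      have "(LINT x:K n|lborel. h x) = (LINT x:(A \<inter> K n) \<union> ((UNIV - A) \<inter> K n)|lborel. h x)"
        by (rule arg_cong[where f="\<lambda>A. LINT x:A|lborel. h x"]) auto
      also have "\<dots> = (LINT x:A \<inter> K n|lborel. h x) + (LINT x:(UNIV - A) \<inter> K n|lborel. h x)"
        by (rule set_integral_Un) (use Ab K in auto)
      finally show ?case using compl box by (simp add: K_def)
    next
      case (union A)
      have Ab: "A i \<in> sets borel" for i using union sig by auto
      have "(LINT x:(\<Union>i. A i \<inter> K n)|lborel. h x) = (\<Sum>i. (LINT x:A i \<inter> K n|lborel. h x))"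
      proof (rule lebesgue_integral_countable_add)
        show "A i \<inter> K n \<in> sets lborel" for i using Ab[of i] K(1)[OF Ab] by simp
        show "(A i \<inter> K n) \<inter> (A j \<inter> K n) = {}" if "i \<noteq> j" for i j
          using disjoint_family_onD[OF union(1) _ _ that] by auto
        have "(\<Union>i. A i) \<in> sets borel" using Ab by auto
        then show "set_integrable lborel (\<Union>i. A i \<inter> K n) h"
          using K(2)[of "\<Union>i. A i" n] by simp
      qed
      then show ?case using union by simp
    qed
  qed
  have ae: "AE x in lborel. indicator (K n) x *\<^sub>R h x = 0" for n
  proof -
    have int: "integrable lborel (\<lambda>x. indicator (K n) x *\<^sub>R h x)"
      using K[of UNIV n] by (simp add: set_integrable_def)
    have s: "(LINT x:A|lborel. indicator (K n) x *\<^sub>R h x) = 0" if "A \<in> sets lborel" for A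
      using all[of A n] that by (simp add: set_lebesgue_integral_def indicator_inter_arith mult_ac)
    have si: "integrable lborel (\<lambda>x. indicator A x *\<^sub>R (indicator (K n) x *\<^sub>R h x))" if "A \<in> sets lborel" for A
      using integrable_mult_indicator[OF that int] .
    have "AE x in lborel. Re (indicator (K n) x *\<^sub>R h x) = 0"
    proof (rule AE_zero_if_set_integrals_zero)
      fix A assume A: "A \<in> sets (lborel :: (real^'n) measure)"
      show "(LINT x:A|lborel. Re (indicator (K n) x *\<^sub>R h x)) = 0"
        using s[OF A] si[OF A] integral_Re[OF si[OF A]] unfolding set_lebesgue_integral_def by (simp add: mult.assoc)
    qed (rule integrable_Re[OF int])
    moreover have "AE x in lborel. Im (indicator (K n) x *\<^sub>R h x) = 0"
    proof (rule AE_zero_if_set_integrals_zero)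
      fix A assume A: "A \<in> sets (lborel :: (real^'n) measure)"
      show "(LINT x:A|lborel. Im (indicator (K n) x *\<^sub>R h x)) = 0"
        using s[OF A] si[OF A] integral_Im[OF si[OF A]] unfolding set_lebesgue_integral_def by (simp add: mult.assoc)
    qed (rule integrable_Im[OF int])
    ultimately show ?thesis by eventually_elim (simp add: complex_eq_iff)
  qed
  then have "AE x in lborel. \<forall>n. indicator (K n) x *\<^sub>R h x = 0" by (simp only: AE_all_countable simp_thms)
  then show ?thesis
  proof eventually_elim
    case (elim x)
    obtain n where "x \<in> K n" using UN_box_eq_UNIV unfolding K_def by blast
    then show ?case using elim[rule_format, of n] by simp
  qed
qed


subsection \<open>Inverse Fourier transforms of compactly supported functions\<close>

text \<open>The normalising factor \<open>(2\<pi>)\<^sup>-\<^sup>n\<close> is omitted.\<close>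

definition ift :: "(real ^ 'n \<Rightarrow> complex) \<Rightarrow> real ^ 'n \<Rightarrow> complex" where
  "ift g x = (\<integral>\<xi>. exp (\<i> * complex_of_real (x \<bullet> \<xi>)) * g \<xi> \<partial>lborel)"

lemma integrable_compact_support:
  fixes g :: "real ^ 'n \<Rightarrow> complex"
  assumes "continuous_on UNIV g" "\<And>x. R < norm x \<Longrightarrow> g x = 0"
  shows "integrable lborel g"
proof -
  have "set_integrable lborel (cball 0 R) g"
    unfolding set_integrable_def
    by (rule borel_integrable_compact) (auto intro: continuous_on_subset[OF assms(1)])
  moreover have "(\<lambda>x. indicator (cball 0 R) x *\<^sub>R g x) = g"
    using assms(2) by (auto simp: indicator_def fun_eq_iff)
  ultimately show ?thesis by (simp add: set_integrable_def)
qed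

text \<open>\<open>has_partial\<close> differentiates at parameter 0 only; recentring the line at x
  + t e_i reaches every parameter.\<close>

lemma has_partial_line:
  assumes "\<And>x. has_partial i h (h' x) x"
  shows "((\<lambda>t::real. h (x + t *\<^sub>R axis i 1)) has_vector_derivative h' (x + t *\<^sub>R axis i 1)) (at t)"
proof -
  have "((\<lambda>s. h ((x + t *\<^sub>R axis i 1) + (s - t) *\<^sub>R axis i 1)) has_vector_derivative 1 *\<^sub>R h' (x + t *\<^sub>R axis i 1)) (at t)"
    by (rule vector_diff_chain_at[of "\<lambda>s. s - t" 1 t "\<lambda>s. h ((x + t *\<^sub>R axis i 1) + s *\<^sub>R axis i 1)", unfolded o_def])
      (use assms in \<open>auto intro!: derivative_eq_intros\<close>)
  then show ?thesis by (simp add: algebra_simps)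
qed

lemma has_partial_diff_bound:
  assumes "\<And>x. has_partial i h (h' x) x" "\<And>x. norm (h' x) \<le> B" "0 \<le> B"
  shows "norm (h (x + t *\<^sub>R axis i 1) - h x) \<le> B * \<bar>t\<bar>"
proof -
  have "norm (h (x + t *\<^sub>R axis i 1) - h (x + 0 *\<^sub>R axis i 1)) \<le> B * norm (t - 0)"
  proof (rule differentiable_bound[of UNIV])
    fix s :: real
    show "((\<lambda>t. h (x + t *\<^sub>R axis i 1)) has_derivative (\<lambda>r. r *\<^sub>R h' (x + s *\<^sub>R axis i 1))) (at s within UNIV)"
      using has_partial_line[OF assms(1), of x s] by (simp add: has_vector_derivative_def)
    show "onorm (\<lambda>r. r *\<^sub>R h' (x + s *\<^sub>R axis i 1)) \<le> B"
      by (rule onorm_bound) (use assms in \<open>auto simp: mult.commute[of B] intro: mult_left_mono\<close>)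
  qed auto
  then show ?thesis by simp
qed

text \<open>The integral of \<open>h (x + t e\<^sub>i)\<close> does not depend on \<open>t\<close>; differentiate under the integral sign.\<close>

lemma integral_partial_deriv_eq_0:
  fixes h :: "real ^ 'n \<Rightarrow> complex"
  assumes h: "Ck 1 UNIV h" and supp: "\<And>x. R < norm x \<Longrightarrow> h x = 0"
    and bound: "\<And>x. norm (partial_deriv i h x) \<le> B"
  shows "(\<integral>x. partial_deriv i h x \<partial>lborel) = 0"
proof -
  note h' = Ck_SucD[OF h[unfolded One_nat_def]]
  have hi: "integrable lborel h" by (rule integrable_compact_support[OF h'(1) supp])
  have B: "0 \<le> B" using bound[of 0] norm_ge_zero order_trans by blast
  let ?e = "axis i 1 :: real ^ 'n"
  define q where "q m x = (h (x + (1 / real (Suc m)) *\<^sub>R ?e) - h x) /\<^sub>R (1 / real (Suc m))" for m x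
  have q0: "(\<integral>x. q m x \<partial>lborel) = 0" for m
  proof -
    have "integrable lborel (\<lambda>x. h ((1 / real (Suc m)) *\<^sub>R ?e + x))"
      using hi by (simp add: integrable_lborel_shift)
    then show ?thesis
      unfolding q_def using hi integral_lborel_shift[of h "(1 / real (Suc m)) *\<^sub>R ?e"]
      by (subst integral_scaleR_right, subst Bochner_Integration.integral_diff) (simp_all add: add.commute)
  qed
  \<comment> \<open>The increments 1 / (m + 1) are at most 1, so all difference quotients vanish
    outside the ball of radius R + 1, and the mean value inequality bounds them by B.\<close>
  have "(\<lambda>m. \<integral>x. q m x \<partial>lborel) \<longlonglongrightarrow> (\<integral>x. partial_deriv i h x \<partial>lborel)"
  proof (rule integral_dominated_convergence[where w="\<lambda>x. B * indicator (cball 0 (R + 1)) x"])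
    have "Ck 0 UNIV (partial_deriv i h)" using h'(3) .
    then show "partial_deriv i h \<in> borel_measurable lborel"
      by (simp add: borel_measurable_continuous_onI)
    have [measurable]: "h \<in> borel_measurable borel" using h'(1) by (rule borel_measurable_continuous_onI)
    show "q m \<in> borel_measurable lborel" for m unfolding q_def by measurable
    show "integrable lborel (\<lambda>x. B * indicator (cball 0 (R + 1)) x)"
      by (intro integrable_mult_right) (auto intro!: integrable_real_indicator emeasure_bounded_finite[unfolded less_top[symmetric]])
    show "AE x in lborel. norm (q m x) \<le> B * indicator (cball 0 (R + 1)) x" for m
    proof (rule AE_I2)
      fix x
      show "norm (q m x) \<le> B * indicator (cball 0 (R + 1)) x"
      proof (cases "x \<in> cball 0 (R + 1)")
        case True
        have "norm (h (x + (1 / real (Suc m)) *\<^sub>R ?e) - h x) \<le> B * \<bar>1 / real (Suc m)\<bar>"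
          by (rule has_partial_diff_bound[OF h'(2) bound B]) simp
        then have "real (Suc m) * norm (h (x + (1 / real (Suc m)) *\<^sub>R ?e) - h x) \<le> B"
          by (simp add: field_simps del: of_nat_Suc)
        then show ?thesis using True by (simp add: q_def del: of_nat_Suc)
      next
        case False
        have "norm x \<le> norm (x + (1 / real (Suc m)) *\<^sub>R ?e) + norm ((1 / real (Suc m)) *\<^sub>R ?e)"
          using norm_triangle_ineq4[of "x + (1 / real (Suc m)) *\<^sub>R ?e" "(1 / real (Suc m)) *\<^sub>R ?e"] by simp
        moreover have "norm ((1 / real (Suc m)) *\<^sub>R ?e) \<le> 1" by (simp add: field_simps)
        moreover have "R + 1 < norm x" using False by simp
        ultimately have "R < norm (x + (1 / real (Suc m)) *\<^sub>R ?e)" by linarith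
        then show ?thesis using False supp by (simp add: q_def)
      qed
    qed
    show "AE x in lborel. (\<lambda>m. q m x) \<longlonglongrightarrow> partial_deriv i h x"
    proof (rule AE_I2)
      fix x
      have "((\<lambda>t. (h (x + t *\<^sub>R ?e) - h x) /\<^sub>R t) \<longlongrightarrow> partial_deriv i h x) (at 0)"
      proof (rule Lim_null[THEN iffD2], rule tendsto_norm_zero_cancel, rule Lim_transform_eventually)
        show "((\<lambda>t. norm ((h (x + t *\<^sub>R ?e) - h x - t *\<^sub>R partial_deriv i h x) /\<^sub>R norm t)) \<longlongrightarrow> 0) (at 0)"
          using h'(2)[of x i] by (intro tendsto_norm_zero) (simp add: has_vector_derivative_def has_derivative_at_within)
        show "\<forall>\<^sub>F t in at 0. norm ((h (x + t *\<^sub>R ?e) - h x - t *\<^sub>R partial_deriv i h x) /\<^sub>R norm t) =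
            norm ((h (x + t *\<^sub>R ?e) - h x) /\<^sub>R t - partial_deriv i h x)"
        proof (rule eventually_at_filter[THEN iffD2], intro always_eventually allI impI)
          fix t :: real assume t: "t \<noteq> 0"
          have "(h (x + t *\<^sub>R ?e) - h x) /\<^sub>R t - partial_deriv i h x = (h (x + t *\<^sub>R ?e) - h x - t *\<^sub>R partial_deriv i h x) /\<^sub>R t"
            using t by (simp add: scaleR_diff_right)
          then show "norm ((h (x + t *\<^sub>R ?e) - h x - t *\<^sub>R partial_deriv i h x) /\<^sub>R norm t) =
            norm ((h (x + t *\<^sub>R ?e) - h x) /\<^sub>R t - partial_deriv i h x)"
            by (simp only:) simp
        qed
      qed
      moreover have "filterlim (\<lambda>m. 1 / real (Suc m)) (at 0) sequentially"
        unfolding filterlim_at using LIMSEQ_inverse_real_of_nat by (auto simp: inverse_eq_divide)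
      ultimately show "(\<lambda>m. q m x) \<longlonglongrightarrow> partial_deriv i h x"
        unfolding q_def by (rule filterlim_compose)
    qed
  qed
  then show ?thesis using q0 by (simp add: LIMSEQ_const_iff)
qed

lemma partial_deriv_support:
  assumes "\<And>x. R < norm x \<Longrightarrow> g x = 0" "R < norm x"
  shows "partial_deriv i g x = 0"
proof -
  have "open {x::real^'a. R < norm x}" by (intro open_Collect_less continuous_intros)
  then have "has_partial i g 0 x"
    by (rule has_partial_cong[where f="\<lambda>x. 0"]) (use assms in auto)
  then show ?thesis by (rule has_partial_imp)
qed

lemma cexp_has_partial:
  "has_partial i (\<lambda>\<xi>. exp (\<i> * complex_of_real (x \<bullet> \<xi>))) (\<i> * complex_of_real (x $ i) * exp (\<i> * complex_of_real (x \<bullet> \<xi>))) \<xi>"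
proof -
  have "((\<lambda>t. exp (\<i> * complex_of_real (x \<bullet> \<xi> + t * x $ i))) has_vector_derivative
     (\<i> * complex_of_real (x $ i)) * exp (\<i> * complex_of_real (x \<bullet> \<xi> + 0 * x $ i))) (at 0)"
    by (rule field_vector_diff_chain_at[where g=exp, unfolded o_def])
      (auto intro!: derivative_eq_intros)
  then show ?thesis by (simp add: inner_add_right inner_axis)
qed

text \<open>Integration by parts without boundary terms: the partial derivative of the compactly
  supported product of the exponential with g integrates to 0.\<close>

lemma ift_partial_deriv:
  fixes g :: "real ^ 'n \<Rightarrow> complex"
  assumes g: "Ck 1 UNIV g" and supp: "\<And>x. R < norm x \<Longrightarrow> g x = 0"
  shows "ift (partial_deriv i g) x = - (\<i> * complex_of_real (x $ i)) * ift g x"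
proof -
  note g' = Ck_SucD[OF g[unfolded One_nat_def]]
  let ?e = "\<lambda>\<xi>. exp (\<i> * complex_of_real (x \<bullet> \<xi>))"
  have ce: "continuous_on UNIV ?e" by (intro continuous_intros)
  have e1: "Ck 1 UNIV ?e"
    unfolding One_nat_def by (rule Ck_SucI[OF _ ce cexp_has_partial]) (auto intro!: continuous_intros)
  have h1: "Ck 1 UNIV (\<lambda>\<xi>. ?e \<xi> * g \<xi>)" using e1 g by (intro Ck_mult) auto
  have pd: "partial_deriv i (\<lambda>\<xi>. ?e \<xi> * g \<xi>) = (\<lambda>\<xi>. ?e \<xi> * partial_deriv i g \<xi> + \<i> * complex_of_real (x $ i) * (?e \<xi> * g \<xi>))"
    (is "_ = ?d")
    using has_partial_imp[OF has_partial_mult[OF cexp_has_partial g'(2)]] by (auto simp: fun_eq_iff mult_ac)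
  have s': "R < norm \<xi> \<Longrightarrow> partial_deriv i g \<xi> = 0" for \<xi> using partial_deriv_support[OF supp] .
  have cg: "continuous_on UNIV (partial_deriv i g)" using g'(3)[of i] by simp
  have i1: "integrable lborel (\<lambda>\<xi>. ?e \<xi> * g \<xi>)" and i2: "integrable lborel (\<lambda>\<xi>. ?e \<xi> * partial_deriv i g \<xi>)"
    using supp s' cg g'(1) by (auto intro!: integrable_compact_support[where R=R] continuous_intros)
  have cd: "continuous_on UNIV ?d" using cg g'(1) by (intro continuous_intros)
  have "compact (?d ` cball 0 R)" by (rule compact_continuous_image[OF continuous_on_subset[OF cd]]) auto
  then obtain B where B: "\<And>\<xi>. \<xi> \<in> cball 0 R \<Longrightarrow> norm (?d \<xi>) \<le> B"
    by (fastforce dest: compact_imp_bounded simp: bounded_iff)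
  have "norm (?d \<xi>) \<le> max 0 B" for \<xi>
    using B[of \<xi>] supp[of \<xi>] s'[of \<xi>] by (cases "norm \<xi> \<le> R") auto
  then have "(\<integral>\<xi>. ?d \<xi> \<partial>lborel) = 0"
    using integral_partial_deriv_eq_0[OF h1, of R i "max 0 B"] supp unfolding pd by simp
  moreover have "(\<integral>\<xi>. ?d \<xi> \<partial>lborel) = ift (partial_deriv i g) x + \<i> * complex_of_real (x $ i) * ift g x"
    unfolding ift_def using i1 i2 by (subst Bochner_Integration.integral_add) auto
  ultimately show ?thesis by (simp add: eq_neg_iff_add_eq_0)
qed

lemma ift_bound:
  fixes g :: "real ^ 'n \<Rightarrow> complex"
  assumes "continuous_on UNIV g" "\<And>x. R < norm x \<Longrightarrow> g x = 0" "\<And>x. norm (g x) \<le> B"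
  shows "norm (ift g x) \<le> B * measure lborel (cball (0 :: real ^ 'n) R)"
proof -
  have "norm (ift g x) \<le> (\<integral>\<xi>. norm (g \<xi>) \<partial>lborel)"
    unfolding ift_def by (rule order_trans[OF integral_norm_bound]) (simp add: norm_mult)
  also have "\<dots> \<le> (\<integral>\<xi>. B * indicator (cball (0 :: real ^ 'n) R) \<xi> \<partial>lborel)"
  proof (rule integral_mono)
    show "integrable lborel (\<lambda>\<xi>. norm (g \<xi>))"
      using integrable_compact_support[OF assms(1,2)] by auto
    show "integrable lborel (\<lambda>\<xi>. B * indicator (cball (0 :: real ^ 'n) R) \<xi>)"
      by (intro integrable_mult_right) (auto intro!: integrable_real_indicator emeasure_bounded_finite[unfolded less_top[symmetric]])
    show "norm (g \<xi>) \<le> B * indicator (cball 0 R) \<xi>" for \<xi>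
      using assms(2)[of \<xi>] assms(3)[of \<xi>] by (cases "norm \<xi> \<le> R") auto
  qed
  also have "\<dots> = B * measure lborel (cball (0 :: real ^ 'n) R)" by simp
  finally show ?thesis .
qed

lemma ift_component_decay:
  fixes g :: "real ^ 'n \<Rightarrow> complex"
  shows "Ck N UNIV g \<Longrightarrow> Bk N UNIV B g \<Longrightarrow> (\<And>x. R < norm x \<Longrightarrow> g x = 0) \<Longrightarrow>
    \<bar>x $ i\<bar> ^ N * norm (ift g x) \<le> B * measure lborel (cball (0 :: real ^ 'n) R)"
proof (induction N arbitrary: g)
  case 0 then show ?case using ift_bound[of g R B x] by simp
next
  case (Suc N)
  have "\<bar>x $ i\<bar> ^ N * norm (ift (partial_deriv i g) x) \<le> B * measure lborel (cball (0 :: real ^ 'n) R)"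
    using Suc.prems by (intro Suc.IH) (auto intro: partial_deriv_support)
  moreover have "ift (partial_deriv i g) x = - (\<i> * complex_of_real (x $ i)) * ift g x"
    by (rule ift_partial_deriv[OF Ck_mono[OF _ Suc.prems(1)] Suc.prems(3)]) auto
  ultimately show ?case by (simp add: norm_mult mult_ac)
qed

text \<open>The factor 2^N comes from 1 + t \<le> 2 max(1, t), the factor n^N from comparing |x|
  with its largest coordinate, and the volume from integrating over the support.\<close>

definition decay_const :: "'n::finite itself \<Rightarrow> nat \<Rightarrow> real \<Rightarrow> real" where
  "decay_const _ N R = 2 ^ N * (1 + real CARD('n) ^ N) * measure lborel (cball (0 :: real ^ 'n) R)"

lemma ift_decay:
  fixes g :: "real ^ 'n \<Rightarrow> complex"
  assumes C: "Ck N UNIV g" and B: "Bk N UNIV B g" and supp: "\<And>x. R < norm x \<Longrightarrow> g x = 0"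
  shows "(1 + norm x) ^ N * norm (ift g x) \<le> decay_const TYPE('n) N R * B"
proof -
  let ?V = "measure lborel (cball (0 :: real ^ 'n) R)"
  have a0: "norm (ift g x) \<le> B * ?V"
    using ift_bound[OF Ck_continuous[OF C] supp Bk_bound[OF B]] by simp
  have ac: "\<bar>x $ i\<bar> ^ N * norm (ift g x) \<le> B * ?V" for i
    by (rule ift_component_decay[OF C B supp])
  \<comment> \<open>A coordinate of largest modulus controls the norm up to the factor n, so
    integrating by parts in this single direction is enough.\<close>
  have "Max (range (\<lambda>j. \<bar>x $ j\<bar>)) \<in> range (\<lambda>j. \<bar>x $ j\<bar>)" by (rule Max_in) auto
  then obtain i where i': "Max (range (\<lambda>j. \<bar>x $ j\<bar>)) = \<bar>x $ i\<bar>" by (rule rangeE)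
  have i: "\<bar>x $ j\<bar> \<le> \<bar>x $ i\<bar>" for j
    unfolding i'[symmetric] by (rule Max_ge) auto
  have "norm x \<le> (\<Sum>j\<in>UNIV. \<bar>x $ j\<bar>)" by (rule norm_le_l1_cart)
  also have "\<dots> \<le> (\<Sum>j\<in>(UNIV::'n set). \<bar>x $ i\<bar>)" by (rule sum_mono) (rule i)
  finally have n: "norm x \<le> real CARD('n) * \<bar>x $ i\<bar>" by simp
  have "(1 + norm x) ^ N \<le> (2 * max 1 (norm x)) ^ N" by (rule power_mono) auto
  also have "\<dots> \<le> 2 ^ N * (1 + norm x ^ N)"
    by (auto simp: power_mult_distrib max_def)
  also have "\<dots> \<le> 2 ^ N * (1 + real CARD('n) ^ N * \<bar>x $ i\<bar> ^ N)"
    using power_mono[OF n, of N] by (simp add: power_mult_distrib)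
  finally have "(1 + norm x) ^ N * norm (ift g x) \<le> 2 ^ N * (1 + real CARD('n) ^ N * \<bar>x $ i\<bar> ^ N) * norm (ift g x)"
    by (rule mult_right_mono) simp
  also have "\<dots> = 2 ^ N * (norm (ift g x) + real CARD('n) ^ N * (\<bar>x $ i\<bar> ^ N * norm (ift g x)))"
    by (simp add: algebra_simps)
  also have "\<dots> \<le> 2 ^ N * (B * ?V + real CARD('n) ^ N * (B * ?V))"
    using a0 ac by (intro mult_left_mono add_mono) auto
  also have "\<dots> = decay_const TYPE('n) N R * B" by (simp add: decay_const_def algebra_simps)
  finally show ?thesis .
qed

lemma ift_measurable[measurable]:
  assumes [measurable]: "g \<in> borel_measurable borel"
  shows "ift g \<in> borel_measurable borel"
  unfolding ift_def by measurable

lemma ift_scaled: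
  fixes g :: "real ^ 'n \<Rightarrow> complex"
  assumes c: "0 < c"
  shows "ift (\<lambda>\<xi>. g ((1 / c) *\<^sub>R \<xi>)) x = (c ^ CARD('n)) *\<^sub>R ift g (c *\<^sub>R x)"
  unfolding ift_def
  by (subst integral_lborel_affine[where c=c and t=0]) (use c in simp_all)

lemma ift_convolution:
  fixes a \<psi> :: "real ^ 'n \<Rightarrow> complex"
  assumes a: "integrable lborel a" and p: "integrable lborel \<psi>"
  shows "(\<integral>y. \<psi> y * ift a (x - y) \<partial>lborel) = ift (\<lambda>\<xi>. fourier \<psi> \<xi> * a \<xi>) x"
proof -
  have [measurable]: "a \<in> borel_measurable borel" "\<psi> \<in> borel_measurable borel"
    using borel_measurable_integrable[OF a] borel_measurable_integrable[OF p] by auto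
  let ?F = "\<lambda>(y, \<xi>). \<psi> y * (exp (\<i> * complex_of_real ((x - y) \<bullet> \<xi>)) * a \<xi>)"
  have int: "integrable (lborel \<Otimes>\<^sub>M lborel) ?F"
  proof (rule lborel_pair.Fubini_integrable)
    show "?F \<in> borel_measurable (lborel \<Otimes>\<^sub>M lborel)" by measurable
    show "integrable lborel (\<lambda>y. \<integral>\<xi>. norm (?F (y, \<xi>)) \<partial>lborel)"
      using p a by (simp add: norm_mult)
    show "AE y in lborel. integrable lborel (\<lambda>\<xi>. ?F (y, \<xi>))"
      by (intro AE_I2, rule integrable_dominated[OF integrable_mult_right[OF integrable_norm[OF a], of "norm (\<psi> _)"]])
        (auto simp: norm_mult)
  qed
  have "(\<integral>y. \<psi> y * ift a (x - y) \<partial>lborel) = (\<integral>y. \<integral>\<xi>. ?F (y, \<xi>) \<partial>lborel \<partial>lborel)"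
    unfolding ift_def by simp
  also have "\<dots> = (\<integral>\<xi>. \<integral>y. ?F (y, \<xi>) \<partial>lborel \<partial>lborel)"
    using lborel_pair.Fubini_integral[of "\<lambda>y \<xi>. ?F (y, \<xi>)"] int by simp
  also have "\<dots> = ift (\<lambda>\<xi>. fourier \<psi> \<xi> * a \<xi>) x"
    unfolding ift_def fourier_def
  proof (rule Bochner_Integration.integral_cong[OF refl])
    fix \<xi>
    have "(\<integral>y. ?F (y, \<xi>) \<partial>lborel) = (\<integral>y. (exp (\<i> * complex_of_real (x \<bullet> \<xi>)) * a \<xi>) * (exp (- \<i> * complex_of_real (y \<bullet> \<xi>)) * \<psi> y) \<partial>lborel)"
      by (rule Bochner_Integration.integral_cong) (auto simp: inner_diff_left exp_diff exp_minus algebra_simps divide_inverse)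
    then show "(\<integral>y. ?F (y, \<xi>) \<partial>lborel) = exp (\<i> * complex_of_real (x \<bullet> \<xi>)) * ((\<integral>x. exp (- \<i> * complex_of_real (x \<bullet> \<xi>)) * \<psi> x \<partial>lborel) * a \<xi>)"
      by (simp only: integral_mult_right_zero) (simp add: mult_ac)
  qed
  finally show ?thesis .
qed

subsection \<open>Fourier inversion at the origin\<close>

lemma integral_lborel_prod:
  fixes f :: "'a::euclidean_space \<Rightarrow> real \<Rightarrow> complex"
  assumes f: "\<And>b. b \<in> Basis \<Longrightarrow> integrable lborel (f b)"
  shows "(\<integral>x. (\<Prod>b\<in>Basis. f b (x \<bullet> b)) \<partial>lborel) = (\<Prod>b\<in>Basis. \<integral>t. f b t \<partial>lborel)"
    and "integrable lborel (\<lambda>x::'a. \<Prod>b\<in>Basis. f b (x \<bullet> b))"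
proof -
  interpret product_sigma_finite "\<lambda>_::'a. lborel :: real measure" by standard
  have [measurable]: "f b \<in> borel_measurable borel" if "b \<in> Basis" for b
    using borel_measurable_integrable[OF f[OF that]] by simp
  have m: "(\<lambda>f. \<Sum>b\<in>Basis. f b *\<^sub>R b) \<in> measurable (\<Pi>\<^sub>M b\<in>(Basis::'a set). lborel :: real measure) borel"
    by measurable
  have s: "(\<Prod>b\<in>Basis. f b ((\<Sum>b'\<in>Basis. y b' *\<^sub>R b') \<bullet> b)) = (\<Prod>b\<in>Basis. f b (y b))" for y :: "'a \<Rightarrow> real"
    by (rule prod.cong) auto
  have mm: "(\<lambda>x::'a. \<Prod>b\<in>Basis. f b (x \<bullet> b)) \<in> borel_measurable borel" by measurable
  show "(\<integral>x. (\<Prod>b\<in>Basis. f b (x \<bullet> b)) \<partial>lborel) = (\<Prod>b\<in>Basis. \<integral>t. f b t \<partial>lborel)"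
    by (subst lborel_eq, subst integral_distr[OF m mm]) (simp only: s product_integral_prod[OF finite_Basis f])
  show "integrable lborel (\<lambda>x::'a. \<Prod>b\<in>Basis. f b (x \<bullet> b))"
    by (subst lborel_eq, subst integrable_distr_eq[OF m mm]) (simp only: s product_integrable_prod[OF finite_Basis f])
qed

definition gauss :: "'a::euclidean_space \<Rightarrow> complex" where
  "gauss x = complex_of_real (exp (- (norm x)\<^sup>2 / 2))"

text \<open>Up to the factor sqrt(2 pi), this is the characteristic function of the standard normal
  distribution.\<close>

lemma gauss_fourier_real:
  "(\<integral>t. exp (\<i> * complex_of_real (t * s)) * gauss t \<partial>lborel) = complex_of_real (sqrt (2 * pi)) * gauss s"
  "integrable lborel (\<lambda>t::real. exp (\<i> * complex_of_real (t * s)) * gauss t)"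
proof -
  have *: "exp (\<i> * complex_of_real (t * s)) * gauss t = complex_of_real (sqrt (2 * pi)) * (std_normal_density t *\<^sub>R iexp (s * t))" for t :: real
    by (simp add: gauss_def std_normal_density_def scaleR_conv_of_real mult_ac)
  have i: "integrable lborel (\<lambda>t. std_normal_density t *\<^sub>R iexp (s * t))"
    by (rule integrable_dominated[OF integrable_normal_density[of 1 0]]) auto
  show "integrable lborel (\<lambda>t::real. exp (\<i> * complex_of_real (t * s)) * gauss t)"
    unfolding * by (intro integrable_mult_right i)
  have "char std_normal_distribution s = (\<integral>t. std_normal_density t *\<^sub>R iexp (s * t) \<partial>lborel)"
    unfolding char_def by (subst integral_density) auto
  then have "(\<integral>t. std_normal_density t *\<^sub>R iexp (s * t) \<partial>lborel) = gauss s"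
    by (simp add: char_std_normal_distribution gauss_def)
  then show "(\<integral>t. exp (\<i> * complex_of_real (t * s)) * gauss t \<partial>lborel) = complex_of_real (sqrt (2 * pi)) * gauss s"
    unfolding * by (simp only: integral_mult_right_zero)
qed

lemma gauss_fourier:
  fixes \<xi> :: "'a::euclidean_space"
  shows "(\<integral>x. exp (\<i> * complex_of_real (x \<bullet> \<xi>)) * gauss x \<partial>lborel) = complex_of_real (sqrt (2 * pi)) ^ DIM('a) * gauss \<xi>"
    and "integrable lborel (\<lambda>x. exp (\<i> * complex_of_real (x \<bullet> \<xi>)) * gauss x)"
proof -
  have g: "gauss x = (\<Prod>b\<in>Basis. gauss (x \<bullet> b))" for x :: 'a
  proof -
    have "(norm x)\<^sup>2 = (\<Sum>b\<in>Basis. (x \<bullet> b)\<^sup>2)"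
      by (subst power2_norm_eq_inner, subst euclidean_inner) (simp add: power2_eq_square)
    then show ?thesis
      by (simp add: gauss_def exp_sum[symmetric] of_real_prod[symmetric] sum_negf sum_divide_distrib del: of_real_prod)
  qed
  have *: "exp (\<i> * complex_of_real (x \<bullet> \<xi>)) * gauss x = (\<Prod>b\<in>Basis. exp (\<i> * complex_of_real ((x \<bullet> b) * (\<xi> \<bullet> b))) * gauss (x \<bullet> b))" for x
    by (subst euclidean_inner, subst g) (simp add: prod.distrib exp_sum[symmetric] sum_distrib_left)
  show "(\<integral>x. exp (\<i> * complex_of_real (x \<bullet> \<xi>)) * gauss x \<partial>lborel) = complex_of_real (sqrt (2 * pi)) ^ DIM('a) * gauss \<xi>"
    unfolding * by (subst integral_lborel_prod(1))
      (simp_all add: gauss_fourier_real prod.distrib g[symmetric] del: of_real_mult)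
  show "integrable lborel (\<lambda>x. exp (\<i> * complex_of_real (x \<bullet> \<xi>)) * gauss x)"
    unfolding * by (intro integral_lborel_prod(2) gauss_fourier_real)
qed

lemma gauss_measurable[measurable]: "gauss \<in> borel_measurable borel"
  unfolding gauss_def by measurable

lemma gauss_0[simp]: "gauss 0 = 1"
  by (simp add: gauss_def)

lemma norm_gauss_le: "norm (gauss x) \<le> 1"
  by (simp add: gauss_def)

lemma integral_gauss:
  "integrable lborel (gauss :: 'a::euclidean_space \<Rightarrow> complex)"
  "(\<integral>x. gauss (x::'a) \<partial>lborel) = complex_of_real (sqrt (2 * pi)) ^ DIM('a)"
  using gauss_fourier[of "0::'a"] by auto

text \<open>Gaussian regularisation: Fubini turns the integral of \<open>ift b\<close> against a
  Gaussian of width 1 / e into a Gaussian average of b at scale e, which tends to b 0 by continuity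
  as e tends to 0. Integrability of \<open>ift b\<close> permits the limit on the other
  side.\<close>

lemma integral_ift:
  fixes b :: "real ^ 'n \<Rightarrow> complex"
  assumes c: "continuous_on UNIV b" and supp: "\<And>x. R < norm x \<Longrightarrow> b x = 0"
    and int: "integrable lborel (ift b)"
  shows "(\<integral>x. ift b x \<partial>lborel) = complex_of_real (2 * pi) ^ CARD('n) * b 0"
proof -
  have bi: "integrable lborel b" by (rule integrable_compact_support[OF c supp])
  have [measurable]: "b \<in> borel_measurable borel" using c by (rule borel_measurable_continuous_onI)
  \<comment> \<open>This constant appears twice, once from the transform of the Gaussian and once as
    its total mass, which gives (2 pi)^n in the end.\<close>
  let ?s = "complex_of_real (sqrt (2 * pi)) ^ CARD('n)"
  have ss: "?s * ?s = complex_of_real (2 * pi) ^ CARD('n)"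
    by (simp add: power_mult_distrib[symmetric] of_real_mult[symmetric] del: of_real_mult)
  have eq: "(\<integral>x. ift b x * gauss (e *\<^sub>R x) \<partial>lborel) = ?s * (\<integral>\<eta>. b (e *\<^sub>R \<eta>) * gauss \<eta> \<partial>lborel)" if e: "0 < e" for e :: real
  proof -
    have gi: "integrable lborel (\<lambda>x. gauss (e *\<^sub>R (x :: real ^ 'n)) :: complex)"
      using integrable_lborel_affine[OF integral_gauss(1), of e "0 :: real ^ 'n"] e by simp
    let ?F = "\<lambda>(x, \<xi>). exp (\<i> * complex_of_real (x \<bullet> \<xi>)) * b \<xi> * gauss (e *\<^sub>R x)"
    have "integrable (lborel \<Otimes>\<^sub>M lborel) ?F"
    proof (rule lborel_pair.Fubini_integrable)
      show "?F \<in> borel_measurable (lborel \<Otimes>\<^sub>M lborel)" by measurable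
      show "integrable lborel (\<lambda>x. \<integral>\<xi>. norm (?F (x, \<xi>)) \<partial>lborel)"
        using gi by (simp add: norm_mult)
      show "AE x in lborel. integrable lborel (\<lambda>\<xi>. ?F (x, \<xi>))"
        by (intro AE_I2, rule integrable_dominated[OF integrable_mult_left[OF integrable_norm[OF bi], of "norm (gauss (e *\<^sub>R _))"]])
          (auto simp: norm_mult)
    qed
    then have "(\<integral>x. \<integral>\<xi>. ?F (x, \<xi>) \<partial>lborel \<partial>lborel) = (\<integral>\<xi>. \<integral>x. ?F (x, \<xi>) \<partial>lborel \<partial>lborel)"
      using lborel_pair.Fubini_integral[of "\<lambda>x \<xi>. ?F (x, \<xi>)"] by simp
    moreover have "(\<integral>x. \<integral>\<xi>. ?F (x, \<xi>) \<partial>lborel \<partial>lborel) = (\<integral>x. ift b x * gauss (e *\<^sub>R x) \<partial>lborel)"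
      unfolding ift_def by simp
    moreover have "(\<integral>x. ?F (x, \<xi>) \<partial>lborel) = (1 / e) ^ CARD('n) *\<^sub>R (?s * (b \<xi> * gauss ((1 / e) *\<^sub>R \<xi>)))" for \<xi>
    proof -
      have "(\<integral>x. ?F (x, \<xi>) \<partial>lborel) = b \<xi> * (\<integral>x. exp (\<i> * complex_of_real (x \<bullet> \<xi>)) * gauss (e *\<^sub>R x) \<partial>lborel)"
        by (subst integral_mult_right_zero[symmetric]) (simp add: mult_ac)
      also have "(\<integral>x. exp (\<i> * complex_of_real (x \<bullet> \<xi>)) * gauss (e *\<^sub>R x) \<partial>lborel) =
          (1 / e) ^ CARD('n) *\<^sub>R (\<integral>x. exp (\<i> * complex_of_real (x \<bullet> ((1 / e) *\<^sub>R \<xi>))) * gauss x \<partial>lborel)"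
        by (subst integral_lborel_affine[where c="1 / e" and t=0]) (use e in simp_all)
      finally show ?thesis using gauss_fourier(1)[of "(1 / e) *\<^sub>R \<xi>"] by (simp add: mult_ac)
    qed
    ultimately have "(\<integral>x. ift b x * gauss (e *\<^sub>R x) \<partial>lborel) = (\<integral>\<xi>. (1 / e) ^ CARD('n) *\<^sub>R (?s * (b \<xi> * gauss ((1 / e) *\<^sub>R \<xi>))) \<partial>lborel)"
      by simp
    also have "\<dots> = ?s * (\<integral>\<eta>. b (e *\<^sub>R \<eta>) * gauss \<eta> \<partial>lborel)"
      by (subst integral_lborel_affine[where c="e" and t=0]) (use e in \<open>simp_all add: power_divide\<close>)
    finally show ?thesis .
  qed
  let ?e = "\<lambda>m. 1 / real (Suc m)"
  have e0: "?e \<longlonglongrightarrow> 0" using LIMSEQ_inverse_real_of_nat by (simp add: inverse_eq_divide)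
  have "compact (b ` cball 0 R)" by (rule compact_continuous_image[OF continuous_on_subset[OF c]]) auto
  then obtain B where B: "\<And>\<xi>. \<xi> \<in> cball 0 R \<Longrightarrow> norm (b \<xi>) \<le> B"
    by (fastforce dest: compact_imp_bounded simp: bounded_iff)
  have B': "norm (b \<xi>) \<le> max 0 B" for \<xi> using B[of \<xi>] supp[of \<xi>] by (cases "norm \<xi> \<le> R") auto
  have lim1: "(\<lambda>m. \<integral>x. ift b x * gauss (?e m *\<^sub>R x) \<partial>lborel) \<longlonglongrightarrow> (\<integral>x. ift b x \<partial>lborel)"
  proof (rule integral_dominated_convergence[where w="\<lambda>x. norm (ift b x)"])
    show "AE x in lborel. norm (ift b x * gauss (?e m *\<^sub>R x)) \<le> norm (ift b x)" for m
      using norm_gauss_le by (auto simp: norm_mult intro!: AE_I2 mult_left_le)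
    show "AE x in lborel. (\<lambda>m. ift b x * gauss (?e m *\<^sub>R x)) \<longlonglongrightarrow> ift b x"
    proof (rule AE_I2)
      fix x
      have "(\<lambda>m. ift b x * complex_of_real (exp (- (norm (?e m *\<^sub>R x))\<^sup>2 / 2))) \<longlonglongrightarrow> ift b x * complex_of_real (exp (- (norm (0 *\<^sub>R x))\<^sup>2 / 2))"
        by (intro tendsto_intros e0) auto
      then show "(\<lambda>m. ift b x * gauss (?e m *\<^sub>R x)) \<longlonglongrightarrow> ift b x" by (simp add: gauss_def)
    qed
  qed (use int in auto)
  have lim2: "(\<lambda>m. \<integral>\<eta>. b (?e m *\<^sub>R \<eta>) * gauss \<eta> \<partial>lborel) \<longlonglongrightarrow> (\<integral>\<eta>. b 0 * gauss (\<eta>::real^'n) \<partial>lborel)"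
  proof (rule integral_dominated_convergence[where w="\<lambda>\<eta>. max 0 B * norm (gauss \<eta> :: complex)"])
    show "integrable lborel (\<lambda>\<eta>::real^'n. max 0 B * norm (gauss \<eta> :: complex))"
      using integral_gauss(1) by auto
    show "AE \<eta> in lborel. norm (b (?e m *\<^sub>R \<eta>) * gauss \<eta>) \<le> max 0 B * norm (gauss \<eta>)" for m
      using B' by (auto simp: norm_mult intro!: AE_I2 mult_right_mono)
    show "AE \<eta> in lborel. (\<lambda>m. b (?e m *\<^sub>R \<eta>) * gauss \<eta>) \<longlonglongrightarrow> b 0 * gauss \<eta>"
    proof (rule AE_I2, rule tendsto_mult[OF _ tendsto_const])
      fix \<eta> :: "real^'n"
      have "(\<lambda>m. ?e m *\<^sub>R \<eta>) \<longlonglongrightarrow> 0 *\<^sub>R \<eta>" by (intro tendsto_intros e0)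
      then show "(\<lambda>m. b (?e m *\<^sub>R \<eta>)) \<longlonglongrightarrow> b 0"
        using continuous_on_tendsto_compose[OF c, of "\<lambda>m. ?e m *\<^sub>R \<eta>" 0 sequentially] by simp
    qed
  qed auto
  have "(\<lambda>m. \<integral>x. ift b x * gauss (?e m *\<^sub>R x) \<partial>lborel) \<longlonglongrightarrow> ?s * (b 0 * ?s)"
    using tendsto_mult_left[OF lim2, of ?s] integral_gauss(2)[where 'a="real^'n"] by (simp add: eq)
  from LIMSEQ_unique[OF lim1 this] show ?thesis using ss by (simp add: mult_ac)
qed


subsection \<open>Correlation with a kernel\<close>

text \<open>With the convention of \<^const>\<open>dist_conv\<close>, pairing with \<open>\<psi> * f\<close> is \<open>\<phi> \<mapsto> f (\<psi> * \<phi>)\<close>, so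
  on functions it acts as the correlation below.\<close>

definition corr :: "('a::euclidean_space \<Rightarrow> complex) \<Rightarrow> ('a \<Rightarrow> complex) \<Rightarrow> 'a \<Rightarrow> complex" where
  "corr h F w = (\<integral>z. h z * F (w + z) \<partial>lborel)"

text \<open>\<open>wint l\<close> and \<open>poly_bounded l\<close> are matched classes: since
  \<open>wgt l\<close> is submultiplicative, correlating a member of the first with a member of the
  second converges absolutely at every point and stays in the second class.\<close>

definition wint :: "real \<Rightarrow> ('a::euclidean_space \<Rightarrow> complex) \<Rightarrow> bool" where
  "wint l h \<longleftrightarrow> h \<in> borel_measurable borel \<and> integrable lborel (\<lambda>x. wgt l x * norm (h x))"

definition poly_bounded :: "real \<Rightarrow> ('a::euclidean_space \<Rightarrow> complex) \<Rightarrow> bool" where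
  "poly_bounded l F \<longleftrightarrow> F \<in> borel_measurable borel \<and> (\<exists>A. \<forall>y. norm (F y) \<le> A * wgt l y)"

lemma wint_measurable[measurable_dest]: "wint l h \<Longrightarrow> h \<in> borel_measurable borel"
  by (simp add: wint_def)

lemma poly_bounded_measurable[measurable_dest]: "poly_bounded l F \<Longrightarrow> F \<in> borel_measurable borel"
  by (simp add: poly_bounded_def)

lemma poly_boundedE:
  assumes "poly_bounded l F"
  obtains A where "0 \<le> A" "\<And>y. norm (F y) \<le> A * wgt l y"
proof -
  from assms obtain A where A: "\<And>y. norm (F y) \<le> A * wgt l y" by (auto simp: poly_bounded_def)
  have "norm (F y) \<le> max 0 A * wgt l y" for y
    using A[of y] by (rule order_trans) (auto intro: mult_right_mono)
  then show ?thesis using that[of "max 0 A"] by auto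
qed

lemma wint_integrable:
  assumes l: "0 \<le> l" and h: "wint l h"
  shows "integrable lborel h"
proof (rule integrable_dominated)
  show "norm (h x) \<le> wgt l x * norm (h x)" for x
    using mult_right_mono[OF wgt_ge1[OF l] norm_ge_zero] by simp
qed (use h in \<open>simp_all add: wint_def\<close>)

lemma wint_add: "wint l h \<Longrightarrow> wint l g \<Longrightarrow> wint l (\<lambda>x. h x + g x)"
proof -
  assume h: "wint l h" and g: "wint l g"
  note [measurable] = wint_measurable[OF h] wint_measurable[OF g]
  have "integrable lborel (\<lambda>x. wgt l x * norm (h x + g x))"
  proof (rule integrable_dominated)
    show "integrable lborel (\<lambda>x. wgt l x * norm (h x) + wgt l x * norm (g x))"
      using h g by (simp add: wint_def)
    show "norm (wgt l x * norm (h x + g x)) \<le> wgt l x * norm (h x) + wgt l x * norm (g x)" for x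
      by (simp add: distrib_left[symmetric] norm_triangle_ineq)
  qed measurable
  then show ?thesis by (simp add: wint_def)
qed

lemma wint_zero: "wint l (\<lambda>x. 0)"
  by (simp add: wint_def)

lemma wint_sum: "(\<And>k. k \<in> A \<Longrightarrow> wint l (h k)) \<Longrightarrow> wint l (\<lambda>x. \<Sum>k\<in>A. h k x)"
  by (induction A rule: infinite_finite_induct) (auto intro: wint_add wint_zero)

lemma corr_integrand_bound:
  fixes h F :: "'a::euclidean_space \<Rightarrow> complex"
  assumes l: "0 \<le> l" and F: "\<And>y. norm (F y) \<le> A * wgt l y" and A: "0 \<le> A"
  shows "norm (h z * F (w + z)) \<le> A * wgt l w * (wgt l z * norm (h z))"
proof -
  have "norm (h z * F (w + z)) \<le> norm (h z) * (A * (wgt l w * wgt l z))"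
    unfolding norm_mult
    by (rule mult_left_mono[OF order_trans[OF F mult_left_mono[OF wgt_add[OF l] A]]]) simp
  then show ?thesis by (simp add: mult_ac)
qed

lemma corr_integrable:
  assumes l: "0 \<le> l" and h: "wint l h" and F: "poly_bounded l F"
  shows "integrable lborel (\<lambda>z. h z * F (w + z))"
proof -
  note [measurable] = wint_measurable[OF h] poly_bounded_measurable[OF F]
  obtain A where A: "0 \<le> A" "\<And>y. norm (F y) \<le> A * wgt l y" using poly_boundedE[OF F] by blast
  show ?thesis
  proof (rule integrable_dominated)
    show "integrable lborel (\<lambda>z. A * wgt l w * (wgt l z * norm (h z)))"
      using h by (simp add: wint_def)
  qed (measurable, rule corr_integrand_bound[OF l A(2,1)])
qed

lemma poly_bounded_corr:
  assumes l: "0 \<le> l" and h: "wint l h" and F: "poly_bounded l F"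
  shows "poly_bounded l (corr h F)"
proof -
  note [measurable] = wint_measurable[OF h] poly_bounded_measurable[OF F]
  obtain A where A: "0 \<le> A" "\<And>y. norm (F y) \<le> A * wgt l y" using poly_boundedE[OF F] by blast
  have "norm (corr h F w) \<le> (A * (\<integral>z. wgt l z * norm (h z) \<partial>lborel)) * wgt l w" for w
  proof -
    have "norm (corr h F w) \<le> (\<integral>z. A * wgt l w * (wgt l z * norm (h z)) \<partial>lborel)"
      unfolding corr_def
    proof (rule order_trans[OF integral_norm_bound], rule integral_mono)
      show "integrable lborel (\<lambda>z. norm (h z * F (w + z)))" by (rule integrable_norm[OF corr_integrable[OF l h F]])
      show "integrable lborel (\<lambda>z. A * wgt l w * (wgt l z * norm (h z)))" using h by (simp add: wint_def)
    qed (rule corr_integrand_bound[OF l A(2,1)])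
    then show ?thesis unfolding integral_mult_right_zero by (simp only: mult_ac)
  qed
  moreover have "corr h F \<in> borel_measurable borel" unfolding corr_def by measurable
  ultimately show ?thesis unfolding poly_bounded_def by blast
qed

lemma corr_add:
  assumes "0 \<le> l" "wint l h" "wint l g" "poly_bounded l F"
  shows "corr (\<lambda>x. h x + g x) F w = corr h F w + corr g F w"
  unfolding corr_def distrib_right
  by (intro Bochner_Integration.integral_add corr_integrable[OF assms(1) _ assms(4)] assms(2,3))

lemma corr_sum:
  assumes "0 \<le> l" "poly_bounded l F" "\<And>k. k \<in> A \<Longrightarrow> wint l (h k)"
  shows "corr (\<lambda>x. \<Sum>k\<in>A. h k x) F w = (\<Sum>k\<in>A. corr (h k) F w)"
  unfolding corr_def sum_distrib_right
  by (intro Bochner_Integration.integral_sum corr_integrable[OF assms(1) _ assms(2)] assms(3))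

lemma corr_cong_AE:
  assumes "AE y in lborel. F y = G y" "F \<in> borel_measurable borel" "G \<in> borel_measurable borel" "h \<in> borel_measurable borel"
  shows "corr h F w = corr h G w"
  unfolding corr_def
  by (rule integral_cong_AE) (use AE_lborel_shift[OF assms(1), of w] assms in \<open>auto elim: eventually_mono\<close>)

text \<open>Both sides are iterated integrals of h z * g y * F (w + z + y), which the weights make
  absolutely integrable.\<close>

lemma corr_commute:
  assumes l: "0 \<le> l" and h: "wint l h" and g: "wint l g" and F: "poly_bounded l F"
  shows "corr h (corr g F) w = corr g (corr h F) w"
proof -
  note [measurable] = wint_measurable[OF h] wint_measurable[OF g] poly_bounded_measurable[OF F]
  obtain A where A: "0 \<le> A" "\<And>y. norm (F y) \<le> A * wgt l y" using poly_boundedE[OF F] by blast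
  let ?I = "\<lambda>(z, y). h z * (g y * F (w + z + y))"
  let ?W = "\<integral>y. wgt l y * norm (g y) \<partial>lborel"
  have int: "integrable lborel (\<lambda>y. ?I (z, y))" for z
    using corr_integrable[OF l g F, of "w + z"] by simp
  have "integrable (lborel \<Otimes>\<^sub>M lborel) ?I"
  proof (rule lborel_pair.Fubini_integrable)
    show "?I \<in> borel_measurable (lborel \<Otimes>\<^sub>M lborel)" by measurable
    show "AE z in lborel. integrable lborel (\<lambda>y. ?I (z, y))" using int by simp
    show "integrable lborel (\<lambda>z. \<integral>y. norm (?I (z, y)) \<partial>lborel)"
    proof (rule integrable_dominated)
      show "integrable lborel (\<lambda>z. (A * ?W * wgt l w) * (wgt l z * norm (h z)))"
        using h by (simp add: wint_def)
      show "norm (\<integral>y. norm (?I (z, y)) \<partial>lborel) \<le> (A * ?W * wgt l w) * (wgt l z * norm (h z))" for z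
      proof -
        have "(\<integral>y. norm (?I (z, y)) \<partial>lborel) \<le> (\<integral>y. norm (h z) * (A * wgt l (w + z) * (wgt l y * norm (g y))) \<partial>lborel)"
        proof (rule integral_mono)
          show "integrable lborel (\<lambda>y. norm (?I (z, y)))" by (rule integrable_norm[OF int])
          show "integrable lborel (\<lambda>y. norm (h z) * (A * wgt l (w + z) * (wgt l y * norm (g y))))"
            using g by (simp add: wint_def)
          show "norm (?I (z, y)) \<le> norm (h z) * (A * wgt l (w + z) * (wgt l y * norm (g y)))" for y
            using corr_integrand_bound[OF l A(2,1), of g y "w + z"] by (simp only: prod.case norm_mult mult_left_mono norm_ge_zero)
        qed
        also have "\<dots> = norm (h z) * A * ?W * wgt l (w + z)" by simp
        also have "\<dots> \<le> norm (h z) * A * ?W * (wgt l w * wgt l z)"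
          by (intro mult_left_mono wgt_add l mult_nonneg_nonneg A Bochner_Integration.integral_nonneg) auto
        finally show ?thesis by (simp add: mult_ac)
      qed
    qed measurable
  qed
  then have "(\<integral>z. \<integral>y. ?I (z, y) \<partial>lborel \<partial>lborel) = (\<integral>y. \<integral>z. ?I (z, y) \<partial>lborel \<partial>lborel)"
    using lborel_pair.Fubini_integral[of "\<lambda>z y. ?I (z, y)"] by simp
  moreover have "(\<integral>z. \<integral>y. ?I (z, y) \<partial>lborel \<partial>lborel) = corr h (corr g F) w"
    unfolding corr_def by simp
  moreover have "(\<integral>z. ?I (z, y) \<partial>lborel) = g y * (\<integral>z. h z * F (w + y + z) \<partial>lborel)" for y
    by (subst integral_mult_right_zero[symmetric]) (simp add: algebra_simps)
  ultimately show ?thesis unfolding corr_def by simp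
qed

lemma corr_corr:
  assumes l: "0 \<le> l" and h: "wint l h" and g: "wint l g" and F: "poly_bounded l F"
  shows "corr g (corr h F) w = corr (\<lambda>x. \<integral>y. g y * h (x - y) \<partial>lborel) F w"
proof -
  note [measurable] = wint_measurable[OF h] wint_measurable[OF g] poly_bounded_measurable[OF F]
  obtain A where A: "0 \<le> A" "\<And>y. norm (F y) \<le> A * wgt l y" using poly_boundedE[OF F] by blast
  let ?I = "\<lambda>(y, x). g y * (h (x - y) * F (w + x))"
  let ?W = "\<integral>y. wgt l y * norm (h y) \<partial>lborel"
  have eq: "(\<lambda>x. h (x - y) * F (w + x)) = (\<lambda>x. (\<lambda>z. h z * F (w + y + z)) (- y + x))" for y
    by (auto simp: algebra_simps)
  have int0: "integrable lborel (\<lambda>x. h (x - y) * F (w + x))" for y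
    unfolding eq by (subst integrable_lborel_shift) (rule corr_integrable[OF l h F])
  then have int: "integrable lborel (\<lambda>x. ?I (y, x))" for y by simp
  have "integrable (lborel \<Otimes>\<^sub>M lborel) ?I"
  proof (rule lborel_pair.Fubini_integrable)
    show "?I \<in> borel_measurable (lborel \<Otimes>\<^sub>M lborel)" by measurable
    show "AE y in lborel. integrable lborel (\<lambda>x. ?I (y, x))" using int by simp
    show "integrable lborel (\<lambda>y. \<integral>x. norm (?I (y, x)) \<partial>lborel)"
    proof (rule integrable_dominated)
      show "integrable lborel (\<lambda>y. (A * ?W * wgt l w) * (wgt l y * norm (g y)))"
        using g by (simp add: wint_def)
      show "norm (\<integral>x. norm (?I (y, x)) \<partial>lborel) \<le> (A * ?W * wgt l w) * (wgt l y * norm (g y))" for y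
      proof -
        have e1: "(\<integral>x. norm (?I (y, x)) \<partial>lborel) = norm (g y) * (\<integral>x. norm (h (x - y) * F (w + x)) \<partial>lborel)"
          by (simp add: norm_mult)
        have "(\<integral>x. norm (h (x - y) * F (w + x)) \<partial>lborel) = (\<integral>x. norm (h x * F (w + y + x)) \<partial>lborel)"
          using integral_lborel_shift[of "\<lambda>x. norm (h x * F (w + y + x))" "- y"] by (simp add: algebra_simps)
        also have "\<dots> \<le> (\<integral>x. A * wgt l (w + y) * (wgt l x * norm (h x)) \<partial>lborel)"
        proof (rule integral_mono)
          show "integrable lborel (\<lambda>x. norm (h x * F (w + y + x)))" by (rule integrable_norm[OF corr_integrable[OF l h F]])
          show "integrable lborel (\<lambda>x. A * wgt l (w + y) * (wgt l x * norm (h x)))" using h by (simp add: wint_def)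
        qed (rule corr_integrand_bound[OF l A(2,1)])
        also have "\<dots> = A * ?W * wgt l (w + y)" by simp
        also have "\<dots> \<le> A * ?W * (wgt l w * wgt l y)"
          by (intro mult_left_mono wgt_add l mult_nonneg_nonneg A Bochner_Integration.integral_nonneg) auto
        finally have "(\<integral>x. norm (?I (y, x)) \<partial>lborel) \<le> norm (g y) * (A * ?W * (wgt l w * wgt l y))"
          unfolding e1 by (rule mult_left_mono) simp
        then show ?thesis by (simp add: mult_ac)
      qed
    qed measurable
  qed
  then have "(\<integral>y. \<integral>x. ?I (y, x) \<partial>lborel \<partial>lborel) = (\<integral>x. \<integral>y. ?I (y, x) \<partial>lborel \<partial>lborel)"
    using lborel_pair.Fubini_integral[of "\<lambda>y x. ?I (y, x)"] by simp
  moreover have e2: "(\<integral>x. ?I (y, x) \<partial>lborel) = g y * (\<integral>z. h z * F (w + y + z) \<partial>lborel)" for y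
    using integral_lborel_shift[of "\<lambda>z. h z * F (w + y + z)" "- y"] by (simp add: algebra_simps)
  moreover have e3: "(\<integral>y. ?I (y, x) \<partial>lborel) = (\<integral>y. g y * h (x - y) \<partial>lborel) * F (w + x)" for x
    by (subst integral_mult_left_zero[symmetric]) (simp add: algebra_simps)
  ultimately show ?thesis unfolding corr_def e2 e3 by simp
qed

lemma locally_integrable_poly_bounded:
  fixes F :: "real ^ 'n \<Rightarrow> complex"
  assumes l: "0 \<le> l" and F: "poly_bounded l F"
  shows "locally_integrable F"
  unfolding locally_integrable_def
proof (intro allI impI)
  fix K :: "(real ^ 'n) set" assume K: "compact K"
  note [measurable] = poly_bounded_measurable[OF F]
  obtain A where A: "0 \<le> A" "\<And>y. norm (F y) \<le> A * wgt l y" using poly_boundedE[OF F] by blast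
  obtain R where R: "\<And>x. x \<in> K \<Longrightarrow> norm x \<le> R" using compact_imp_bounded[OF K] by (auto simp: bounded_iff)
  have Km[measurable]: "K \<in> sets borel" using K by (simp add: compact_imp_closed)
  have fin: "emeasure lborel K < \<infinity>" using emeasure_compact_finite[OF K] .
  show "set_integrable lborel K F"
    unfolding set_integrable_def
  proof (rule integrable_dominated)
    show "integrable lborel (\<lambda>x. (A * (1 + R) powr l) * indicator K x :: real)"
      using fin by (intro integrable_mult_right integrable_real_indicator) auto
    have "norm (F x) \<le> A * (1 + R) powr l" if "x \<in> K" for x
      using R[OF that] by (intro order_trans[OF A(2)] mult_left_mono A) (auto simp: wgt_def l intro: powr_mono2)
    then show "norm (indicator K x *\<^sub>R F x) \<le> (A * (1 + R) powr l) * indicator K x" for x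
      by (auto simp: indicator_def)
  qed measurable
qed

subsection \<open>Translates of test functions\<close>

lemma test_function_Ck: "test_function g \<Longrightarrow> Ck N UNIV g"
  by (simp add: test_function_def C_on_iff_Ck)

lemma test_function_support:
  fixes g :: "real ^ 'n \<Rightarrow> complex"
  assumes "test_function g"
  obtains R where "0 \<le> R" "\<And>x. R < norm x \<Longrightarrow> g x = 0"
proof -
  obtain K where K: "compact K" "\<And>x. x \<notin> K \<Longrightarrow> g x = 0" using assms by (auto simp: test_function_def)
  obtain R where R: "\<And>x. x \<in> K \<Longrightarrow> norm x \<le> R" using compact_imp_bounded[OF K(1)] by (auto simp: bounded_iff)
  show ?thesis by (rule that[of "max 0 R"]) (use R K in fastforce)+
qed

lemma test_functionI:
  fixes g :: "real ^ 'n \<Rightarrow> complex"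
  assumes "\<And>N. Ck N UNIV g" "\<And>x. R < norm x \<Longrightarrow> g x = 0"
  shows "test_function g"
  unfolding test_function_def
proof (intro conjI allI)
  show "\<exists>K. compact K \<and> (\<forall>x. x \<notin> K \<longrightarrow> g x = 0)"
    using assms(2) by (intro exI[of _ "cball 0 R"]) (auto simp: not_le)
qed (use assms in \<open>simp add: C_on_iff_Ck\<close>)

lemma test_function_affine:
  fixes g :: "real ^ 'n \<Rightarrow> complex"
  assumes g: "test_function g" and c: "\<bar>c\<bar> = 1"
  shows "test_function (\<lambda>x. g (a + c *\<^sub>R x))"
proof -
  obtain R where R: "\<And>x. R < norm x \<Longrightarrow> g x = 0" using test_function_support[OF g] by blast
  show ?thesis
  proof (rule test_functionI[where R="R + norm a"])
    show "Ck N UNIV (\<lambda>x. g (a + c *\<^sub>R x))" for N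
      by (rule Ck_affine[OF _ _ test_function_Ck[OF g]]) auto
    fix x :: "real ^ 'n" assume x: "R + norm a < norm x"
    have "norm x = norm ((a + c *\<^sub>R x) - a)" using c by simp
    also have "\<dots> \<le> norm (a + c *\<^sub>R x) + norm a" by (rule norm_triangle_ineq4)
    finally show "g (a + c *\<^sub>R x) = 0" using x by (intro R) simp
  qed
qed

lemma pderivs_support:
  assumes "\<And>x. R < norm x \<Longrightarrow> g x = 0"
  shows "R < norm x \<Longrightarrow> pderivs is g x = 0"
  using assms
proof (induction "is" arbitrary: x)
  case (Cons i "is") then show ?case using partial_deriv_support[of R "pderivs is g" x i] by auto
qed simp

lemma pderivs_continuous: "(\<And>N. Ck N UNIV g) \<Longrightarrow> continuous_on UNIV (pderivs is g)"
  unfolding C_on_iff_Ck[symmetric] C_on_def by blast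

lemma test_function_schwartz:
  fixes g :: "real ^ 'n \<Rightarrow> complex"
  assumes g: "test_function g"
  shows "schwartz g"
  unfolding schwartz_def
proof (intro conjI allI)
  show "C_on N UNIV g" for N using g by (simp add: test_function_def)
  fix N :: nat and "is" :: "'n list"
  obtain R where R: "\<And>x. R < norm x \<Longrightarrow> g x = 0" using test_function_support[OF g] by blast
  let ?p = "\<lambda>x. (1 + norm x) ^ N *\<^sub>R pderivs is g x"
  have "continuous_on UNIV ?p"
    using pderivs_continuous[OF test_function_Ck[OF g], of "is"] by (auto intro!: continuous_intros)
  then have "bounded (?p ` cball 0 R)"
    by (intro compact_imp_bounded compact_continuous_image[OF continuous_on_subset[of UNIV ?p]]) auto
  moreover have "range ?p \<subseteq> insert 0 (?p ` cball 0 R)"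
  proof
    fix y assume "y \<in> range ?p"
    then obtain x where x: "y = ?p x" by auto
    show "y \<in> insert 0 (?p ` cball 0 R)"
      using pderivs_support[where g=g and R=R and x=x] R x by (cases "norm x \<le> R") auto
  qed
  ultimately show "bounded (range ?p)" by (meson bounded_insert bounded_subset)
qed

lemma uniform_translation:
  fixes p :: "real ^ 'n \<Rightarrow> complex"
  assumes p: "continuous_on UNIV p" and supp: "\<And>x. R < norm x \<Longrightarrow> p x = 0" and e: "0 < e"
  shows "\<exists>d>0. \<forall>u v. dist u v < d \<longrightarrow> norm (p u - p v) < e"
proof -
  have "uniformly_continuous_on (cball 0 (R + 1)) p"
    by (intro compact_uniformly_continuous continuous_on_subset[OF p]) auto
  then obtain d where d: "d > 0" "\<And>u v. u \<in> cball 0 (R + 1) \<Longrightarrow> v \<in> cball 0 (R + 1) \<Longrightarrow> dist v u < d \<Longrightarrow> dist (p v) (p u) < e"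
    using e unfolding uniformly_continuous_on_def by metis
  have "norm (p u - p v) < e" if uv: "dist u v < min d 1" for u v
  proof (cases "u \<in> cball 0 (R + 1) \<and> v \<in> cball 0 (R + 1)")
    case True then show ?thesis using d(2)[of v u] uv by (simp add: dist_norm)
  next
    case False
    have "norm u \<le> norm v + dist u v" "norm v \<le> norm u + dist u v"
      using norm_triangle_sub[of u v] norm_triangle_sub[of v u] by (simp_all add: dist_norm norm_minus_commute)
    then have "R < norm u" "R < norm v" using False uv by auto
    then show ?thesis using supp e by simp
  qed
  then show ?thesis using d(1) by (intro exI[of _ "min d 1"]) auto
qed

text \<open>A tempered distribution is controlled by finitely many derivatives; those of g are
  uniformly continuous, and nearby translates have their supports in a common ball. Continuity
  supplies measurability and local boundedness, on which the growth condition is silent.\<close>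

lemma continuous_translation:
  fixes g :: "real ^ 'n \<Rightarrow> complex"
  assumes f: "tempered_distribution f" and g: "test_function g"
  shows "continuous_on UNIV (\<lambda>x. f (\<lambda>y. g (y - x)))"
proof -
  obtain C N where CN: "\<And>\<phi>. schwartz \<phi> \<Longrightarrow> norm (f \<phi>) \<le> C * schwartz_seminorm N \<phi>"
    using f unfolding tempered_distribution_def by blast
  have add: "schwartz \<phi> \<Longrightarrow> schwartz \<eta> \<Longrightarrow> f (\<lambda>x. \<phi> x + \<eta> x) = f \<phi> + f \<eta>"
    and cm: "schwartz \<phi> \<Longrightarrow> f (\<lambda>x. c * \<phi> x) = c * f \<phi>" for \<phi> \<eta> c
    using f unfolding tempered_distribution_def by blast+
  obtain R where R: "0 \<le> R" "\<And>x. R < norm x \<Longrightarrow> g x = 0" using test_function_support[OF g] by blast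
  have tg: "test_function (\<lambda>y. g (y - x))" for x
    using test_function_affine[OF g, of 1 "- x"] by (simp add: algebra_simps)
  show ?thesis
    unfolding continuous_on_iff
  proof (intro ballI allI impI)
    fix x :: "real ^ 'n" and e :: real assume e: "0 < e"
    \<comment> \<open>Radius of a ball containing the supports of all translates of g by vectors at
      distance at most 1 from x.\<close>
    define \<rho> where "\<rho> = R + norm x + 1"
    \<comment> \<open>Chosen so that |C| (1 + \<rho>)^N e' < e; the summand 1 keeps the denominator
      positive when C = 0.\<close>
    define e' where "e' = e / (2 * (\<bar>C\<bar> + 1) * (1 + \<rho>) ^ N)"
    have r1: "0 < 1 + \<rho>" unfolding \<rho>_def using R(1) norm_ge_zero[of x] by linarith
    then have rp: "0 < (1 + \<rho>) ^ N" by simp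
    have e': "0 < e'" using e rp by (simp add: e'_def)
    let ?L = "{is :: 'n list. length is \<le> N}"
    have fin: "finite ?L" using finite_lists_length_le[of "UNIV :: 'n set" N] by simp
    have "\<exists>d>0. \<forall>u v. dist u v < d \<longrightarrow> norm (pderivs is g u - pderivs is g v) < e'" for "is"
      by (rule uniform_translation[OF _ _ e'])
        (use pderivs_continuous[OF test_function_Ck[OF g]] pderivs_support[OF R(2)] in auto)
    then obtain d where d: "\<And>is. d is > 0"
      "\<And>is u v. dist u v < d is \<Longrightarrow> norm (pderivs is g u - pderivs is g v) < e'" by metis
    define D where "D = Min (insert 1 (d ` ?L))"
    have D: "0 < D" "D \<le> 1" "\<And>is. is \<in> ?L \<Longrightarrow> D \<le> d is"
      unfolding D_def using fin d(1) by auto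
    show "\<exists>d>0. \<forall>x'\<in>UNIV. dist x' x < d \<longrightarrow> dist (f (\<lambda>y. g (y - x'))) (f (\<lambda>y. g (y - x))) < e"
    proof (intro exI[of _ D] conjI D(1) ballI impI)
      fix x' assume x': "dist x' x < D"
      let ?\<phi> = "\<lambda>y. g (y - x') - g (y - x)"
      have tr: "pderivs is (\<lambda>y. g (y - x)) = (\<lambda>y. pderivs is g (y - x))" for "is" x
        using pderivs_affine[OF test_function_Ck[OF g], of "is" "- x" 1] by (simp add: algebra_simps)
      have pd: "pderivs is ?\<phi> = (\<lambda>y. pderivs is g (y - x') - pderivs is g (y - x))" for "is"
        by (subst pderivs_diff) (use test_function_Ck[OF tg] tr in auto)
      have phi0: "?\<phi> y = 0" if y: "\<rho> < norm y" for y :: "real ^ 'n"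
      proof -
        have "norm x' \<le> norm x + 1" using norm_triangle_sub[of x' x] x' D(2) by (simp add: dist_norm)
        then have "R < norm (y - x)" "R < norm (y - x')"
          using norm_triangle_ineq2[of y x] norm_triangle_ineq2[of y x'] y unfolding \<rho>_def by linarith+
        then show ?thesis by (simp add: R(2))
      qed
      have neg: "test_function (\<lambda>y. (- 1) * g (y - x))"
      proof (rule test_functionI[where R="R + norm x"])
        show "Ck M UNIV (\<lambda>y. (- 1) * g (y - x))" for M
          by (rule Ck_mult[OF open_UNIV Ck_const test_function_Ck[OF tg]])
        fix y :: "real ^ 'n" assume "R + norm x < norm y"
        then have "R < norm (y - x)" using norm_triangle_ineq2[of y x] by linarith
        then show "(- 1) * g (y - x) = 0" by (simp add: R(2))
      qed
      have tphi: "test_function ?\<phi>"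
      proof (rule test_functionI[where R=\<rho>])
        show "Ck M UNIV ?\<phi>" for M
          using Ck_add[OF open_UNIV test_function_Ck[OF tg, of M x'] test_function_Ck[OF neg]] by simp
      qed (rule phi0)
      have "f (\<lambda>y. g (y - x')) - f (\<lambda>y. g (y - x)) = f ?\<phi>"
      proof -
        have "f (\<lambda>y. g (y - x') + (- 1) * g (y - x)) = f (\<lambda>y. g (y - x')) + f (\<lambda>y. (- 1) * g (y - x))"
          by (rule add[OF test_function_schwartz[OF tg] test_function_schwartz[OF neg]])
        also have "f (\<lambda>y. (- 1) * g (y - x)) = (- 1) * f (\<lambda>y. g (y - x))"
          by (rule cm[OF test_function_schwartz[OF tg]])
        finally show ?thesis by simp
      qed
      then have "dist (f (\<lambda>y. g (y - x'))) (f (\<lambda>y. g (y - x))) = norm (f ?\<phi>)" by (simp add: dist_norm)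
      also have "\<dots> \<le> C * schwartz_seminorm N ?\<phi>" by (rule CN[OF test_function_schwartz[OF tphi]])
      also have "\<dots> \<le> \<bar>C\<bar> * ((1 + \<rho>) ^ N * e')"
      proof -
        have pt: "(1 + norm y) ^ N * norm (pderivs is ?\<phi> y) \<le> (1 + \<rho>) ^ N * e'" if "is \<in> ?L" for "is" y
        proof (cases "norm y \<le> \<rho>")
          case True
          have "dist (y - x') (y - x) = dist x' x" by (simp add: dist_norm norm_minus_commute)
          then have "norm (pderivs is ?\<phi> y) \<le> e'"
            unfolding pd using d(2)[of "y - x'" "y - x" "is"] D(3)[OF that] x' by auto
          then show ?thesis using True by (intro mult_mono power_mono) (auto simp: rp less_imp_le)
        next
          case False
          have "pderivs is ?\<phi> y = 0"
            by (rule pderivs_support[where R=\<rho>, OF phi0]) (use False in auto)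
          then show ?thesis using rp e' by simp
        qed
        have nonneg: "0 \<le> schwartz_seminorm N ?\<phi>"
        proof -
          have "0 \<le> (case ([], 0) of (is, x) \<Rightarrow> (1 + norm x) ^ N * norm (pderivs is ?\<phi> x))" by simp
          also have "\<dots> \<le> schwartz_seminorm N ?\<phi>"
            unfolding schwartz_seminorm_def
            by (rule cSUP_upper) (use pt in \<open>auto simp: bdd_above_def intro!: exI[of _ "(1 + \<rho>) ^ N * e'"]\<close>)
          finally show ?thesis .
        qed
        have "schwartz_seminorm N ?\<phi> \<le> (1 + \<rho>) ^ N * e'"
          unfolding schwartz_seminorm_def
          by (rule cSUP_least) (use pt in \<open>auto intro!: exI[of _ "[]"]\<close>)
        then show ?thesis using nonneg by (meson abs_ge_self abs_ge_zero mult_mono)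
      qed
      also have "\<dots> < e"
      proof -
        have "\<bar>C\<bar> * ((1 + \<rho>) ^ N * e') = e * (\<bar>C\<bar> / (2 * (\<bar>C\<bar> + 1)))"
          using r1 by (simp add: e'_def)
        also have "\<dots> < e * 1"
          using e by (intro mult_strict_left_mono) (auto simp: divide_simps)
        finally show ?thesis by simp
      qed
      finally show "dist (f (\<lambda>y. g (y - x'))) (f (\<lambda>y. g (y - x))) < e" .
    qed
  qed
qed

text \<open>The growth condition, applied to \<open>reflect g\<close>, settles large x; continuity
  settles the remaining ball.\<close>

lemma poly_bounded_translation:
  fixes g :: "real ^ 'n \<Rightarrow> complex"
  assumes f: "has_growth f l" and g: "test_function g" and l: "0 \<le> l"
  shows "poly_bounded l (\<lambda>x. f (\<lambda>y. g (y - x)))"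
proof -
  let ?G = "\<lambda>x. f (\<lambda>y. g (y - x))"
  have c: "continuous_on UNIV ?G" using f g by (intro continuous_translation) (auto simp: has_growth_def)
  have sch: "schwartz (reflect g)"
    using test_function_schwartz[OF test_function_affine[OF g, of "-1" 0]] by (simp add: reflect_def[abs_def])
  have G: "schwartz_conv (reflect g) f = ?G" by (simp add: schwartz_conv_def reflect_def fun_eq_iff)
  from f sch have "(\<lambda>x. norm (schwartz_conv (reflect g) f x)) \<in> O[at_infinity](\<lambda>x. norm x powr l)"
    by (simp add: has_growth_def)
  then have "(\<lambda>x. norm (?G x)) \<in> O[at_infinity](\<lambda>x. norm x powr l)" unfolding G .
  then obtain c' where c': "c' > 0" "\<forall>\<^sub>F x in at_infinity. norm (norm (?G x)) \<le> c' * norm (norm x powr l)"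
    by (rule landau_o.bigE)
  from c'(2) obtain b where b: "\<And>x. b \<le> norm x \<Longrightarrow> norm (?G x) \<le> c' * norm x powr l"
    by (auto simp: eventually_at_infinity)
  have "compact (?G ` cball 0 b)" by (rule compact_continuous_image[OF continuous_on_subset[OF c]]) auto
  then obtain B where B: "\<And>x. x \<in> cball 0 b \<Longrightarrow> norm (?G x) \<le> B"
    by (fastforce dest: compact_imp_bounded simp: bounded_iff)
  have "norm (?G x) \<le> max B c' * wgt l x" for x
  proof (cases "b \<le> norm x")
    case True
    have "norm (?G x) \<le> c' * wgt l x"
      unfolding wgt_def using l c' by (intro order_trans[OF b[OF True]] mult_left_mono powr_mono2) auto
    also have "\<dots> \<le> max B c' * wgt l x" by (intro mult_right_mono) auto
    finally show ?thesis .
  next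
    case False
    then have "norm (?G x) \<le> B * 1" using B[of x] by simp
    also have "\<dots> \<le> max B c' * wgt l x" using wgt_ge1[OF l, of x] c' by (intro mult_mono) auto
    finally show ?thesis .
  qed
  then show ?thesis unfolding poly_bounded_def using borel_measurable_continuous_onI[OF c] by blast
qed

lemma wint_test_function:
  fixes g :: "real ^ 'n \<Rightarrow> complex"
  assumes g: "test_function g" and l: "0 \<le> l"
  shows "wint l g"
proof -
  have c: "continuous_on UNIV g" using test_function_Ck[OF g, of 0] by simp
  have "integrable lborel (\<lambda>x. complex_of_real (wgt l x * norm (g x)))"
  proof -
    obtain R where R: "\<And>x. R < norm x \<Longrightarrow> g x = 0" using test_function_support[OF g] by blast
    show ?thesis
      by (rule integrable_compact_support[where R=R])
        (use R c in \<open>auto simp: wgt_def intro!: continuous_intros\<close>, metis add_pos_nonneg less_irrefl norm_ge_zero zero_less_one)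
  qed
  from integrable_Re[OF this] show ?thesis
    using borel_measurable_continuous_onI[OF c] by (simp add: wint_def)
qed

text \<open>This is \<psi>1 * (\<psi>2 * f) = \<psi>2 * (\<psi>1 * f). Paired with a test function
  g, each side becomes a double correlation of the two kernels with the translates of g evaluated by
  \<open>f\<close>, and these correlations commute.\<close>

lemma corr_dist_conv_commute:
  fixes \<psi>1 \<psi>2 F1 F2 :: "real ^ 'n \<Rightarrow> complex"
  assumes f: "has_growth f l" and l: "0 \<le> l"
    and w: "wint l \<psi>1" "wint l \<psi>2"
    and F: "is_loc_int_function (dist_conv \<psi>1 f) F1" "is_loc_int_function (dist_conv \<psi>2 f) F2"
    and pb: "poly_bounded l F1" "poly_bounded l F2"
  shows "AE x in lborel. corr \<psi>1 F2 x = corr \<psi>2 F1 x"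
proof -
  note pbc = poly_bounded_corr[OF l w(1) pb(2)] poly_bounded_corr[OF l w(2) pb(1)]
  \<comment> \<open>Pairing with g is correlation with g at the origin. Moving g inside onto F'
    makes the defining property of F' applicable to every translate of g.\<close>
  have *: "(\<integral>x. corr \<psi> F' x * g x \<partial>lborel) = corr \<psi> (corr \<psi>' (\<lambda>x. f (\<lambda>y. g (y - x)))) 0"
    if g: "test_function g" and a: "wint l \<psi>" "is_loc_int_function (dist_conv \<psi>' f) F'" "poly_bounded l F'" for \<psi> \<psi>' F' g
  proof -
    have tg: "test_function (\<lambda>y. g (y - z))" for z
      using test_function_affine[OF g, of 1 "- z"] by (simp add: algebra_simps)
    have 1: "corr g F' z = corr \<psi>' (\<lambda>x. f (\<lambda>y. g (y - x))) z" for z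
    proof -
      have "corr g F' z = (\<integral>y. F' y * g (y - z) \<partial>lborel)"
        unfolding corr_def
        using integral_lborel_shift[of "\<lambda>y. F' y * g (y - z)" z] by (simp add: mult.commute)
      also have "\<dots> = dist_conv \<psi>' f (\<lambda>y. g (y - z))"
        using a(2) tg[of z] unfolding is_loc_int_function_def by simp
      also have "\<dots> = corr \<psi>' (\<lambda>x. f (\<lambda>y. g (y - x))) z"
        unfolding dist_conv_def corr_def schwartz_conv_def reflect_def by (simp add: algebra_simps)
      finally show ?thesis .
    qed
    have "(\<integral>x. corr \<psi> F' x * g x \<partial>lborel) = corr g (corr \<psi> F') 0"
      unfolding corr_def[of g] by (simp add: mult.commute)
    also have "\<dots> = corr \<psi> (corr g F') 0"
      by (rule corr_commute[OF l wint_test_function[OF g l] a(1,3)])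
    finally show ?thesis using 1 by presburger
  qed
  have "AE x in lborel. corr \<psi>1 F2 x - corr \<psi>2 F1 x = 0"
  proof (rule test_functions_separate)
    have "locally_integrable (corr \<psi>1 F2)" "locally_integrable (corr \<psi>2 F1)"
      by (rule locally_integrable_poly_bounded[OF l pbc(1)], rule locally_integrable_poly_bounded[OF l pbc(2)])
    then show "locally_integrable (\<lambda>x. corr \<psi>1 F2 x - corr \<psi>2 F1 x)"
      unfolding locally_integrable_def by (auto intro: set_integral_diff)
    fix g :: "real ^ 'n \<Rightarrow> complex" assume g: "test_function g"
    have i: "integrable lborel (\<lambda>x. corr \<psi>1 F2 x * g x)" "integrable lborel (\<lambda>x. corr \<psi>2 F1 x * g x)"
      using corr_integrable[OF l wint_test_function[OF g l] pbc(1), of 0]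
        corr_integrable[OF l wint_test_function[OF g l] pbc(2), of 0] by (simp_all add: mult.commute)
    have "(\<integral>x. (corr \<psi>1 F2 x - corr \<psi>2 F1 x) * g x \<partial>lborel) =
       (\<integral>x. corr \<psi>1 F2 x * g x \<partial>lborel) - (\<integral>x. corr \<psi>2 F1 x * g x \<partial>lborel)"
      unfolding left_diff_distrib by (rule Bochner_Integration.integral_diff[OF i])
    also have "\<dots> = 0"
      using *[OF g w(1) F(2) pb(2)] *[OF g w(2) F(1) pb(1)]
        corr_commute[OF l w(1) w(2) poly_bounded_translation[OF f g l], of 0] by simp
    finally show "(\<integral>x. (corr \<psi>1 F2 x - corr \<psi>2 F1 x) * g x \<partial>lborel) = 0" .
  qed
  then show ?thesis by eventually_elim simp
qed


subsection \<open>Approximate identities\<close>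

text \<open>A measurable function is an almost everywhere limit of continuous ones. Truncating these
  radially at height A * \<open>wgt l\<close> keeps them continuous and leaves the limit alone,
  since F already satisfies the bound.\<close>

lemma poly_bounded_approx:
  fixes F :: "'a::euclidean_space \<Rightarrow> complex"
  assumes m: "F \<in> borel_measurable borel" and A: "0 < A" and F: "\<And>y. norm (F y) \<le> A * wgt l y"
  obtains h :: "nat \<Rightarrow> 'a \<Rightarrow> complex" where "\<And>n. continuous_on UNIV (h n)" "\<And>n y. norm (h n y) \<le> A * wgt l y"
    "AE y in lborel. (\<lambda>n. h n y) \<longlonglongrightarrow> F y"
proof -
  have "F \<in> borel_measurable (lebesgue_on UNIV)"
    using m by (simp add: lebesgue_on_UNIV_eq measurable_completion)
  then have "F measurable_on UNIV" by (subst measurable_on_iff_borel_measurable) auto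
  then obtain N g where N: "negligible N" and g: "\<And>n. continuous_on UNIV (g n)"
    and lim: "\<And>x. x \<notin> N \<Longrightarrow> (\<lambda>n. g n x) \<longlonglongrightarrow> F x"
    unfolding measurable_on_def by auto
  \<comment> \<open>The divisor is 1 exactly where g n obeys the bound; elsewhere the value is
    scaled back to modulus A * wgt l y.\<close>
  define h where "h n y = g n y /\<^sub>R max 1 (norm (g n y) / (A * wgt l y))" for n :: nat and y
  have Aw: "0 < A * wgt l y" for y :: 'a using A by simp
  show ?thesis
  proof
    show "continuous_on UNIV (h n)" for n
      unfolding h_def wgt_def using Aw[unfolded wgt_def]
      by (intro continuous_intros g) (auto simp: add_nonneg_eq_0_iff max_def not_le[symmetric])
    show "norm (h n y) \<le> A * wgt l y" for n y
    proof -
      have "norm (g n y) \<le> A * wgt l y * max 1 (norm (g n y) / (A * wgt l y))"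
        using Aw[of y] A by (simp add: max_def field_simps)
      then show ?thesis by (simp add: h_def divide_simps)
    qed
    have "AE y in lebesgue. y \<notin> N" using N by (intro AE_not_in) (simp add: negligible_iff_null_sets)
    then have "AE y in lborel. y \<notin> N" by (simp add: AE_completion_iff)
    then show "AE y in lborel. (\<lambda>n. h n y) \<longlonglongrightarrow> F y"
    proof eventually_elim
      case (elim y)
      have "(\<lambda>n. h n y) \<longlonglongrightarrow> F y /\<^sub>R max 1 (norm (F y) / (A * wgt l y))"
        unfolding h_def using Aw[of y] by (intro tendsto_intros lim elim) auto
      moreover have "norm (F y) / (A * wgt l y) \<le> 1" using F[of y] Aw[of y] by simp
      ultimately show ?case by simp
    qed
  qed
qed

text \<open>Of the exponent l + q, the part l absorbs the growth of u and v, and q is left over;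
  once q exceeds the dimension the remaining weight is integrable.\<close>

lemma weighted_difference_bound:
  fixes u v :: "'a::euclidean_space \<Rightarrow> complex"
  assumes l: "0 \<le> l" and A: "0 \<le> A" and u: "\<And>y. norm (u y) \<le> A * wgt l y" and v: "\<And>y. norm (v y) \<le> A * wgt l y"
  shows "wgt (- (l + q)) w * norm (u (w + y) - v (w + z)) \<le> A * (wgt l y + wgt l z) * wgt (- q) w"
proof -
  have "norm (u (w + y) - v (w + z)) \<le> A * (wgt l w * wgt l y) + A * (wgt l w * wgt l z)"
    by (intro order_trans[OF norm_triangle_ineq4] add_mono order_trans[OF u] order_trans[OF v] mult_left_mono wgt_add l A)
  then have "wgt (- (l + q)) w * norm (u (w + y) - v (w + z)) \<le> wgt (- (l + q)) w * (A * (wgt l w * wgt l y) + A * (wgt l w * wgt l z))"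
    by (rule mult_left_mono) simp
  also have "\<dots> = A * (wgt l y + wgt l z) * (wgt (- (l + q)) w * wgt l w)" by (simp add: algebra_simps)
  finally show ?thesis by (simp add: wgt_mult)
qed

lemma weighted_difference_integrable:
  fixes u v :: "'a::euclidean_space \<Rightarrow> complex"
  assumes "0 \<le> l" "0 \<le> A" "\<And>y. norm (u y) \<le> A * wgt l y" "\<And>y. norm (v y) \<le> A * wgt l y"
    and [measurable]: "u \<in> borel_measurable borel" "v \<in> borel_measurable borel" and q: "real DIM('a) < q"
  shows "integrable lborel (\<lambda>w. wgt (- (l + q)) w * norm (u (w + y) - v (w + z)))"
  by (rule integrable_dominated[OF integrable_mult_right[OF wgt_integrable[OF q], of "A * (wgt l y + wgt l z)"]])
    (use weighted_difference_bound[OF assms(1-4)] in auto)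

text \<open>Continuity of translations, by approximation: for the continuous h n it is dominated
  convergence, and the error F - h n is small in weighted L1, before and after translation.\<close>

lemma weighted_L1_translation:
  fixes F :: "'a::euclidean_space \<Rightarrow> complex" and z :: "nat \<Rightarrow> 'a"
  assumes l: "0 \<le> l" and q: "real DIM('a) < q" and F: "poly_bounded l F" and z: "z \<longlonglongrightarrow> 0"
  shows "(\<lambda>k. \<integral>w. wgt (- (l + q)) w * norm (F (w + z k) - F w) \<partial>lborel) \<longlonglongrightarrow> 0"
proof -
  note [measurable] = poly_bounded_measurable[OF F]
  obtain A0 where A0: "0 \<le> A0" "\<And>y. norm (F y) \<le> A0 * wgt l y" using poly_boundedE[OF F] by blast
  \<comment> \<open>\<open>poly_bounded_approx\<close> divides by this bound and so wants it
    strictly positive.\<close>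
  define A where "A = A0 + 1"
  have A: "0 < A" "0 \<le> A" "\<And>y. norm (F y) \<le> A * wgt l y"
    using A0(1) by (auto simp: A_def distrib_right intro: order_trans[OF A0(2)])
  obtain h where h: "\<And>n. continuous_on UNIV (h n)" "\<And>n y. norm (h n y) \<le> A * wgt l y"
    "AE y in lborel. (\<lambda>n. h n y) \<longlonglongrightarrow> F y"
    using poly_bounded_approx[OF poly_bounded_measurable[OF F] A(1,3)] by blast
  have hm[measurable]: "h n \<in> borel_measurable borel" for n using h(1) by (rule borel_measurable_continuous_onI)
  define p where "p = l + q"
  have p0: "0 \<le> p" using l q by (simp add: p_def)
  note wi = wgt_integrable[OF q]
  note int = weighted_difference_integrable[OF l A(2) _ _ _ _ q, folded p_def]
  note bound = weighted_difference_bound[OF l A(2), where q=q, folded p_def]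
  let ?J = "\<lambda>u v y. \<integral>w. wgt (- p) w * norm (u (w + y) - v w :: complex) \<partial>lborel"
  have e0: "(\<lambda>n. ?J F (h n) 0) \<longlonglongrightarrow> 0"
  proof -
    have "(\<lambda>n. ?J F (h n) 0) \<longlonglongrightarrow> (\<integral>(w::'a). 0 \<partial>lborel)"
    proof (rule integral_dominated_convergence[where w="\<lambda>w. A * (wgt l (0::'a) + wgt l (0::'a)) * wgt (- q) w"])
      show "AE w in lborel. norm (wgt (- p) w * norm (F (w + 0) - h n w)) \<le> A * (wgt l (0::'a) + wgt l (0::'a)) * wgt (- q) w" for n
        using bound[OF A(3) h(2)[of n], where y=0 and z=0] by simp
      show "AE w in lborel. (\<lambda>n. wgt (- p) w * norm (F (w + 0) - h n w)) \<longlonglongrightarrow> 0"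
        using h(3)
      proof eventually_elim
        case (elim w)
        have "(\<lambda>n. wgt (- p) w * norm (F (w + 0) - h n w)) \<longlonglongrightarrow> wgt (- p) w * norm (F w - F w)"
          by (intro tendsto_intros) (use elim in simp_all)
        then show ?case by simp
      qed
    qed (use wi in simp_all)
    then show ?thesis by simp
  qed
  \<comment> \<open>Moving the translation from the error onto the weight costs the factor
    \<open>wgt p y\<close>, which tends to 1 along the sequence z.\<close>
  have shift: "(\<integral>w. wgt (- p) w * norm (F (w + y) - h n (w + y)) \<partial>lborel) \<le> wgt p y * ?J F (h n) 0" for n y
  proof -
    let ?D = "\<lambda>w. norm (F w - h n w)"
    have eq: "wgt (- p) (w - y) * ?D w = (\<lambda>w. wgt (- p) w * norm (F (w + y) - h n (w + y))) (- y + w)" for w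
      by (simp add: algebra_simps)
    have "(\<integral>w. wgt (- p) w * norm (F (w + y) - h n (w + y)) \<partial>lborel) = (\<integral>w. wgt (- p) (w - y) * ?D w \<partial>lborel)"
      unfolding eq by (rule integral_lborel_shift[symmetric])
    also have "\<dots> \<le> (\<integral>w. wgt p y * (wgt (- p) w * ?D w) \<partial>lborel)"
    proof (rule integral_mono)
      show "integrable lborel (\<lambda>w. wgt (- p) (w - y) * ?D w)"
        unfolding eq integrable_lborel_shift[of "\<lambda>w. wgt (- p) w * norm (F (w + y) - h n (w + y))" "- y"]
        using A h by (intro int) auto
      show "integrable lborel (\<lambda>w. wgt p y * (wgt (- p) w * ?D w))"
        using int[of F "h n" 0 0] A h by simp
      show "wgt (- p) (w - y) * ?D w \<le> wgt p y * (wgt (- p) w * ?D w)" for w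
        using mult_right_mono[OF wgt_shift[OF p0, of "- y" w], of "?D w"] by (simp add: mult.assoc)
    qed
    finally show ?thesis by simp
  qed
  have cont: "(\<lambda>k. ?J (h n) (h n) (z k)) \<longlonglongrightarrow> 0" for n
  proof -
    obtain Z where Z: "\<And>k. norm (z k) \<le> Z" using convergent_imp_Bseq[OF convergentI[OF z]] by (auto simp: Bseq_def)
    have "(\<lambda>k. ?J (h n) (h n) (z k)) \<longlonglongrightarrow> (\<integral>(w::'a). 0 \<partial>lborel)"
    proof (rule integral_dominated_convergence[where w="\<lambda>w. A * ((1 + Z) powr l + 1) * wgt (- q) w"])
      show "AE w in lborel. norm (wgt (- p) w * norm (h n (w + z k) - h n w)) \<le> A * ((1 + Z) powr l + 1) * wgt (- q) w" for k
      proof (rule AE_I2)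
        fix w :: 'a
        have "wgt l (z k) \<le> (1 + Z) powr l" unfolding wgt_def using Z[of k] l by (intro powr_mono2) auto
        then have "A * (wgt l (z k) + 1) * wgt (- q) w \<le> A * ((1 + Z) powr l + 1) * wgt (- q) w"
          using A by (intro mult_right_mono mult_left_mono) auto
        then show "norm (wgt (- p) w * norm (h n (w + z k) - h n w)) \<le> A * ((1 + Z) powr l + 1) * wgt (- q) w"
          using bound[OF h(2)[of n] h(2)[of n], where w=w and y="z k" and z=0] by simp
      qed
      show "AE w in lborel. (\<lambda>k. wgt (- p) w * norm (h n (w + z k) - h n w)) \<longlonglongrightarrow> 0"
      proof (rule AE_I2)
        fix w :: 'a
        have "(\<lambda>k. w + z k) \<longlonglongrightarrow> w + 0" by (intro tendsto_intros z)
        then have "(\<lambda>k. h n (w + z k)) \<longlonglongrightarrow> h n w"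
          using continuous_on_tendsto_compose[OF h(1)[of n], of "\<lambda>k. w + z k" w sequentially] by simp
        then have "(\<lambda>k. wgt (- p) w * norm (h n (w + z k) - h n w)) \<longlonglongrightarrow> wgt (- p) w * norm (h n w - h n w)"
          by (intro tendsto_intros)
        then show "(\<lambda>k. wgt (- p) w * norm (h n (w + z k) - h n w)) \<longlonglongrightarrow> 0" by simp
      qed
    qed (use wi in simp_all)
    then show ?thesis by simp
  qed
  have main: "?J F F y \<le> wgt p y * ?J F (h n) 0 + ?J (h n) (h n) y + ?J F (h n) 0" for n y
  proof -
    have i: "integrable lborel (\<lambda>w. wgt (- p) w * norm (F (w + y) - F w))"
      "integrable lborel (\<lambda>w. wgt (- p) w * norm (F (w + y) - h n (w + y)))"
      "integrable lborel (\<lambda>w. wgt (- p) w * norm (h n (w + y) - h n w))"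
      "integrable lborel (\<lambda>w. wgt (- p) w * norm (F w - h n w))"
      using int[of F F y 0] int[of F "h n" y y] int[of "h n" "h n" y 0] int[of F "h n" 0 0] A h by simp_all
    have "?J F F y \<le> (\<integral>w. wgt (- p) w * norm (F (w + y) - h n (w + y)) + wgt (- p) w * norm (h n (w + y) - h n w) +
        wgt (- p) w * norm (F w - h n w) \<partial>lborel)"
    proof (rule integral_mono[OF i(1)])
      fix w :: 'a
      have "norm (F (w + y) - F w) \<le> norm (F (w + y) - h n (w + y)) + norm (h n (w + y) - h n w) + norm (F w - h n w)"
        using norm_triangle_ineq4[of "(F (w + y) - h n (w + y)) + (h n (w + y) - h n w)" "F w - h n w"]
          norm_triangle_ineq[of "F (w + y) - h n (w + y)" "h n (w + y) - h n w"] by simp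
      then show "wgt (- p) w * norm (F (w + y) - F w) \<le>
        wgt (- p) w * norm (F (w + y) - h n (w + y)) + wgt (- p) w * norm (h n (w + y) - h n w) + wgt (- p) w * norm (F w - h n w)"
        by (simp add: distrib_left[symmetric] mult_left_mono)
    qed (use i in auto)
    also have "\<dots> = (\<integral>w. wgt (- p) w * norm (F (w + y) - h n (w + y)) \<partial>lborel) + ?J (h n) (h n) y + ?J F (h n) 0"
      using i by simp
    finally show ?thesis using shift[of y n] by linarith
  qed
  have nonneg: "0 \<le> ?J u v y" for u v y by (intro Bochner_Integration.integral_nonneg) auto
  have "(\<lambda>k. ?J F F (z k)) \<longlonglongrightarrow> 0"
  proof (rule LIMSEQ_I)
    fix r :: real assume r: "0 < r"
    obtain n where n: "norm (?J F (h n) 0 - 0) < r / 4" using LIMSEQ_D[OF e0, of "r / 4"] r by auto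
    let ?e = "?J F (h n) 0"
    have "(\<lambda>k. wgt p (z k) * ?e + ?J (h n) (h n) (z k) + ?e) \<longlonglongrightarrow> (1 + norm (0::'a)) powr p * ?e + 0 + ?e"
      unfolding wgt_def[of p] by (intro tendsto_intros z cont) auto
    moreover have "(1 + norm (0::'a)) powr p * ?e + 0 + ?e < r" using n nonneg[of F 0 "h n"] r by simp
    ultimately have "\<forall>\<^sub>F k in sequentially. wgt p (z k) * ?e + ?J (h n) (h n) (z k) + ?e < r"
      by (rule order_tendstoD)
    then obtain N where N: "\<And>k. k \<ge> N \<Longrightarrow> wgt p (z k) * ?e + ?J (h n) (h n) (z k) + ?e < r"
      by (auto simp: eventually_sequentially)
    have "norm (?J F F (z k) - 0) < r" if "k \<ge> N" for k
      using N[OF that] main[of "z k" n] nonneg[of F "z k" F] by simp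
    then show "\<exists>no. \<forall>k\<ge>no. norm (?J F F (z k) - 0) < r" by blast
  qed
  then show ?thesis by (simp add: p_def)
qed

text \<open>The weighted L1 distance between the mollified function and c * F is at most the average
  of an L1 modulus of continuity of F against |\<Phi>|, which tends to 0; a subsequence then
  converges almost everywhere. Because s is at least 1, the points x / s k stay below x in norm, and
  one dominating function serves all k.\<close>

lemma approximate_identity:
  fixes F \<Phi> :: "'a::euclidean_space \<Rightarrow> complex"
  assumes l: "0 \<le> l" and F: "poly_bounded l F" and P: "wint l \<Phi>" and s: "filterlim s at_top sequentially"
    and s0: "\<And>k. 1 \<le> s k"
  shows "\<exists>r::nat\<Rightarrow>nat. strict_mono r \<and>
    (AE w in lborel. (\<lambda>k. corr (\<lambda>x. (s (r k) ^ DIM('a)) *\<^sub>R \<Phi> (s (r k) *\<^sub>R x)) F w) \<longlonglongrightarrow> (\<integral>x. \<Phi> x \<partial>lborel) * F w)"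
proof -
  note [measurable] = poly_bounded_measurable[OF F] wint_measurable[OF P]
  obtain A where A: "0 \<le> A" "\<And>y. norm (F y) \<le> A * wgt l y" using poly_boundedE[OF F] by blast
  define q where "q = real DIM('a) + 1"
  have q: "real DIM('a) < q" by (simp add: q_def)
  define p where "p = l + q"
  note wi = wgt_integrable[OF q]
  have int: "integrable lborel (\<lambda>w. wgt (- p) w * norm (F (w + y) - F w))" for y
    using weighted_difference_integrable[OF l A(1) A(2) A(2) _ _ q, where y=y and z=0] by (simp add: p_def)
  have dom: "wgt (- p) w * norm (F (w + y) - F w) \<le> 2 * A * wgt l y * wgt (- q) w" for w y
  proof -
    have "A * (wgt l y + wgt l (0::'a)) * wgt (- q) w \<le> A * (wgt l y + wgt l y) * wgt (- q) w"
      using A wgt_ge1[OF l, of y] by (intro mult_right_mono mult_left_mono) auto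
    then show ?thesis using weighted_difference_bound[OF l A(1) A(2) A(2), where q=q and w=w and y=y and z=0] by (simp add: p_def)
  qed
  \<comment> \<open>The weighted L1 modulus of continuity of F; it tends to 0 at the origin by
    \<open>weighted_L1_translation\<close> and grows at most like \<open>wgt l\<close>.\<close>
  define \<omega> where "\<omega> y = (\<integral>w. wgt (- p) w * norm (F (w + y) - F w) \<partial>lborel)" for y
  define I where "I = (\<integral>w. wgt (- q) (w::'a) \<partial>lborel)"
  have \<omega>m[measurable]: "\<omega> \<in> borel_measurable borel" unfolding \<omega>_def by measurable
  have \<omega>0: "0 \<le> \<omega> y" for y unfolding \<omega>_def by (intro Bochner_Integration.integral_nonneg) auto
  have \<omega>b: "\<omega> y \<le> 2 * A * I * wgt l y" for y
  proof -
    have "\<omega> y \<le> (\<integral>(w::'a). 2 * A * wgt l y * wgt (- q) w \<partial>lborel)"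
      unfolding \<omega>_def by (rule integral_mono[OF int _ dom]) (use wi in simp)
    then show ?thesis by (simp add: I_def mult_ac)
  qed
  have I0: "0 \<le> I" unfolding I_def by (intro Bochner_Integration.integral_nonneg) auto
  have \<Phi>i: "integrable lborel \<Phi>" by (rule wint_integrable[OF l P])
  define c where "c = (\<integral>x. \<Phi> x \<partial>lborel)"
  define D where "D k w = corr (\<lambda>x. (s k ^ DIM('a)) *\<^sub>R \<Phi> (s k *\<^sub>R x)) F w - c * F w" for k w
  have sp: "0 < s k" for k using s0[of k] by linarith
  have corr_eq: "corr (\<lambda>x. (s k ^ DIM('a)) *\<^sub>R \<Phi> (s k *\<^sub>R x)) F w = (\<integral>x. \<Phi> x * F (w + (1 / s k) *\<^sub>R x) \<partial>lborel)" for k w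
  proof -
    have "(\<integral>x. \<Phi> x * F (w + (1 / s k) *\<^sub>R x) \<partial>lborel) = (s k ^ DIM('a)) *\<^sub>R (\<integral>x. \<Phi> (s k *\<^sub>R x) * F (w + x) \<partial>lborel)"
      by (subst integral_lborel_affine[where c="s k" and t=0]) (use sp[of k] in \<open>simp_all add: less_imp_neq[symmetric]\<close>)
    then show ?thesis unfolding corr_def by simp
  qed
  have small: "norm ((1 / s k) *\<^sub>R x) \<le> norm x" for k and x :: 'a
    using s0[of k] by (simp add: divide_le_eq mult_le_cancel_left1)
  have Fi: "integrable lborel (\<lambda>x. \<Phi> x * F (w + (1 / s k) *\<^sub>R x))" for w k
  proof (rule integrable_dominated)
    show "integrable lborel (\<lambda>x. A * wgt l w * (wgt l x * norm (\<Phi> x)))" using P by (simp add: wint_def)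
    show "norm (\<Phi> x * F (w + (1 / s k) *\<^sub>R x)) \<le> A * wgt l w * (wgt l x * norm (\<Phi> x))" for x
    proof -
      have "norm (F (w + (1 / s k) *\<^sub>R x)) \<le> A * (wgt l w * wgt l ((1 / s k) *\<^sub>R x))"
        by (rule order_trans[OF A(2) mult_left_mono[OF wgt_add[OF l] A(1)]])
      also have "\<dots> \<le> A * (wgt l w * wgt l x)"
        by (intro mult_left_mono wgt_norm_mono small l A) auto
      finally have "norm (\<Phi> x) * norm (F (w + (1 / s k) *\<^sub>R x)) \<le> norm (\<Phi> x) * (A * (wgt l w * wgt l x))"
        by (rule mult_left_mono) simp
      then show ?thesis by (simp add: norm_mult mult_ac)
    qed
  qed measurable
  have D_eq: "D k w = (\<integral>x. \<Phi> x * (F (w + (1 / s k) *\<^sub>R x) - F w) \<partial>lborel)" for k w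
    unfolding D_def corr_eq c_def right_diff_distrib using Fi[of w k] \<Phi>i by simp
  have pair: "integrable (lborel \<Otimes>\<^sub>M lborel) (\<lambda>(x, w). norm (\<Phi> x) * (wgt (- p) w * norm (F (w + (1 / s k) *\<^sub>R x) - F w)))" (is "integrable _ ?J") for k
  proof (rule lborel_pair.Fubini_integrable)
    show "?J \<in> borel_measurable (lborel \<Otimes>\<^sub>M lborel)" by measurable
    show "AE x in lborel. integrable lborel (\<lambda>w. ?J (x, w))" using int by simp
    show "integrable lborel (\<lambda>x. \<integral>w. norm (?J (x, w)) \<partial>lborel)"
    proof (rule integrable_dominated)
      show "integrable lborel (\<lambda>x. (2 * A * I) * (wgt l x * norm (\<Phi> x)))" using P by (simp add: wint_def)
      show "norm (\<integral>w. norm (?J (x, w)) \<partial>lborel) \<le> (2 * A * I) * (wgt l x * norm (\<Phi> x))" for x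
      proof -
        have "(\<integral>w. norm (?J (x, w)) \<partial>lborel) = norm (\<Phi> x) * \<omega> ((1 / s k) *\<^sub>R x)" by (simp add: \<omega>_def abs_mult)
        also have "\<dots> \<le> norm (\<Phi> x) * (2 * A * I * wgt l x)"
          using A I0 by (intro mult_left_mono order_trans[OF \<omega>b] wgt_norm_mono small l) auto
        finally show ?thesis by (simp add: mult_ac)
      qed
    qed measurable
  qed
  have Dm[measurable]: "D k \<in> borel_measurable borel" for k unfolding D_def corr_def by measurable
  have b: "norm (wgt (- p) w *\<^sub>R D k w) \<le> (\<integral>x. norm (\<Phi> x) * (wgt (- p) w * norm (F (w + (1 / s k) *\<^sub>R x) - F w)) \<partial>lborel)" for k w
  proof -
    have "norm (D k w) \<le> (\<integral>x. norm (\<Phi> x * (F (w + (1 / s k) *\<^sub>R x) - F w)) \<partial>lborel)"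
      unfolding D_eq by (rule integral_norm_bound)
    then have "wgt (- p) w * norm (D k w) \<le> wgt (- p) w * (\<integral>x. norm (\<Phi> x * (F (w + (1 / s k) *\<^sub>R x) - F w)) \<partial>lborel)"
      by (rule mult_left_mono) simp
    also have "\<dots> = (\<integral>x. norm (\<Phi> x) * (wgt (- p) w * norm (F (w + (1 / s k) *\<^sub>R x) - F w)) \<partial>lborel)"
      by (subst integral_mult_right_zero[symmetric]) (simp add: norm_mult mult_ac)
    finally show ?thesis by simp
  qed
  have Ji: "integrable lborel (\<lambda>w. \<integral>x. norm (\<Phi> x) * (wgt (- p) w * norm (F (w + (1 / s k) *\<^sub>R x) - F w)) \<partial>lborel)" for k
    using lborel_pair.integrable_snd[OF pair[of k]] by simp
  have Di: "integrable lborel (\<lambda>w. wgt (- p) w *\<^sub>R D k w)" for k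
    by (rule integrable_dominated[OF Ji[of k] _ b]) measurable
  have bound: "(\<integral>w. norm (wgt (- p) w *\<^sub>R D k w) \<partial>lborel) \<le> (\<integral>x. norm (\<Phi> x) * \<omega> ((1 / s k) *\<^sub>R x) \<partial>lborel)" for k
  proof -
    have "(\<integral>w. norm (wgt (- p) w *\<^sub>R D k w) \<partial>lborel) \<le> (\<integral>w. \<integral>x. norm (\<Phi> x) * (wgt (- p) w * norm (F (w + (1 / s k) *\<^sub>R x) - F w)) \<partial>lborel \<partial>lborel)"
      by (rule integral_mono[OF integrable_norm[OF Di] Ji b])
    also have "\<dots> = (\<integral>x. \<integral>w. norm (\<Phi> x) * (wgt (- p) w * norm (F (w + (1 / s k) *\<^sub>R x) - F w)) \<partial>lborel \<partial>lborel)"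
      using lborel_pair.Fubini_integral[of "\<lambda>x w. norm (\<Phi> x) * (wgt (- p) w * norm (F (w + (1 / s k) *\<^sub>R x) - F w))"] pair[of k] by simp
    also have "\<dots> = (\<integral>x. norm (\<Phi> x) * \<omega> ((1 / s k) *\<^sub>R x) \<partial>lborel)" by (simp add: \<omega>_def)
    finally show ?thesis .
  qed
  have lim: "(\<lambda>k. \<integral>x. norm (\<Phi> x) * \<omega> ((1 / s k) *\<^sub>R x) \<partial>lborel) \<longlonglongrightarrow> (\<integral>(x::'a). 0 \<partial>lborel)"
  proof (rule integral_dominated_convergence[where w="\<lambda>x. (2 * A * I) * (wgt l x * norm (\<Phi> x))"])
    show "integrable lborel (\<lambda>x. (2 * A * I) * (wgt l x * norm (\<Phi> x)))" using P by (simp add: wint_def)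
    show "AE x in lborel. norm (norm (\<Phi> x) * \<omega> ((1 / s k) *\<^sub>R x)) \<le> (2 * A * I) * (wgt l x * norm (\<Phi> x))" for k
    proof (rule AE_I2)
      fix x :: 'a
      have "norm (\<Phi> x) * \<omega> ((1 / s k) *\<^sub>R x) \<le> norm (\<Phi> x) * (2 * A * I * wgt l x)"
        using A I0 by (intro mult_left_mono order_trans[OF \<omega>b] wgt_norm_mono small l) auto
      then show "norm (norm (\<Phi> x) * \<omega> ((1 / s k) *\<^sub>R x)) \<le> (2 * A * I) * (wgt l x * norm (\<Phi> x))"
        using \<omega>0 by (simp add: abs_mult mult_ac)
    qed
    show "AE x in lborel. (\<lambda>k. norm (\<Phi> x) * \<omega> ((1 / s k) *\<^sub>R x)) \<longlonglongrightarrow> 0"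
    proof (rule AE_I2)
      fix x :: 'a
      have "(\<lambda>k. (1 / s k) *\<^sub>R x) \<longlonglongrightarrow> 0 *\<^sub>R x"
        by (rule tendsto_scaleR[OF _ tendsto_const]) (use tendsto_inverse_0_at_top[OF s] in \<open>simp add: inverse_eq_divide\<close>)
      then have "(\<lambda>k. \<omega> ((1 / s k) *\<^sub>R x)) \<longlonglongrightarrow> 0"
        unfolding \<omega>_def unfolding p_def by (intro weighted_L1_translation[OF l q F]) simp
      then have "(\<lambda>k. norm (\<Phi> x) * \<omega> ((1 / s k) *\<^sub>R x)) \<longlonglongrightarrow> norm (\<Phi> x) * 0" by (intro tendsto_intros)
      then show "(\<lambda>k. norm (\<Phi> x) * \<omega> ((1 / s k) *\<^sub>R x)) \<longlonglongrightarrow> 0" by simp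
    qed
  qed measurable
  have "(\<lambda>k. \<integral>w. norm (wgt (- p) w *\<^sub>R D k w) \<partial>lborel) \<longlonglongrightarrow> 0"
    by (rule tendsto_sandwich[OF _ _ tendsto_const]) (use bound lim in \<open>auto intro!: always_eventually Bochner_Integration.integral_nonneg\<close>)
  from tendsto_L1_AE_subseq[OF Di this]
  obtain r where r: "strict_mono r" "AE w in lborel. (\<lambda>k. wgt (- p) w *\<^sub>R D (r k) w) \<longlonglongrightarrow> 0" by blast
  from r(2) have "AE w in lborel. (\<lambda>k. corr (\<lambda>x. (s (r k) ^ DIM('a)) *\<^sub>R \<Phi> (s (r k) *\<^sub>R x)) F w) \<longlonglongrightarrow> c * F w"
  proof eventually_elim
    case (elim w)
    have "(\<lambda>k. inverse (wgt (- p) w) *\<^sub>R (wgt (- p) w *\<^sub>R D (r k) w) + c * F w) \<longlonglongrightarrow> inverse (wgt (- p) w) *\<^sub>R 0 + c * F w"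
      by (intro tendsto_intros elim)
    then show ?case by (simp add: D_def)
  qed
  then show ?thesis using r(1) unfolding c_def by blast
qed


subsection \<open>A partition of unity adapted to the kernel\<close>

text \<open>Equal to 1 on the cube of points with all |\<xi>_i| \<le> 1, and 0 as soon as some
  |\<xi>_i| is at least 2. The product form reduces smoothness to one variable.\<close>

definition cutoff :: "real ^ 'n \<Rightarrow> complex" where
  "cutoff \<xi> = (\<Prod>i\<in>UNIV. complex_of_real (smooth_step (2 + (- 1) * \<xi> $ i) * smooth_step (2 + 1 * \<xi> $ i)))"

definition shell :: "real ^ 'n \<Rightarrow> complex" where
  "shell \<xi> = cutoff \<xi> - cutoff (2 *\<^sub>R \<xi>)"

lemma Ck_cutoff: "open S \<Longrightarrow> Ck N S cutoff"
  unfolding cutoff_def[abs_def]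
  by (intro Ck_prod Ck_component[where f="\<lambda>t. smooth_step (2 + (- 1) * t) * smooth_step (2 + 1 * t)"]
      smooth_upto_mult smooth_upto_affine smooth_upto_smooth_step | assumption)+

lemma cutoff_eq_1: "norm \<xi> \<le> 1 \<Longrightarrow> cutoff \<xi> = 1"
proof -
  assume \<xi>: "norm \<xi> \<le> 1"
  have "\<bar>\<xi> $ i\<bar> \<le> 1" for i using component_le_norm_cart[of \<xi> i] \<xi> by linarith
  then have "smooth_step (2 + (- 1) * \<xi> $ i) = 1" "smooth_step (2 + 1 * \<xi> $ i) = 1" for i
    by (auto intro!: smooth_step_eq_1 simp: abs_le_iff algebra_simps) (smt (verit, best) abs_le_iff)+
  then show ?thesis by (simp add: cutoff_def)
qed

lemma cutoff_eq_0:
  fixes \<xi> :: "real ^ 'n"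
  assumes "2 * real CARD('n) < norm \<xi>"
  shows "cutoff \<xi> = 0"
proof -
  have "\<exists>i. 2 \<le> \<bar>\<xi> $ i\<bar>"
  proof (rule ccontr)
    assume "\<nexists>i. 2 \<le> \<bar>\<xi> $ i\<bar>"
    then have "\<bar>\<xi> $ i\<bar> \<le> 2" for i by (meson linear)
    then have "(\<Sum>i\<in>UNIV. \<bar>\<xi> $ i\<bar>) \<le> (\<Sum>i\<in>(UNIV::'n set). 2)" by (intro sum_mono)
    then show False using norm_le_l1_cart[of \<xi>] assms by simp
  qed
  then obtain i where i: "2 \<le> \<bar>\<xi> $ i\<bar>" by blast
  then have "smooth_step (2 + (- 1) * \<xi> $ i) = 0 \<or> smooth_step (2 + 1 * \<xi> $ i) = 0"
    by (cases "0 \<le> \<xi> $ i") (auto intro!: smooth_step_eq_0)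
  then show ?thesis unfolding cutoff_def by (intro prod_zero) auto
qed

text \<open>The norm is at most the sum of the n coordinates, so this ball contains the cube of
  half-side 2 outside which \<open>cutoff\<close> vanishes.\<close>

definition outer_radius :: "'n::finite itself \<Rightarrow> real" where
  "outer_radius _ = 2 * real CARD('n)"

lemma shell_eq_0:
  fixes \<xi> :: "real ^ 'n"
  assumes "norm \<xi> \<le> 1 / 2 \<or> outer_radius TYPE('n) < norm \<xi>"
  shows "shell \<xi> = 0"
  using assms
proof
  assume "norm \<xi> \<le> 1 / 2"
  then show ?thesis by (simp add: shell_def cutoff_eq_1)
next
  assume a: "outer_radius TYPE('n) < norm \<xi>"
  then have "2 * real CARD('n) < norm (2 *\<^sub>R \<xi>)" by (simp add: outer_radius_def)
  then show ?thesis using a unfolding shell_def by (simp add: cutoff_eq_0 outer_radius_def)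
qed

lemma Ck_shell: "open S \<Longrightarrow> Ck N S shell"
proof -
  assume S: "open S"
  have "Ck N S (\<lambda>\<xi>. cutoff \<xi> + (- 1) * cutoff (2 *\<^sub>R \<xi>))"
    by (intro Ck_add Ck_mult Ck_const Ck_cutoff S Ck_scaled[where S=UNIV]) auto
  then show ?thesis by (simp add: shell_def[abs_def])
qed

text \<open>A single dilate of \<open>p\<close> may vanish somewhere on the support of \<^const>\<open>shell\<close>, in directions that
  the Tauberian condition does not control uniformly, so \<^const>\<open>shell\<close> is divided by a sum over
  finitely many dilates.\<close>

definition energy :: "(real ^ 'n \<Rightarrow> complex) \<Rightarrow> nat \<Rightarrow> real ^ 'n \<Rightarrow> complex" where
  "energy p L \<xi> = (\<Sum>k\<in>{- int L..int L}. p ((2 powi k) *\<^sub>R \<xi>) * cnj (p ((2 powi k) *\<^sub>R \<xi>)))"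

text \<open>Among all solutions u of the equation Sum_k p(2^k \<xi>) u_k = shell \<xi> this is,
  where \<open>energy\<close> does not vanish, the one of least Euclidean norm. It requires no
  choice of a dilate that depends on \<xi>, hence is as regular as p.\<close>

definition freq_part :: "(real ^ 'n \<Rightarrow> complex) \<Rightarrow> nat \<Rightarrow> int \<Rightarrow> real ^ 'n \<Rightarrow> complex" where
  "freq_part p L k \<xi> = shell \<xi> * cnj (p ((2 powi k) *\<^sub>R \<xi>)) * inverse (energy p L \<xi>)"

definition covers :: "(real ^ 'n \<Rightarrow> complex) \<Rightarrow> nat \<Rightarrow> bool" where
  "covers p L \<longleftrightarrow> (\<forall>\<xi>. 1 / 2 \<le> norm \<xi> \<and> norm \<xi> \<le> outer_radius TYPE('n) \<longrightarrow>
     (\<exists>k\<in>{- int L..int L}. p ((2 powi k) *\<^sub>R \<xi>) \<noteq> 0))"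

lemma energy_neq_0:
  assumes "covers p L" "1 / 2 \<le> norm \<xi>" "norm \<xi> \<le> outer_radius TYPE('n)"
  shows "energy p L (\<xi> :: real ^ 'n) \<noteq> 0"
proof -
  obtain k where k: "k \<in> {- int L..int L}" "p ((2 powi k) *\<^sub>R \<xi>) \<noteq> 0" using assms unfolding covers_def by blast
  have "0 < (\<Sum>k\<in>{- int L..int L}. (norm (p ((2 powi k) *\<^sub>R \<xi>)))\<^sup>2)"
    by (rule sum_pos2[OF _ k(1)]) (use k in auto)
  moreover have "energy p L \<xi> = complex_of_real (\<Sum>k\<in>{- int L..int L}. (norm (p ((2 powi k) *\<^sub>R \<xi>)))\<^sup>2)"
    unfolding energy_def of_real_sum by (intro sum.cong refl) (simp only: complex_norm_square)
  ultimately show ?thesis by (metis less_irrefl of_real_eq_0_iff)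
qed

lemma sum_freq_part:
  fixes p :: "real ^ 'n \<Rightarrow> complex"
  assumes "covers p L"
  shows "(\<Sum>k\<in>{- int L..int L}. p ((2 powi k) *\<^sub>R \<xi>) * freq_part p L k \<xi>) = shell \<xi>"
proof -
  have "(\<Sum>k\<in>{- int L..int L}. p ((2 powi k) *\<^sub>R \<xi>) * freq_part p L k \<xi>) = shell \<xi> * (energy p L \<xi> * inverse (energy p L \<xi>))"
    unfolding freq_part_def energy_def[of p L \<xi>] sum_distrib_right sum_distrib_left by (intro sum.cong refl) (simp add: mult_ac)
  also have "\<dots> = shell \<xi>"
  proof (cases "shell \<xi> = 0")
    case False
    then have "1 / 2 \<le> norm \<xi>" "norm \<xi> \<le> outer_radius TYPE('n)"
      using shell_eq_0[of \<xi>] by (meson linear not_le)+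
    then show ?thesis using energy_neq_0[OF assms, of \<xi>] by simp
  qed simp
  finally show ?thesis .
qed

lemma freq_part_support:
  fixes p :: "real ^ 'n \<Rightarrow> complex"
  assumes "norm \<xi> \<le> 1 / 2 \<or> outer_radius TYPE('n) < norm \<xi>"
  shows "freq_part p L k \<xi> = 0"
  using shell_eq_0[OF assms] by (simp add: freq_part_def)

lemma open_compl0: "open (- {0 :: real ^ 'n})"
  by auto

text \<open>Two open sets cover the space: one where \<open>energy\<close> is nonzero and the
  quotient is regular, and one where \<open>shell\<close> vanishes. The second contains a
  neighbourhood of the origin, where p itself may be singular.\<close>

lemma Ck_freq_part_mult:
  fixes p :: "real ^ 'n \<Rightarrow> complex"
  assumes p: "Ck N (- {0}) p" and cov: "covers p L" and c: "c \<noteq> 0"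
  shows "Ck N UNIV (\<lambda>\<xi>. p (c *\<^sub>R \<xi>) * freq_part p L k \<xi>)" and "Ck N UNIV (freq_part p L k)"
proof -
  have sc: "Ck N (- {0}) (\<lambda>\<xi>. p (c *\<^sub>R \<xi>))" if "c \<noteq> 0" for c
    by (rule Ck_scaled[OF open_compl0 _ p]) (use that in auto)
  have E: "Ck N (- {0}) (energy p L)"
    unfolding energy_def[abs_def] by (intro Ck_sum Ck_mult Ck_cnj sc open_compl0) auto
  define S where "S = - {0} \<inter> energy p L -` (- {0})"
  have "open S"
    unfolding S_def by (rule continuous_open_preimage[OF Ck_continuous[OF E]]) auto
  have SS: "S \<subseteq> - {0}" by (auto simp: S_def)
  have fS: "Ck N S (freq_part p L k)"
    unfolding freq_part_def[abs_def]
    using Ck_subset[OF E SS] Ck_subset[OF sc[of "2 powi k"] SS]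
    by (intro Ck_mult Ck_shell Ck_cnj Ck_inverse \<open>open S\<close>) (auto simp: S_def)
  have gS: "Ck N S (\<lambda>\<xi>. p (c *\<^sub>R \<xi>) * freq_part p L k \<xi>)"
    by (intro Ck_mult \<open>open S\<close> fS Ck_subset[OF sc[OF c] SS])
  define T where "T = {\<xi>::real ^ 'n. norm \<xi> < 1 / 2} \<union> {\<xi>. outer_radius TYPE('n) < norm \<xi>}"
  have "open T" unfolding T_def by (intro open_Un open_Collect_less continuous_intros)
  have fT: "Ck N T (freq_part p L k)"
    by (rule Ck_cong[OF \<open>open T\<close> _ Ck_const[of N T 0]]) (auto simp: T_def freq_part_support)
  have gT: "Ck N T (\<lambda>\<xi>. p (c *\<^sub>R \<xi>) * freq_part p L k \<xi>)"
    by (rule Ck_cong[OF \<open>open T\<close> _ Ck_const[of N T 0]]) (auto simp: T_def freq_part_support)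
  have U: "S \<union> T = UNIV"
  proof -
    have "\<xi> \<in> S" if "\<xi> \<notin> T" for \<xi>
      using that energy_neq_0[OF cov, of \<xi>] by (auto simp: T_def S_def not_less)
    then show ?thesis by auto
  qed
  show "Ck N UNIV (\<lambda>\<xi>. p (c *\<^sub>R \<xi>) * freq_part p L k \<xi>)"
    using Ck_Un[OF \<open>open S\<close> \<open>open T\<close> gS gT] by (simp add: U)
  show "Ck N UNIV (freq_part p L k)"
    using Ck_Un[OF \<open>open S\<close> \<open>open T\<close> fS fT] by (simp add: U)
qed

text \<open>An interval [a, b] with b at least 2 a contains a dyadic multiple of any positive
  number, so along every ray some dilate is nonzero. By continuity it stays nonzero nearby, and
  compactness of the annulus leaves finitely many dilates although a and b vary with the
  direction.\<close>

lemma tauberian_covers: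
  fixes \<psi> :: "real ^ 'n \<Rightarrow> complex"
  assumes t: "tauberian \<psi>" and c: "continuous_on (- {0}) (fourier \<psi>)"
  shows "\<exists>L. covers (fourier \<psi>) L"
proof -
  have ex: "\<exists>k::int. fourier \<psi> ((2 powi k) *\<^sub>R \<xi>) \<noteq> 0" if \<xi>: "\<xi> \<noteq> 0" for \<xi>
  proof -
    have "norm (\<xi> /\<^sub>R norm \<xi>) = 1" using \<xi> by simp
    then obtain a b where ab: "0 < 2 * a" "2 * a \<le> b"
      "\<And>t. a \<le> t \<Longrightarrow> t \<le> b \<Longrightarrow> norm (fourier \<psi> (t *\<^sub>R (\<xi> /\<^sub>R norm \<xi>))) > 0"
      using t unfolding tauberian_def by blast
    have n: "0 < norm \<xi>" using \<xi> by simp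
    define u where "u = log 2 (a / norm \<xi>)"
    have "0 < a / norm \<xi>" using ab(1) n by simp
    then have u: "2 powr u = a / norm \<xi>" by (simp add: u_def)
    \<comment> \<open>Rounding up loses less than a factor 2, so 2^k |\<xi>| lies between a and 2 a,
      inside the interval of nonvanishing.\<close>
    define k where "k = \<lceil>u\<rceil>"
    have k: "2 powi k = (2::real) powr k" by (simp add: powr_real_of_int')
    have "2 powr u \<le> 2 powr k" unfolding k_def by (intro powr_mono) auto
    moreover have "2 powr k \<le> 2 powr (u + 1)" unfolding k_def by (intro powr_mono) linarith+
    ultimately have "a / norm \<xi> \<le> 2 powi k" "2 powi k \<le> 2 * (a / norm \<xi>)"
      unfolding k by (simp_all add: powr_add u mult.commute)
    then have "a \<le> 2 powi k * norm \<xi>" "2 powi k * norm \<xi> \<le> b"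
      using n ab(2) by (simp_all add: divide_simps mult_ac)
    from ab(3)[OF this] show ?thesis using n by (intro exI[of _ k]) (simp add: mult.assoc)
  qed
  define K where "K = {\<xi> :: real ^ 'n. 1 / 2 \<le> norm \<xi> \<and> norm \<xi> \<le> outer_radius TYPE('n)}"
  have "K = cball 0 (outer_radius TYPE('n)) \<inter> {\<xi>. 1 / 2 \<le> norm \<xi>}" by (auto simp: K_def)
  then have "compact K"
    by (auto intro!: compact_Int_closed closed_Collect_le continuous_intros)
  define U where "U k = (- {0} \<inter> (\<lambda>\<xi>. fourier \<psi> ((2 powi k) *\<^sub>R \<xi>)) -` (- {0}))" for k :: int
  have oU: "open (U k)" for k
    unfolding U_def
    by (rule continuous_open_preimage) (auto intro!: continuous_on_compose2[OF c] continuous_intros)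
  have KU: "K \<subseteq> (\<Union>k\<in>UNIV. U k)"
  proof
    fix \<xi> assume "\<xi> \<in> K"
    then have "\<xi> \<noteq> 0" by (auto simp: K_def)
    then show "\<xi> \<in> (\<Union>k\<in>UNIV. U k)" using ex[of \<xi>] by (auto simp: U_def)
  qed
  obtain C where C: "finite C" "K \<subseteq> (\<Union>k\<in>C. U k)"
    by (rule compactE_image[OF \<open>compact K\<close> oU KU]) auto
  define L where "L = nat (Max (insert 0 (abs ` C)))"
  have L: "k \<in> {- int L..int L}" if "k \<in> C" for k
  proof -
    have "\<bar>k\<bar> \<le> Max (insert 0 (abs ` C))" using C(1) that by (intro Max_ge) auto
    moreover have "0 \<le> Max (insert 0 (abs ` C))" using C(1) by (intro Max_ge) auto
    ultimately show ?thesis unfolding L_def by auto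
  qed
  have "covers (fourier \<psi>) L"
    unfolding covers_def
  proof (intro allI impI)
    fix \<xi> :: "real ^ 'n" assume "1 / 2 \<le> norm \<xi> \<and> norm \<xi> \<le> outer_radius TYPE('n)"
    then have "\<xi> \<in> K" by (simp add: K_def)
    then obtain k where "k \<in> C" "\<xi> \<in> U k" using C(2) by blast
    then show "\<exists>k\<in>{- int L..int L}. fourier \<psi> ((2 powi k) *\<^sub>R \<xi>) \<noteq> 0"
      using L by (auto simp: U_def)
  qed
  then show ?thesis ..
qed

subsection \<open>Kernel bounds\<close>

lemma Bk_mono: "M \<le> N \<Longrightarrow> Bk N S B g \<Longrightarrow> Bk M S B g"
  by (induction N rule: nat_induct) (auto simp: le_Suc_eq intro: Bk_less simp del: Bk.simps(2))

lemma Bk_subset: "Bk N S B g \<Longrightarrow> T \<subseteq> S \<Longrightarrow> Bk N T B g"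
  by (induction N arbitrary: g) auto

lemma Bk_Un: "Bk N S B f \<Longrightarrow> Bk N T B f \<Longrightarrow> Bk N (S \<union> T) B f"
  by (induction N arbitrary: f) auto

lemma Bk_zero: "0 \<le> B \<Longrightarrow> Bk N S B (\<lambda>x. 0)"
  by (induction N) (auto simp: partial_deriv_const)

lemma Bk_compact_support:
  fixes g :: "real ^ 'n \<Rightarrow> complex"
  assumes g: "Ck N UNIV g" and supp: "\<And>x. R < norm x \<Longrightarrow> g x = 0"
  obtains B where "0 \<le> B" "Bk N UNIV B g"
proof -
  obtain B where B: "0 \<le> B" "\<And>T. T \<subseteq> cball 0 (R + 1) \<Longrightarrow> Bk N T B g"
    using Bk_compact[OF compact_cball open_UNIV _ g] by blast
  have o: "open {x :: real ^ 'n. R < norm x}" by (intro open_Collect_less continuous_intros)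
  have "Bk N {x. R < norm x} B g"
    by (rule Bk_cong[OF o _ Ck_const Bk_zero[OF B(1)]]) (use supp in auto)
  with B(2)[of "cball 0 (R + 1)"] have "Bk N (cball 0 (R + 1) \<union> {x. R < norm x}) B g"
    by (intro Bk_Un) auto
  moreover have "cball 0 (R + 1) \<union> {x. R < norm x} = (UNIV :: (real ^ 'n) set)" by auto
  ultimately show ?thesis using that B(1) by simp
qed

lemma ift_wgt_bound:
  fixes g :: "real ^ 'n \<Rightarrow> complex"
  assumes g: "Ck N UNIV g" and supp: "\<And>x. R < norm x \<Longrightarrow> g x = 0" and q: "q \<le> real N"
  obtains C where "0 \<le> C" "\<And>x. norm (ift g x) \<le> C * wgt (- q) x"
proof -
  obtain B where B: "0 \<le> B" "Bk N UNIV B g" using Bk_compact_support[OF g supp] by blast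
  let ?C = "decay_const TYPE('n) N R * B"
  have C0: "0 \<le> ?C" using B by (simp add: decay_const_def)
  have "norm (ift g x) \<le> ?C * wgt (- q) x" for x
  proof -
    have w: "wgt (real N) x = (1 + norm x) ^ N" by (simp add: wgt_def powr_realpow add_pos_nonneg)
    have "norm (ift g x) = wgt (- real N) x * (wgt (real N) x * norm (ift g x))"
      by (simp add: wgt_mult mult.assoc[symmetric])
    also have "\<dots> \<le> wgt (- real N) x * ?C"
      unfolding w by (intro mult_left_mono ift_decay[OF g B(2) supp]) auto
    also have "\<dots> \<le> wgt (- q) x * ?C" using q C0 by (intro mult_right_mono wgt_mono) auto
    finally show ?thesis by (simp add: mult.commute)
  qed
  then show ?thesis using that C0 by blast
qed

text \<open>N derivatives give decay of order N, and N - l > n makes the weighted kernel integrable.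
  This is the origin of the n + 1 + [\<ell>] derivatives in the theorem.\<close>

lemma wint_ift:
  fixes g :: "real ^ 'n \<Rightarrow> complex"
  assumes g: "Ck N UNIV g" and supp: "\<And>x. R < norm x \<Longrightarrow> g x = 0" and N: "real CARD('n) + l < real N"
  shows "wint l (ift g)"
proof -
  obtain C where C: "0 \<le> C" "\<And>x. norm (ift g x) \<le> C * wgt (- real N) x"
    using ift_wgt_bound[OF g supp order_refl] by blast
  have [measurable]: "g \<in> borel_measurable borel" by (rule borel_measurable_continuous_onI[OF Ck_continuous[OF g]])
  have "integrable lborel (\<lambda>x. wgt l x * norm (ift g x))"
  proof (rule integrable_dominated)
    show "integrable lborel (\<lambda>x :: real ^ 'n. C * wgt (- (real N - l)) x)"
      using N by (intro integrable_mult_right wgt_integrable) auto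
    show "norm (wgt l x * norm (ift g x)) \<le> C * wgt (- (real N - l)) x" for x
    proof -
      have "wgt l x * norm (ift g x) \<le> wgt l x * (C * wgt (- real N) x)"
        by (rule mult_left_mono[OF C(2)]) simp
      also have "\<dots> = C * wgt (- (real N - l)) x"
        using wgt_mult[of l x "- real N"] by (simp add: algebra_simps)
      finally show ?thesis by simp
    qed
  qed measurable
  then show ?thesis by (simp add: wint_def)
qed

text \<open>Scaling by \<open>2\<^sup>s\<close> costs a factor \<open>2\<^sup>s\<^sup>M\<close> for derivatives of order \<open>M\<close>, which is
  paid by measuring \<open>x\<close> in units of \<open>2\<^sup>s\<close>; the decay of \<open>p\<close> at infinity is kept.\<close>

lemma scaled_kernel_bound:
  fixes p :: "real ^ 'n \<Rightarrow> complex"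
  assumes p: "Ck M (- {0}) p" and cov: "covers p L" and lam: "0 \<le> lam" "lam \<le> real M"
    and O: "\<And>\<kappa>. length \<kappa> \<le> M \<Longrightarrow> (\<lambda>\<xi>. norm (pderivs \<kappa> p \<xi>)) \<in> O[at_infinity](\<lambda>\<xi>. norm \<xi> powr (- \<beta>))"
  shows "\<exists>C\<ge>0. \<forall>s x. norm (ift (\<lambda>\<xi>. p ((2 ^ s) *\<^sub>R \<xi>) * freq_part p L k \<xi>) x) \<le>
      C * 2 powr (- real s * \<beta>) * wgt (- lam) ((1 / 2 ^ s) *\<^sub>R x)"
proof -
  let ?R = "outer_radius TYPE('n)"
  let ?u = "freq_part p L k"
  \<comment> \<open>The hypothesis on p concerns large \<xi> only; on the remaining compact shell,
    which avoids the origin, continuity gives the same kind of bound.\<close>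
  have far: "\<exists>C\<ge>0. \<forall>\<xi>. 1 / 4 \<le> norm \<xi> \<longrightarrow> norm (pderivs \<kappa> p \<xi>) \<le> C * norm \<xi> powr (- \<beta>)" if \<kappa>: "length \<kappa> \<le> M" for \<kappa>
  proof -
    from O[OF \<kappa>] obtain c where c: "c > 0" "\<forall>\<^sub>F \<xi> in at_infinity. norm (norm (pderivs \<kappa> p \<xi>)) \<le> c * norm (norm \<xi> powr (- \<beta>))"
      by (rule landau_o.bigE)
    then obtain b where b: "\<And>\<xi>. b \<le> norm \<xi> \<Longrightarrow> norm (pderivs \<kappa> p \<xi>) \<le> c * norm \<xi> powr (- \<beta>)"
      by (auto simp: eventually_at_infinity)
    let ?K = "cball 0 b \<inter> {\<xi> :: real ^ 'n. 1 / 4 \<le> norm \<xi>}"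
    have K: "compact ?K" by (intro compact_Int_closed closed_Collect_le continuous_intros) auto
    have cd: "continuous_on (- {0}) (pderivs \<kappa> p)" using p \<kappa> unfolding C_on_iff_Ck[symmetric] C_on_def by blast
    have "continuous_on ?K (\<lambda>\<xi>. norm \<xi> powr \<beta> *\<^sub>R pderivs \<kappa> p \<xi>)"
      by (intro continuous_intros continuous_on_subset[OF cd]) auto
    then have "bounded ((\<lambda>\<xi>. norm \<xi> powr \<beta> *\<^sub>R pderivs \<kappa> p \<xi>) ` ?K)"
      by (intro compact_imp_bounded compact_continuous_image K)
    then obtain B where B: "\<And>\<xi>. \<xi> \<in> ?K \<Longrightarrow> norm (norm \<xi> powr \<beta> *\<^sub>R pderivs \<kappa> p \<xi>) \<le> B"
      unfolding bounded_iff by blast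
    have "norm (pderivs \<kappa> p \<xi>) \<le> max B c * norm \<xi> powr (- \<beta>)" if \<xi>: "1 / 4 \<le> norm \<xi>" for \<xi>
    proof (cases "b \<le> norm \<xi>")
      case True
      show ?thesis by (rule order_trans[OF b[OF True]]) (auto intro: mult_right_mono)
    next
      case False
      then have "norm \<xi> powr \<beta> * norm (pderivs \<kappa> p \<xi>) \<le> B" using B[of \<xi>] \<xi> by simp
      then have "norm (pderivs \<kappa> p \<xi>) \<le> B * norm \<xi> powr (- \<beta>)"
        using \<xi> by (cases "\<xi> = 0") (simp_all add: powr_minus field_simps)
      also have "\<dots> \<le> max B c * norm \<xi> powr (- \<beta>)" by (intro mult_right_mono) auto
      finally show ?thesis .
    qed
    then show ?thesis using c(1) by (intro exI[of _ "max B c"]) auto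
  qed
  have fin: "finite {\<kappa> :: 'n list. length \<kappa> \<le> M}" using finite_lists_length_le[of "UNIV :: 'n set" M] by simp
  obtain c where c: "\<And>\<kappa>. length \<kappa> \<le> M \<Longrightarrow> 0 \<le> c \<kappa>"
    "\<And>\<kappa> \<xi>. length \<kappa> \<le> M \<Longrightarrow> 1 / 4 \<le> norm \<xi> \<Longrightarrow> norm (pderivs \<kappa> p \<xi>) \<le> c \<kappa> * norm \<xi> powr (- \<beta>)"
    using far by metis
  define C0 where "C0 = (\<Sum>\<kappa>\<in>{\<kappa> :: 'n list. length \<kappa> \<le> M}. c \<kappa>)"
  have C0: "0 \<le> C0" unfolding C0_def by (rule sum_nonneg) (use c in auto)
  have pC0: "norm (pderivs \<kappa> p \<xi>) \<le> C0 * norm \<xi> powr (- \<beta>)" if "length \<kappa> \<le> M" "1 / 4 \<le> norm \<xi>" for \<kappa> \<xi>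
  proof -
    have "c \<kappa> \<le> C0" unfolding C0_def by (rule member_le_sum) (use that c fin in auto)
    then show ?thesis by (intro order_trans[OF c(2)[OF that]] mult_right_mono) auto
  qed
  \<comment> \<open>As \<beta> may have either sign, the power is largest at one end of the interval
    or at the other; the sum of both values bounds it in each case.\<close>
  define D where "D = (1 / 4) powr (- \<beta>) + (?R + 1) powr (- \<beta>)"
  have D0: "0 \<le> D" by (simp add: D_def)
  have D: "t powr (- \<beta>) \<le> D" if "1 / 4 < t" "t < ?R + 1" for t
  proof (cases "0 \<le> \<beta>")
    case True
    have "t powr (- \<beta>) \<le> (1 / 4) powr (- \<beta>)" using True that by (intro powr_mono2') auto
    then show ?thesis by (simp add: D_def add_increasing2)
  next
    case False
    have "t powr (- \<beta>) \<le> (?R + 1) powr (- \<beta>)" using False that by (intro powr_mono2) auto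
    then show ?thesis by (simp add: D_def add_increasing)
  qed
  \<comment> \<open>An open annulus around the closed support of u_k; with the open region T' where
    u_k vanishes it covers the space.\<close>
  define T where "T = {\<xi> :: real ^ 'n. 1 / 4 < norm \<xi>} \<inter> {\<xi>. norm \<xi> < ?R + 1}"
  have oT: "open T" unfolding T_def by (intro open_Int open_Collect_less continuous_intros)
  define S where "S s = {\<eta> :: real ^ 'n. (1 / 2 ^ s) *\<^sub>R \<eta> \<in> T}" for s :: nat
  have oS: "open (S s)" for s
  proof -
    have "open ((\<lambda>\<eta>. (1 / 2 ^ s) *\<^sub>R \<eta>) -` T)" by (rule open_vimage[OF oT]) (intro continuous_intros)
    then show ?thesis by (simp add: S_def vimage_def)
  qed
  have S0: "S s \<subseteq> - {0}" for s by (auto simp: S_def T_def)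
  have T0: "T \<subseteq> - {0}" by (auto simp: T_def)
  define e where "e s = 2 powr (- real s * \<beta>)" for s
  have e0: "0 < e s" for s by (simp add: e_def)
  \<comment> \<open>On S s, the annulus T enlarged by 2^s, all derivatives of p have size about
    2^(-s \<beta>).\<close>
  have BS: "Bk M (S s) (C0 * (e s * D)) p" for s
  proof (rule BkI)
    fix "is" :: "'n list" and \<eta> assume a: "length is \<le> M" "\<eta> \<in> S s"
    let ?t = "norm ((1 / 2 ^ s) *\<^sub>R \<eta>)"
    have t: "1 / 4 < ?t" "?t < ?R + 1" using a(2) by (auto simp: S_def T_def)
    have n: "norm \<eta> = 2 ^ s * ?t" by simp
    have "1 * ?t \<le> 2 ^ s * ?t" by (intro mult_right_mono) auto
    then have "1 / 4 \<le> norm \<eta>" using t(1) n by linarith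
    from pC0[OF a(1) this] have "norm (pderivs is p \<eta>) \<le> C0 * norm \<eta> powr (- \<beta>)" .
    also have "norm \<eta> powr (- \<beta>) = e s * ?t powr (- \<beta>)"
      unfolding n by (subst powr_mult) (auto simp: e_def powr_realpow[symmetric] powr_powr)
    also have "C0 * (e s * ?t powr (- \<beta>)) \<le> C0 * (e s * D)"
      using D[OF t] C0 e0 by (intro mult_left_mono) (auto intro: less_imp_le)
    finally show "norm (pderivs is p \<eta>) \<le> C0 * (e s * D)" .
  qed
  have u: "Ck M UNIV ?u" using Ck_freq_part_mult(2)[OF p cov, of 1] by simp
  obtain Bu where Bu: "0 \<le> Bu" "Bk M UNIV Bu ?u"
    by (rule Bk_compact_support[OF u, of ?R]) (auto intro: freq_part_support)
  have BuT: "Bk M' T Bu ?u" if "M' \<le> M" for M'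
    by (rule Bk_subset[OF Bk_mono[OF that Bu(2)]]) simp
  have cT: "(2 ^ s) *\<^sub>R \<xi> \<in> S s" if "\<xi> \<in> T" for s \<xi> using that by (simp add: S_def)
  define g where "g s \<xi> = p ((2 ^ s) *\<^sub>R \<xi>) * ?u \<xi>" for s \<xi>
  define T' where "T' = {\<xi> :: real ^ 'n. norm \<xi> < 1 / 2} \<union> {\<xi>. ?R < norm \<xi>}"
  have oT': "open T'" unfolding T'_def by (intro open_Un open_Collect_less continuous_intros)
  have TT: "T \<union> T' = UNIV" by (auto simp: T_def T'_def)
  have Ckg: "Ck M UNIV (g s)" for s
    unfolding g_def using Ck_freq_part_mult(1)[OF p cov, of "2 ^ s"] by simp
  have Bg: "Bk M' UNIV (2 ^ M' * ((2 ^ s) ^ M' * (C0 * (e s * D)) * Bu)) (g s)" if M': "M' \<le> M" for M' s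
  proof -
    have pM: "Ck M' (- {0}) p" by (rule Ck_mono[OF M' p])
    have BSM: "Bk M' (S s) (C0 * (e s * D)) p"
      by (rule Bk_mono[OF M' BS])
    have nn: "0 \<le> C0 * (e s * D)" using C0 D0 e0[of s] by simp
    have "Bk M' T ((2 ^ s) ^ M' * (C0 * (e s * D))) (\<lambda>\<xi>. p ((2 ^ s) *\<^sub>R \<xi>))"
      by (rule Bk_scaled[OF oS oT cT _ nn Ck_subset[OF pM S0] BSM]) auto
    then have "Bk M' T (2 ^ M' * ((2 ^ s) ^ M' * (C0 * (e s * D)) * Bu)) (g s)"
      unfolding g_def
      by (intro Bk_mult oT Ck_scaled[OF oT _ pM] Ck_subset[OF Ck_mono[OF M' u]] BuT[OF M'] Bu(1))
        (use T0 nn in auto)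
    moreover have "Bk M' T' (2 ^ M' * ((2 ^ s) ^ M' * (C0 * (e s * D)) * Bu)) (g s)"
      by (rule Bk_cong[OF oT' _ Ck_const Bk_zero])
        (use nn Bu(1) in \<open>auto simp: g_def T'_def freq_part_support\<close>)
    ultimately show ?thesis using Bk_Un TT by metis
  qed
  have supp: "?R < norm \<xi> \<Longrightarrow> g s \<xi> = 0" for s \<xi> by (simp add: g_def freq_part_support)
  define V where "V = C0 * D * Bu"
  have V0: "0 \<le> V" using C0 D0 Bu by (simp add: V_def)
  define dM where "dM = decay_const TYPE('n) M ?R * 2 ^ M"
  define d0 where "d0 = decay_const TYPE('n) 0 ?R"
  have d: "0 \<le> dM" "0 \<le> d0" by (simp_all add: dM_def d0_def decay_const_def)
  \<comment> \<open>The bound of order 0 serves |x| \<le> 2^s. Beyond, M derivatives produce the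
    factor 2^(s M), which dividing x by 2^s compensates. Adding both gives the weight at the scale
    2^s.\<close>
  have main: "norm (ift (g s) x) \<le> (2 ^ M * (d0 + dM) * V) * e s * wgt (- lam) ((1 / 2 ^ s) *\<^sub>R x)" for s x
  proof -
    have b0: "norm (ift (g s) x) \<le> d0 * V * e s"
    proof -
      have "(1 + norm x) ^ 0 * norm (ift (g s) x) \<le> d0 * (2 ^ 0 * ((2 ^ s) ^ 0 * (C0 * (e s * D)) * Bu))"
        unfolding d0_def by (rule ift_decay[OF Ck_mono[OF _ Ckg] Bg supp]) auto
      then show ?thesis by (simp add: V_def mult_ac)
    qed
    have "(1 + norm x) ^ M * norm (ift (g s) x) \<le> dM * V * e s * (2 ^ s) ^ M"
    proof -
      have "(1 + norm x) ^ M * norm (ift (g s) x) \<le>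
          decay_const TYPE('n) M ?R * (2 ^ M * ((2 ^ s) ^ M * (C0 * (e s * D)) * Bu))"
        by (rule ift_decay[OF Ckg Bg supp]) auto
      then show ?thesis by (simp add: dM_def V_def mult_ac)
    qed
    moreover have "norm x ^ M * norm (ift (g s) x) \<le> (1 + norm x) ^ M * norm (ift (g s) x)"
      by (intro mult_right_mono power_mono) auto
    ultimately have bM: "((1 / 2 ^ s) * norm x) ^ M * norm (ift (g s) x) \<le> dM * V * e s"
      by (simp add: power_divide field_simps)
    let ?y = "(1 / 2 ^ s) * norm x"
    have "(1 + ?y) ^ M \<le> (2 * max 1 ?y) ^ M" by (rule power_mono) auto
    also have "\<dots> \<le> 2 ^ M * (1 + ?y ^ M)" by (auto simp: power_mult_distrib max_def)
    finally have "(1 + ?y) ^ M * norm (ift (g s) x) \<le> 2 ^ M * (1 + ?y ^ M) * norm (ift (g s) x)"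
      by (rule mult_right_mono) simp
    also have "\<dots> = 2 ^ M * (norm (ift (g s) x) + ?y ^ M * norm (ift (g s) x))" by (simp add: algebra_simps)
    also have "\<dots> \<le> 2 ^ M * (d0 * V * e s + dM * V * e s)" using b0 bM by (intro mult_left_mono add_mono) auto
    finally have b: "(1 + ?y) ^ M * norm (ift (g s) x) \<le> (2 ^ M * (d0 + dM) * V) * e s" by (simp add: algebra_simps)
    have w: "wgt (real M) ((1 / 2 ^ s) *\<^sub>R x) = (1 + ?y) ^ M"
      by (simp add: wgt_def powr_realpow add_pos_nonneg)
    have "norm (ift (g s) x) = wgt (- real M) ((1 / 2 ^ s) *\<^sub>R x) * (wgt (real M) ((1 / 2 ^ s) *\<^sub>R x) * norm (ift (g s) x))"
      by (simp add: wgt_mult mult.assoc[symmetric])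
    also have "\<dots> \<le> wgt (- real M) ((1 / 2 ^ s) *\<^sub>R x) * ((2 ^ M * (d0 + dM) * V) * e s)"
      unfolding w by (intro mult_left_mono b) auto
    also have "\<dots> \<le> wgt (- lam) ((1 / 2 ^ s) *\<^sub>R x) * ((2 ^ M * (d0 + dM) * V) * e s)"
      using lam(2) d V0 e0[of s] by (intro mult_right_mono wgt_mono) auto
    finally show ?thesis by (simp add: mult_ac)
  qed
  show ?thesis
    by (rule exI[of _ "2 ^ M * (d0 + dM) * V"]) (use main[unfolded g_def[abs_def] e_def] d V0 in auto)
qed


subsection \<open>The reproducing formula\<close>

lemma ift_add:
  assumes "integrable lborel g" "integrable lborel h"
  shows "ift (\<lambda>\<xi>. g \<xi> + h \<xi>) x = ift g x + ift h x"
proof -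
  have i: "integrable lborel (\<lambda>\<xi>. exp (\<i> * complex_of_real (x \<bullet> \<xi>)) * g \<xi>)" if g: "integrable lborel g" for g
  proof (rule integrable_dominated[OF integrable_norm[OF g]])
    have [measurable]: "g \<in> borel_measurable borel" using borel_measurable_integrable[OF g] by simp
    show "(\<lambda>\<xi>. exp (\<i> * complex_of_real (x \<bullet> \<xi>)) * g \<xi>) \<in> borel_measurable lborel" by measurable
  qed (auto simp: norm_mult)
  show ?thesis unfolding ift_def distrib_left by (rule Bochner_Integration.integral_add[OF i[OF assms(1)] i[OF assms(2)]])
qed

lemma ift_zero: "ift (\<lambda>\<xi>. 0) x = 0"
  by (simp add: ift_def)

lemma ift_sum:
  "(\<And>k. k \<in> A \<Longrightarrow> integrable lborel (g k)) \<Longrightarrow> ift (\<lambda>\<xi>. \<Sum>k\<in>A. g k \<xi>) x = (\<Sum>k\<in>A. ift (g k) x)"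
  by (induction A rule: infinite_finite_induct) (auto simp: ift_zero ift_add)

lemma wint_dilate:
  fixes \<psi> :: "real ^ 'n \<Rightarrow> complex"
  assumes l: "0 \<le> l" and w: "wint l \<psi>"
  shows "wint l (dilate a \<psi>)"
proof -
  note [measurable] = wint_measurable[OF w]
  let ?c = "2 powi a :: real"
  have c: "0 < ?c" by simp
  have m: "dilate a \<psi> \<in> borel_measurable borel" unfolding dilate_def by measurable
  \<comment> \<open>Ensures 1 + |x| \<le> B (1 + c |x|) whether c is large or small, so the weight
    at x is comparable to the weight at c x.\<close>
  let ?B = "max 1 (1 / ?c)"
  have "integrable lborel (\<lambda>x. wgt l x * norm (dilate a \<psi> x))"
  proof (rule integrable_dominated)
    have "integrable lborel (\<lambda>x. (\<lambda>x. wgt l x * norm (\<psi> x)) (0 + ?c *\<^sub>R x))"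
      by (rule integrable_lborel_affine) (use w c in \<open>auto simp: wint_def\<close>)
    then show "integrable lborel (\<lambda>x. (?B powr l * 2 powi (a * int CARD('n))) * (wgt l (?c *\<^sub>R x) * norm (\<psi> (?c *\<^sub>R x))))"
      by simp
    show "norm (wgt l x * norm (dilate a \<psi> x)) \<le>
       (?B powr l * 2 powi (a * int CARD('n))) * (wgt l (?c *\<^sub>R x) * norm (\<psi> (?c *\<^sub>R x)))" for x
    proof -
      have "norm x \<le> ?B * (?c * norm x)"
        using c mult_right_mono[of "1 / ?c" ?B "?c * norm x"] by simp
      then have "1 + norm x \<le> ?B * (1 + ?c * norm x)" by (simp add: distrib_left)
      then have "wgt l x \<le> (?B * (1 + ?c * norm x)) powr l" unfolding wgt_def using l by (intro powr_mono2) auto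
      also have "\<dots> = ?B powr l * wgt l (?c *\<^sub>R x)"
        using c by (subst powr_mult) (auto simp: wgt_def)
      finally have "wgt l x * norm (dilate a \<psi> x) \<le> ?B powr l * wgt l (?c *\<^sub>R x) * norm (dilate a \<psi> x)"
        by (intro mult_right_mono) auto
      then show ?thesis using c by (simp add: dilate_def abs_mult mult_ac)
    qed
  qed (use m in measurable)
  then show ?thesis using m by (simp add: wint_def)
qed

lemma fourier_dilate:
  fixes \<psi> :: "real ^ 'n \<Rightarrow> complex"
  shows "fourier (dilate a \<psi>) \<xi> = fourier \<psi> ((2 powi (- a)) *\<^sub>R \<xi>)"
proof -
  let ?c = "2 powi a :: real"
  have c: "0 < ?c" by simp
  have e: "(?c *\<^sub>R x) \<bullet> ((2 powi (- a)) *\<^sub>R \<xi>) = x \<bullet> \<xi>" for x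
    using c by (simp add: power_int_minus)
  have "fourier \<psi> ((2 powi (- a)) *\<^sub>R \<xi>) =
    (?c ^ CARD('n)) *\<^sub>R (\<integral>x. exp (- \<i> * complex_of_real ((?c *\<^sub>R x) \<bullet> ((2 powi (- a)) *\<^sub>R \<xi>))) * \<psi> (?c *\<^sub>R x) \<partial>lborel)"
    unfolding fourier_def by (subst integral_lborel_affine[where c="?c" and t=0]) (use c in simp_all)
  also have "\<dots> = fourier (dilate a \<psi>) \<xi>"
    unfolding fourier_def dilate_def integral_scaleR_right[symmetric] e
    by (intro Bochner_Integration.integral_cong refl) (simp add: power_int_mult)
  finally show ?thesis ..
qed

text \<open>The right-hand side is taken in [0, \<infinity>], since \<open>lam\<close> may be too
  small for the growth of G. The reflection z = -y produces the form G (w - y) used in the maximal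
  functions.\<close>

lemma corr_ennreal_bound:
  fixes h G :: "real ^ 'n \<Rightarrow> complex"
  assumes l: "0 \<le> l" and h: "wint l h" and G: "poly_bounded l G" and B: "0 \<le> B"
    and b: "\<And>z. norm (h z) \<le> B * wgt (- lam) (c *\<^sub>R z)"
  shows "ennreal (norm (corr h G w)) \<le> ennreal B * (\<integral>\<^sup>+ y. ennreal (norm (G (w - y))) * ennreal (wgt (- lam) (c *\<^sub>R y)) \<partial>lborel)"
proof -
  note [measurable] = wint_measurable[OF h] poly_bounded_measurable[OF G]
  have "ennreal (norm (corr h G w)) \<le> (\<integral>\<^sup>+ z. ennreal (norm (h z * G (w + z))) \<partial>lborel)"
    unfolding corr_def by (rule integral_norm_bound_ennreal[OF corr_integrable[OF l h G]])
  also have "\<dots> \<le> (\<integral>\<^sup>+ z. ennreal B * (ennreal (norm (G (w + z))) * ennreal (wgt (- lam) (c *\<^sub>R z))) \<partial>lborel)"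
  proof (rule nn_integral_mono)
    fix z
    have "norm (h z * G (w + z)) \<le> B * wgt (- lam) (c *\<^sub>R z) * norm (G (w + z))"
      unfolding norm_mult by (rule mult_right_mono[OF b]) simp
    then show "ennreal (norm (h z * G (w + z))) \<le> ennreal B * (ennreal (norm (G (w + z))) * ennreal (wgt (- lam) (c *\<^sub>R z)))"
      using B by (simp add: ennreal_mult[symmetric] mult_ac)
  qed
  also have "\<dots> = ennreal B * (\<integral>\<^sup>+ z. ennreal (norm (G (w + z))) * ennreal (wgt (- lam) (c *\<^sub>R z)) \<partial>lborel)"
    by (rule nn_integral_cmult) measurable
  also have "(\<integral>\<^sup>+ z. ennreal (norm (G (w + z))) * ennreal (wgt (- lam) (c *\<^sub>R z)) \<partial>lborel) =
      (\<integral>\<^sup>+ y. ennreal (norm (G (w - y))) * ennreal (wgt (- lam) (c *\<^sub>R y)) \<partial>lborel)"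
    using nn_integral_lborel_reflect[of "\<lambda>z. ennreal (norm (G (w + z))) * ennreal (wgt (- lam) (c *\<^sub>R z))" 0] by simp
  finally show ?thesis .
qed

section \<open>The pointwise estimate by finer scales\<close>

definition decay_integral :: "real \<Rightarrow> (int \<Rightarrow> real ^ 'n \<Rightarrow> ennreal) \<Rightarrow> int \<Rightarrow> real ^ 'n \<Rightarrow> int \<Rightarrow> ennreal" where
  "decay_integral p G j x k = (\<integral>\<^sup>+ y. G k (x - y) * ennreal (wgt (- p) ((2 powi j) *\<^sub>R y)) \<partial>lborel)"

text \<open>All terms carry the weight of the single scale j, whereas \<open>mean_sum\<close>
  weights each term at its own scale k. A common scale makes the sum stable under translation, as
  \<open>decay_sum_shift\<close> shows.\<close>

definition decay_sum :: "real \<Rightarrow> real \<Rightarrow> (int \<Rightarrow> real ^ 'n \<Rightarrow> ennreal) \<Rightarrow> int \<Rightarrow> real ^ 'n \<Rightarrow> ennreal" where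
  "decay_sum p q G j x = (\<Sum>i. ennreal (2 powr (- real i * q) * 2 powi ((j + int i) * int CARD('n))) *
     decay_integral p G j x (j + int i))"

text \<open>Each 2^(L n) pays for normalising a kernel at a scale shifted by at most L. The first
  summand belongs to the low frequencies; the second to the 2 L + 1 exchanged terms of each shell,
  where the exponent of 2^(-s \<beta>) is shifted by at most L as well.\<close>

definition repro_const :: "'n::finite itself \<Rightarrow> nat \<Rightarrow> real \<Rightarrow> real" where
  "repro_const _ L \<beta> = 2 ^ (L * CARD('n)) + (2 * real L + 1) * (2 ^ (L * CARD('n)) * 2 powr (real L * \<bar>\<beta>\<bar>))"

lemma sum_shift_le_suminf:
  fixes f :: "nat \<Rightarrow> ennreal"
  shows "(\<Sum>q<m. f (c + q)) \<le> (\<Sum>i. f i)"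
proof -
  have "(\<Sum>q<m. f (c + q)) = sum f ((\<lambda>q. c + q) ` {..<m})" by (subst sum.reindex) auto
  also have "\<dots> \<le> (\<Sum>i. f i)" by (rule sum_le_suminf) auto
  finally show ?thesis .
qed

lemma cutoff_telescope:
  "cutoff ((2 powi (- (i0 + int m))) *\<^sub>R \<xi>) = cutoff ((2 powi (- i0)) *\<^sub>R \<xi>) + (\<Sum>q<m. shell ((2 powi (- (i0 + 1 + int q))) *\<^sub>R \<xi>))"
proof (induction m)
  case (Suc m)
  have "(2::real) * 2 powi (- (i0 + 1 + int m)) = 2 powi (- (i0 + int m))"
    using power_int_add_1[of "2::real" "- (i0 + 1 + int m)"] by (simp add: mult.commute)
  then have "shell ((2 powi (- (i0 + 1 + int m))) *\<^sub>R \<xi>) = cutoff ((2 powi (- (i0 + int (Suc m)))) *\<^sub>R \<xi>) - cutoff ((2 powi (- (i0 + int m))) *\<^sub>R \<xi>)"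
    by (simp add: shell_def add.assoc add.commute[of 1])
  then show ?case using Suc by simp
qed simp

lemma reproducing_estimate:
  fixes \<psi> :: "real ^ 'n \<Rightarrow> complex" and F :: "int \<Rightarrow> real ^ 'n \<Rightarrow> complex"
  assumes l: "0 \<le> l" and w: "wint l \<psi>"
    and pN: "Ck N (- {0}) (fourier \<psi>)" and N: "real CARD('n) + l < real N"
    and cov: "covers (fourier \<psi>) L"
    and f: "has_growth f l" and F: "\<And>j. is_loc_int_function (dist_conv (dilate j \<psi>) f) (F j)"
    and pb: "\<And>j. poly_bounded l (F j)"
    and lam: "0 \<le> lam" and C: "0 \<le> C" and Cb: "\<And>x. norm (ift cutoff (x :: real ^ 'n)) \<le> C * wgt (- lam) x"
    and Ck: "\<And>k s x. k \<in> {- int L..int L} \<Longrightarrow>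
      norm (ift (\<lambda>\<xi>. fourier \<psi> ((2 ^ s) *\<^sub>R \<xi>) * freq_part (fourier \<psi>) L k \<xi>) x) \<le>
      C * 2 powr (- real s * \<beta>) * wgt (- lam) ((1 / 2 ^ s) *\<^sub>R x)"
  shows "AE x in lborel. ennreal (norm (F j x)) \<le>
    ennreal (C * repro_const TYPE('n) L \<beta>) * decay_sum lam \<beta> (\<lambda>k x. ennreal (norm (F k x))) j x"
proof -
  let ?p = "fourier \<psi>" and ?R = "outer_radius TYPE('n)"
  define n where "n = CARD('n)"
  define t where "t i = (2::real) powi i" for i :: int
  have t0: "0 < t i" for i by (simp add: t_def)
  have tadd: "t i * t k = t (i + k)" for i k by (simp add: t_def power_int_add)
  have tinv: "1 / t i = t (- i)" for i by (simp add: t_def power_int_minus field_simps)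
  have tn: "t i ^ n = 2 powi (i * int n)" for i by (simp add: t_def power_int_mult)
  define \<Phi> where "\<Phi> i = ift (\<lambda>\<xi>. cutoff (t (- i) *\<^sub>R (\<xi> :: real ^ 'n)))" for i
  define u where "u k i = (\<lambda>\<xi>. freq_part ?p L k (t (- i) *\<^sub>R \<xi>))" for k i
  \<comment> \<open>The symbol of the kernel of u k i composed with \<psi> at scale a.\<close>
  define v where "v a k i = (\<lambda>\<xi>. ?p (t (- a) *\<^sub>R \<xi>) * freq_part ?p L k (t (- i) *\<^sub>R \<xi>))" for a k i
  have large: "?R < norm (t (- i) *\<^sub>R \<xi>)" if "?R * t i < norm \<xi>" for i and \<xi> :: "real ^ 'n"
    using that t0[of i] tinv[of i, symmetric] t0[of "- i"] by (simp add: abs_of_pos pos_less_divide_eq)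
  have CkPhi: "Ck N UNIV (\<lambda>\<xi> :: real ^ 'n. cutoff (t (- i) *\<^sub>R \<xi>))" for i
    by (rule Ck_scaled[of _ _ UNIV, OF _ _ Ck_cutoff]) auto
  have sPhi: "cutoff (t (- i) *\<^sub>R \<xi>) = 0" if "?R * t i < norm \<xi>" for i and \<xi> :: "real ^ 'n"
    using large[OF that] cutoff_eq_0[of "t (- i) *\<^sub>R \<xi>"] by (simp add: outer_radius_def)
  have Cku: "Ck N UNIV (u k i)" for k i
    unfolding u_def by (rule Ck_scaled[of _ _ UNIV, OF _ _ Ck_freq_part_mult(2)[OF pN cov, of 1]]) auto
  have su: "u k i \<xi> = 0" if "?R * t i < norm \<xi>" for k i and \<xi> :: "real ^ 'n"
    unfolding u_def using large[OF that] by (intro freq_part_support) auto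
  have Ckv: "Ck N UNIV (v a k i)" for a k i
  proof -
    have "Ck N UNIV (\<lambda>\<xi>. ?p (t (i - a) *\<^sub>R (t (- i) *\<^sub>R \<xi>)) * freq_part ?p L k (t (- i) *\<^sub>R \<xi>))"
      by (rule Ck_scaled[of _ _ UNIV, OF _ _ Ck_freq_part_mult(1)[OF pN cov, of "t (i - a)"]]) (use t0[of "i - a"] in auto)
    then show ?thesis by (simp add: v_def tadd)
  qed
  have sv: "v a k i \<xi> = 0" if "?R * t i < norm \<xi>" for a k i and \<xi> :: "real ^ 'n"
    unfolding v_def using large[OF that] by (simp add: freq_part_support)
  have wPhi: "wint l (\<Phi> i)" for i unfolding \<Phi>_def by (rule wint_ift[OF CkPhi sPhi N])
  have wu: "wint l (ift (u k i))" for k i by (rule wint_ift[OF Cku su N])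
  have wv: "wint l (ift (v a k i))" for a k i by (rule wint_ift[OF Ckv sv N])
  have ui: "integrable lborel (u k i)" for k i by (rule integrable_compact_support[OF Ck_continuous[OF Cku] su])
  have vi: "integrable lborel (v a k i)" for a k i by (rule integrable_compact_support[OF Ck_continuous[OF Ckv] sv])
  have Phii: "integrable lborel (\<lambda>\<xi> :: real ^ 'n. cutoff (t (- i) *\<^sub>R \<xi>))" for i
    by (rule integrable_compact_support[OF Ck_continuous[OF CkPhi] sPhi])
  note wd = wint_dilate[OF l w]

  have conv: "corr (dilate a \<psi>) (corr (ift (u k i)) G) x = corr (ift (v a k i)) G x"
    if G: "poly_bounded l G" for a k i G x
  proof -
    have "(\<lambda>\<xi>. fourier (dilate a \<psi>) \<xi> * u k i \<xi>) = v a k i"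
      by (simp add: fun_eq_iff fourier_dilate u_def v_def t_def)
    then have "(\<integral>y. dilate a \<psi> y * ift (u k i) (x - y) \<partial>lborel) = ift (v a k i) x" for x
      using ift_convolution[OF ui wint_integrable[OF l wd[of a]], of k i x] by simp
    then show ?thesis by (subst corr_corr[OF l wu wd G]) simp
  qed
  \<comment> \<open>The factor \<psi>_a is split off the kernel and applied to F j, exchanged for
    \<psi>_j applied to F a, and \<psi>_j is merged into the kernel.\<close>
  have swap: "corr (ift (v a k i)) (F j) x = corr (ift (v j k i)) (F a) x" for a k i j x
  proof -
    have "corr (ift (v a k i)) (F j) x = corr (ift (u k i)) (corr (dilate a \<psi>) (F j)) x"
      unfolding conv[OF pb, symmetric] by (rule corr_commute[OF l wd wu pb])
    also have "\<dots> = corr (ift (u k i)) (corr (dilate j \<psi>) (F a)) x"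
      by (rule corr_cong_AE[OF corr_dist_conv_commute[OF f l wd wd F F pb pb]])
        (use poly_bounded_corr[OF l wd pb] wu in \<open>auto dest: poly_bounded_measurable wint_measurable\<close>)
    also have "\<dots> = corr (ift (v j k i)) (F a) x"
      unfolding conv[OF pb, symmetric] by (rule corr_commute[OF l wu wd pb])
    finally show ?thesis .
  qed

  let ?K = "{- int L..int L}"
  \<comment> \<open>With this start the scales i q - k with |k| \<le> L satisfy i q - k \<ge> j + 1
    + q, so the exchange brings in only scales finer than j.\<close>
  define i0 where "i0 = j + int L"
  define i where "i q = i0 + 1 + int q" for q
  \<comment> \<open>In the k-th part of the shell at scale i q, the dilated transform is that of
    \<psi> at scale i q - k.\<close>
  have symb: "cutoff (t (- (i0 + int m)) *\<^sub>R \<xi>) = cutoff (t (- i0) *\<^sub>R \<xi>) + (\<Sum>q<m. \<Sum>k\<in>?K. v (i q - k) k (i q) \<xi>)" for m \<xi>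
  proof -
    have "shell (t (- i q) *\<^sub>R \<xi>) = (\<Sum>k\<in>?K. v (i q - k) k (i q) \<xi>)" for q
    proof -
      have "v (i q - k) k (i q) \<xi> = ?p ((2 powi k) *\<^sub>R (t (- i q) *\<^sub>R \<xi>)) * freq_part ?p L k (t (- i q) *\<^sub>R \<xi>)" for k
        using tadd[of k "- i q"] by (simp add: v_def t_def)
      then show ?thesis using sum_freq_part[OF cov, of "t (- i q) *\<^sub>R \<xi>"] by simp
    qed
    then show ?thesis using cutoff_telescope[of i0 m \<xi>] by (simp add: t_def i_def)
  qed
  have expand: "corr (\<Phi> (i0 + int m)) (F j) x = corr (\<Phi> i0) (F j) x + (\<Sum>q<m. \<Sum>k\<in>?K. corr (ift (v j k (i q))) (F (i q - k)) x)" for m x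
  proof -
    have "\<Phi> (i0 + int m) z = \<Phi> i0 z + (\<Sum>q<m. \<Sum>k\<in>?K. ift (v (i q - k) k (i q)) z)" for z
      unfolding \<Phi>_def symb by (subst ift_add, simp_all add: Phii vi ift_sum)
    then have "corr (\<Phi> (i0 + int m)) (F j) x = corr (\<lambda>z. \<Phi> i0 z + (\<Sum>q<m. \<Sum>k\<in>?K. ift (v (i q - k) k (i q)) z)) (F j) x"
      by (simp add: corr_def)
    also have "\<dots> = corr (\<Phi> i0) (F j) x + (\<Sum>q<m. \<Sum>k\<in>?K. corr (ift (v (i q - k) k (i q))) (F j) x)"
      by (subst corr_add[OF l _ _ pb]) (simp_all add: wPhi wv wint_sum corr_sum[OF l pb])
    finally show ?thesis unfolding swap[of _ _ _ j] .
  qed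

  let ?G = "\<lambda>k x. ennreal (norm (F k x))"
  define J where "J x = decay_integral lam ?G j x" for x
  define tm where "tm x m = ennreal (2 powr (- real m * \<beta>) * 2 powi ((j + int m) * int n)) * J x (j + int m)" for x and m :: nat
  have S: "decay_sum lam \<beta> ?G j x = (\<Sum>m. tm x m)" for x by (simp add: decay_sum_def tm_def J_def n_def)
  define K1 where "K1 = 2 ^ (L * n) * 2 powr (real L * \<bar>\<beta>\<bar>)"
  have K10: "0 \<le> K1" by (simp add: K1_def)

  \<comment> \<open>The weight decreases in |x|, so it may be relaxed from scale j + L to scale j;
    the normalisation of the kernel leaves 2^(L n).\<close>
  have low: "ennreal (norm (corr (\<Phi> i0) (F j) x)) \<le> ennreal (C * 2 ^ (L * n)) * tm x 0" for x
  proof -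
    have "norm (\<Phi> i0 z) \<le> (t i0 ^ n * C) * wgt (- lam) (t j *\<^sub>R z)" for z
    proof -
      have "\<Phi> i0 z = (t i0 ^ n) *\<^sub>R ift cutoff (t i0 *\<^sub>R z)"
        unfolding \<Phi>_def tinv[symmetric] n_def by (rule ift_scaled[OF t0])
      then have "norm (\<Phi> i0 z) \<le> t i0 ^ n * (C * wgt (- lam) (t i0 *\<^sub>R z))"
        using t0[of i0] Cb[of "t i0 *\<^sub>R z"] by (simp add: mult_left_mono)
      also have "\<dots> \<le> t i0 ^ n * (C * wgt (- lam) (t j *\<^sub>R z))"
      proof -
        have "t j \<le> t i0" unfolding t_def i0_def by (rule power_int_increasing) auto
        then have "norm (t j *\<^sub>R z) \<le> norm (t i0 *\<^sub>R z)" using t0[of j] t0[of i0] by (simp add: mult_right_mono)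
        then show ?thesis using t0[of i0] C lam by (intro mult_left_mono wgt_norm_anti) auto
      qed
      finally show ?thesis by (simp add: mult_ac)
    qed
    from corr_ennreal_bound[OF l wPhi[of i0] pb[of j] _ this, where w=x]
    have "ennreal (norm (corr (\<Phi> i0) (F j) x)) \<le> ennreal (t i0 ^ n * C) * J x j"
      using C t0[of i0] by (simp add: J_def decay_integral_def t_def)
    also have "t i0 ^ n * C = (C * 2 ^ (L * n)) * 2 powi (j * int n)"
      unfolding i0_def tadd[symmetric] power_mult_distrib tn[of j] by (simp add: t_def power_mult)
    finally show ?thesis using C by (simp add: tm_def ennreal_mult mult_ac)
  qed

  have high: "ennreal (norm (corr (ift (v j k (i q))) (F (i q - k)) x)) \<le> ennreal (C * K1) * tm x (nat (int L + 1 - k) + q)"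
    if k: "k \<in> ?K" for k q x
  proof -
    \<comment> \<open>s is the distance of the kernel's scale i q from j, and m that of the scale i
      q - k of F. They differ by k, so powers of 2 in s and in m agree up to bounded
      factors.\<close>
    define s where "s = L + 1 + q"
    define m where "m = nat (int L + 1 - k) + q"
    have im: "i q - k = j + int m" and mi: "int s = int m + k" and iqs: "i q = j + int s"
      using k by (auto simp: m_def s_def i_def i0_def)
    have "norm (ift (v j k (i q)) z) \<le> (t (i q) ^ n * (C * 2 powr (- real s * \<beta>))) * wgt (- lam) (t j *\<^sub>R z)" for z
    proof -
      let ?g = "\<lambda>\<xi>. ?p ((2 ^ s) *\<^sub>R \<xi>) * freq_part ?p L k \<xi>"
      have ts: "2 ^ s * t (- i q) = t (- j)" using tadd[of "int s" "- i q"] by (simp add: t_def iqs)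
      have "v j k (i q) = (\<lambda>\<xi>. ?g ((1 / t (i q)) *\<^sub>R \<xi>))"
        by (simp add: v_def tinv ts fun_eq_iff)
      then have "ift (v j k (i q)) z = (t (i q) ^ n) *\<^sub>R ift ?g (t (i q) *\<^sub>R z)"
        unfolding n_def by (simp only: ift_scaled[OF t0, where g="?g" and x=z])
      then have "norm (ift (v j k (i q)) z) \<le> t (i q) ^ n * (C * 2 powr (- real s * \<beta>) * wgt (- lam) ((1 / 2 ^ s) *\<^sub>R (t (i q) *\<^sub>R z)))"
        using t0[of "i q"] Ck[OF k, of s "t (i q) *\<^sub>R z"] by (simp add: mult_left_mono)
      moreover have "(1 / 2 ^ s) * t (i q) = t j" unfolding iqs tadd[symmetric] by (simp add: t_def)
      ultimately show ?thesis by (simp add: mult_ac)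
    qed
    from corr_ennreal_bound[OF l wv[of j k "i q"] pb[of "i q - k"] _ this, where w=x]
    have "ennreal (norm (corr (ift (v j k (i q))) (F (i q - k)) x)) \<le> ennreal (t (i q) ^ n * (C * 2 powr (- real s * \<beta>))) * J x (i q - k)"
      using C t0[of "i q"] by (simp add: J_def decay_integral_def t_def)
    also have "ennreal (t (i q) ^ n * (C * 2 powr (- real s * \<beta>))) \<le> ennreal (C * K1 * (2 powr (- real m * \<beta>) * 2 powi ((j + int m) * int n)))"
    proof (rule ennreal_leI)
      have "t k \<le> 2 ^ L"
      proof -
        have "t k \<le> t (int L)" unfolding t_def by (rule power_int_increasing) (use k in auto)
        then show ?thesis by (simp add: t_def)
      qed
      then have "t k ^ n \<le> 2 ^ (L * n)" using t0[of k] by (simp add: power_mono power_mult)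
      moreover have "i q = (j + int m) + k" using im by simp
      then have "t (i q) = t (j + int m) * t k" by (simp only: tadd)
      then have "t (i q) ^ n = 2 powi ((j + int m) * int n) * t k ^ n"
        by (simp only: power_mult_distrib tn[of "j + int m"])
      ultimately have a: "t (i q) ^ n \<le> 2 powi ((j + int m) * int n) * 2 ^ (L * n)" by (simp add: mult_left_mono)
      have sm: "real s = real m + real_of_int k" using mi by linarith
      have "- real_of_int k * \<beta> \<le> \<bar>real_of_int k\<bar> * \<bar>\<beta>\<bar>" by (metis abs_ge_self abs_minus_cancel abs_mult)
      also have "\<dots> \<le> real L * \<bar>\<beta>\<bar>" using k by (intro mult_right_mono) auto
      finally have "2 powr (- real_of_int k * \<beta>) \<le> 2 powr (real L * \<bar>\<beta>\<bar>)" by (intro powr_mono) auto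
      moreover have "2 powr (- real s * \<beta>) = 2 powr (- real m * \<beta>) * 2 powr (- real_of_int k * \<beta>)"
        unfolding sm powr_add[symmetric] by (simp add: algebra_simps)
      ultimately have b: "2 powr (- real s * \<beta>) \<le> 2 powr (- real m * \<beta>) * 2 powr (real L * \<bar>\<beta>\<bar>)"
        by (simp add: mult_left_mono)
      have "t (i q) ^ n * (C * 2 powr (- real s * \<beta>)) \<le> (2 powi ((j + int m) * int n) * 2 ^ (L * n)) * (C * (2 powr (- real m * \<beta>) * 2 powr (real L * \<bar>\<beta>\<bar>)))"
        using a b C by (intro mult_mono mult_left_mono) auto
      then show "t (i q) ^ n * (C * 2 powr (- real s * \<beta>)) \<le> C * K1 * (2 powr (- real m * \<beta>) * 2 powi ((j + int m) * int n))"
        by (simp add: K1_def mult_ac)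
    qed
    finally show ?thesis
      using C K10 unfolding im m_def[symmetric] by (simp add: tm_def ennreal_mult mult_ac mult_right_mono)
  qed

  have bound: "ennreal (norm (corr (\<Phi> (i0 + int m)) (F j) x)) \<le> ennreal (C * repro_const TYPE('n) L \<beta>) * (\<Sum>m. tm x m)" for m x
  proof -
    let ?S = "\<Sum>m. tm x m"
    have "norm (corr (\<Phi> (i0 + int m)) (F j) x) \<le> norm (corr (\<Phi> i0) (F j) x) + (\<Sum>q<m. \<Sum>k\<in>?K. norm (corr (ift (v j k (i q))) (F (i q - k)) x))"
      unfolding expand by (intro order_trans[OF norm_triangle_ineq] add_left_mono sum_norm_le order_refl)
    then have "ennreal (norm (corr (\<Phi> (i0 + int m)) (F j) x)) \<le>
       ennreal (norm (corr (\<Phi> i0) (F j) x)) + (\<Sum>q<m. \<Sum>k\<in>?K. ennreal (norm (corr (ift (v j k (i q))) (F (i q - k)) x)))"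
      by (simp add: ennreal_leI sum_ennreal sum_nonneg flip: ennreal_plus)
    also have "(\<Sum>q<m. \<Sum>k\<in>?K. ennreal (norm (corr (ift (v j k (i q))) (F (i q - k)) x))) =
      (\<Sum>k\<in>?K. \<Sum>q<m. ennreal (norm (corr (ift (v j k (i q))) (F (i q - k)) x)))" by (rule sum.swap)
    also have "\<dots> \<le> (\<Sum>k\<in>?K. \<Sum>q<m. ennreal (C * K1) * tm x (nat (int L + 1 - k) + q))"
      by (intro sum_mono high)
    also have "\<dots> = (\<Sum>k\<in>?K. ennreal (C * K1) * (\<Sum>q<m. tm x (nat (int L + 1 - k) + q)))"
      by (simp add: sum_distrib_left)
    also have "\<dots> \<le> (\<Sum>k\<in>?K. ennreal (C * K1) * ?S)"
      by (intro sum_mono mult_left_mono sum_shift_le_suminf) auto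
    also have "\<dots> = ennreal ((2 * real L + 1) * (C * K1)) * ?S"
      using C K10 by (simp add: ennreal_mult mult.assoc ennreal_of_nat_eq_real_of_nat)
    also have "ennreal (norm (corr (\<Phi> i0) (F j) x)) \<le> ennreal (C * 2 ^ (L * n)) * ?S"
      using sum_shift_le_suminf[of "tm x" 0 1] by (intro order_trans[OF low] mult_left_mono) auto
    finally have "ennreal (norm (corr (\<Phi> (i0 + int m)) (F j) x)) \<le>
       ennreal (C * 2 ^ (L * n)) * ?S + ennreal ((2 * real L + 1) * (C * K1)) * ?S"
      by (simp add: add_right_mono add_left_mono)
    also have "\<dots> = ennreal (C * 2 ^ (L * n) + (2 * real L + 1) * (C * K1)) * ?S"
      using C K10 by (simp add: ennreal_plus distrib_right)
    also have "C * 2 ^ (L * n) + (2 * real L + 1) * (C * K1) = C * repro_const TYPE('n) L \<beta>"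
      by (simp add: repro_const_def K1_def n_def algebra_simps)
    finally show ?thesis .
  qed

  \<comment> \<open>The offset makes s at least 1, as \<open>approximate_identity\<close> demands,
    and the exponent at least i0, so that these kernels are among the telescoped ones.\<close>
  define s where "s q = (2::real) ^ (q + nat \<bar>i0\<bar>)" for q
  have s: "filterlim s at_top sequentially"
  proof (rule filterlim_at_top_mono[OF filterlim_real_sequentially], intro always_eventually allI)
    fix q
    have "real q \<le> 2 ^ q" by (rule less_imp_le[OF of_nat_less_two_power])
    also have "\<dots> \<le> s q" unfolding s_def by (intro power_increasing) auto
    finally show "real q \<le> s q" .
  qed
  have Phi0: "wint l (ift (cutoff :: real ^ 'n \<Rightarrow> complex))" using wPhi[of 0] by (simp add: \<Phi>_def t_def)
  obtain r where r: "strict_mono r"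
    "AE x in lborel. (\<lambda>k. corr (\<lambda>x. (s (r k) ^ CARD('n)) *\<^sub>R ift cutoff (s (r k) *\<^sub>R x)) (F j) x) \<longlonglongrightarrow> (\<integral>x. ift cutoff (x :: real ^ 'n) \<partial>lborel) * F j x"
    using approximate_identity[OF l pb Phi0 s, of j] by (auto simp: s_def)
  have c: "(\<integral>x. ift cutoff (x :: real ^ 'n) \<partial>lborel) = complex_of_real (2 * pi) ^ n"
    unfolding n_def
    by (subst integral_ift[where R="?R", OF Ck_continuous[OF Ck_cutoff[OF open_UNIV, of 0]] _ wint_integrable[OF l Phi0]])
      (auto simp: cutoff_eq_0 outer_radius_def cutoff_eq_1)
  \<comment> \<open>The normalising factor omitted from \<open>ift\<close> reappears here; being at
    least 1 in modulus it may be dropped on the left.\<close>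
  have c1: "1 \<le> norm (complex_of_real (2 * pi) ^ n)"
    using pi_gt3 unfolding norm_power by (intro one_le_power) simp
  have Phis: "(\<lambda>x. (s q ^ CARD('n)) *\<^sub>R ift cutoff (s q *\<^sub>R x)) = \<Phi> (i0 + int (nat (int q + \<bar>i0\<bar> - i0)))" for q
  proof -
    have e: "i0 + int (nat (int q + \<bar>i0\<bar> - i0)) = int (q + nat \<bar>i0\<bar>)" by simp
    have st: "s q = t (int (q + nat \<bar>i0\<bar>))" by (simp only: t_def s_def power_int_of_nat)
    show ?thesis
      unfolding e \<Phi>_def st tinv[symmetric] by (rule ext, rule ift_scaled[OF t0, symmetric])
  qed
  from r(2) show ?thesis
  proof eventually_elim
    case (elim x)
    have "(\<lambda>k. ennreal (norm (corr (\<lambda>x. (s (r k) ^ CARD('n)) *\<^sub>R ift cutoff (s (r k) *\<^sub>R x)) (F j) x))) \<longlonglongrightarrow>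
        ennreal (norm (complex_of_real (2 * pi) ^ n * F j x))"
      using elim unfolding c by (intro tendsto_ennrealI tendsto_norm)
    then have "ennreal (norm (complex_of_real (2 * pi) ^ n * F j x)) \<le> ennreal (C * repro_const TYPE('n) L \<beta>) * (\<Sum>m. tm x m)"
      by (rule LIMSEQ_le_const2) (intro exI[of _ 0] allI impI, unfold Phis, rule bound)
    moreover have "norm (F j x) \<le> norm (complex_of_real (2 * pi) ^ n * F j x)"
      unfolding norm_mult using mult_right_mono[OF c1, of "norm (F j x)"] by simp
    ultimately show ?case unfolding S by (meson ennreal_leI order_trans)
  qed
qed


subsection \<open>The self-improving maximal inequality\<close>

lemma decay_sum_anti:
  assumes "p \<le> p'" "q \<le> q'"
  shows "decay_sum p' q' G j x \<le> decay_sum p q G j x"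
  unfolding decay_sum_def decay_integral_def
proof (intro suminf_le summableI mult_mono nn_integral_mono)
  fix i :: nat
  show "ennreal (2 powr (- real i * q') * 2 powi ((j + int i) * int CARD('a))) \<le> ennreal (2 powr (- real i * q) * 2 powi ((j + int i) * int CARD('a)))"
    using assms by (intro ennreal_leI mult_right_mono powr_mono) (auto intro: mult_left_mono)
  show "ennreal (wgt (- p') ((2 powi j) *\<^sub>R y)) \<le> ennreal (wgt (- p) ((2 powi j) *\<^sub>R y))" for y :: "real ^ 'a"
    using assms by (intro ennreal_leI wgt_mono) auto
qed auto

text \<open>For k \<ge> j the weight of w at scale k is at most that at scale j, and by
  submultiplicativity the weights of y and w combine into that of y + w; the factor 2^((j-k) q)
  re-indexes the series. Hence a bound by \<open>decay_sum\<close> at every (k, x - y) passes to the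
  supremum over them.\<close>

lemma decay_sum_shift:
  fixes G :: "int \<Rightarrow> real ^ 'n \<Rightarrow> ennreal"
  assumes [measurable]: "\<And>k. G k \<in> borel_measurable borel" and p: "0 \<le> p" and k: "j \<le> k"
  shows "ennreal (2 powr (real_of_int (j - k) * q) * wgt (- p) ((2 powi j) *\<^sub>R y)) * decay_sum p q G k (x - y) \<le> decay_sum p q G j x"
proof -
  define c where "c = nat (k - j)"
  have kc: "k = j + int c" using k by (simp add: c_def)
  define tm where "tm i = ennreal (2 powr (- real i * q) * 2 powi ((j + int i) * int CARD('n))) * decay_integral p G j x (j + int i)" for i :: nat
  have step: "ennreal (2 powr (real_of_int (j - k) * q) * wgt (- p) ((2 powi j) *\<^sub>R y)) *
     (ennreal (2 powr (- real i * q) * 2 powi ((k + int i) * int CARD('n))) * decay_integral p G k (x - y) (k + int i)) \<le> tm (c + i)" for i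
  proof -
    have e: "k + int i = j + int (c + i)" using kc by simp
    have p1: "2 powr (real_of_int (j - k) * q) * 2 powr (- real i * q) = (2 powr (- real (c + i) * q) :: real)"
      unfolding powr_add[symmetric] kc by (simp add: algebra_simps)
    have "ennreal (wgt (- p) ((2 powi j) *\<^sub>R y)) * decay_integral p G k (x - y) (k + int i) \<le> decay_integral p G j x (k + int i)"
    proof -
      have "ennreal (wgt (- p) ((2 powi j) *\<^sub>R y)) * decay_integral p G k (x - y) (k + int i) =
        (\<integral>\<^sup>+ w. ennreal (wgt (- p) ((2 powi j) *\<^sub>R y)) * (G (k + int i) (x - y - w) * ennreal (wgt (- p) ((2 powi k) *\<^sub>R w))) \<partial>lborel)"
        unfolding decay_integral_def by (rule nn_integral_cmult[symmetric]) measurable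
      also have "\<dots> \<le> (\<integral>\<^sup>+ w. G (k + int i) (x - (y + w)) * ennreal (wgt (- p) ((2 powi j) *\<^sub>R (y + w))) \<partial>lborel)"
      proof (rule nn_integral_mono)
        fix w :: "real ^ 'n"
        have "norm ((2 powi j) *\<^sub>R w) \<le> norm ((2 powi k) *\<^sub>R w)"
          using k by (simp add: mult_right_mono power_int_increasing)
        then have "wgt (- p) ((2 powi k) *\<^sub>R w) \<le> wgt (- p) ((2 powi j) *\<^sub>R w)"
          using p by (intro wgt_norm_anti) auto
        then have "wgt (- p) ((2 powi j) *\<^sub>R y) * wgt (- p) ((2 powi k) *\<^sub>R w) \<le> wgt (- p) ((2 powi j) *\<^sub>R y) * wgt (- p) ((2 powi j) *\<^sub>R w)"
          by (rule mult_left_mono) simp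
        also have "\<dots> \<le> wgt (- p) ((2 powi j) *\<^sub>R (y + w))"
          using wgt_add[OF p, of "(2 powi j) *\<^sub>R y" "(2 powi j) *\<^sub>R w"]
          unfolding wgt_inverse[symmetric] inverse_mult_distrib[symmetric] scaleR_add_right
          by (intro le_imp_inverse_le) auto
        finally have "ennreal (wgt (- p) ((2 powi j) *\<^sub>R y) * wgt (- p) ((2 powi k) *\<^sub>R w)) \<le> ennreal (wgt (- p) ((2 powi j) *\<^sub>R (y + w)))"
          by (rule ennreal_leI)
        then have "G (k + int i) (x - (y + w)) * ennreal (wgt (- p) ((2 powi j) *\<^sub>R y) * wgt (- p) ((2 powi k) *\<^sub>R w)) \<le>
            G (k + int i) (x - (y + w)) * ennreal (wgt (- p) ((2 powi j) *\<^sub>R (y + w)))"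
          by (rule mult_left_mono) simp
        then show "ennreal (wgt (- p) ((2 powi j) *\<^sub>R y)) * (G (k + int i) (x - y - w) * ennreal (wgt (- p) ((2 powi k) *\<^sub>R w))) \<le>
            G (k + int i) (x - (y + w)) * ennreal (wgt (- p) ((2 powi j) *\<^sub>R (y + w)))"
          by (simp add: ennreal_mult diff_diff_eq mult_ac)
      qed
      also have "\<dots> = decay_integral p G j x (k + int i)"
        unfolding decay_integral_def
        using nn_integral_lborel_shift[of "\<lambda>w. G (k + int i) (x - w) * ennreal (wgt (- p) ((2 powi j) *\<^sub>R w))" y] by simp
      finally show ?thesis .
    qed
    then have "ennreal (2 powr (- real (c + i) * q) * 2 powi ((k + int i) * int CARD('n))) *
        (ennreal (wgt (- p) ((2 powi j) *\<^sub>R y)) * decay_integral p G k (x - y) (k + int i)) \<le> tm (c + i)"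
      unfolding tm_def e[symmetric] by (rule mult_left_mono) simp
    then show ?thesis
      unfolding p1[symmetric] by (simp add: ennreal_mult mult_ac)
  qed
  have "ennreal (2 powr (real_of_int (j - k) * q) * wgt (- p) ((2 powi j) *\<^sub>R y)) * decay_sum p q G k (x - y) \<le> (\<Sum>i. tm (c + i))"
    unfolding decay_sum_def ennreal_suminf_cmult[symmetric] by (intro suminf_le summableI step)
  also have "\<dots> \<le> (\<Sum>i. tm i)"
    by (rule suminf_le_const[OF summableI sum_shift_le_suminf])
  finally show ?thesis by (simp add: decay_sum_def tm_def)
qed

text \<open>This is M with exponents (lam, \<beta>) after the substitution of x - y for y, a form
  that also contains the Peetre maximal function as its term k = j.\<close>

definition peetre_sup :: "real \<Rightarrow> real \<Rightarrow> (int \<Rightarrow> real ^ 'n \<Rightarrow> complex) \<Rightarrow> int \<Rightarrow> real ^ 'n \<Rightarrow> ennreal" where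
  "peetre_sup lam \<beta> F j x = (SUP k\<in>{j..}. esssup lborel (\<lambda>y. ennreal
     (2 powr (real_of_int (j - k) * \<beta>) * wgt (- lam) ((2 powi j) *\<^sub>R y) * norm (F k (x - y)))))"

lemma peetre_sup_upper:
  assumes "j \<le> k"
  shows "AE y in lborel. ennreal (2 powr (real_of_int (j - k) * \<beta>) * wgt (- lam) ((2 powi j) *\<^sub>R y) * norm (F k (x - y))) \<le> peetre_sup lam \<beta> F j x"
proof -
  let ?g = "\<lambda>y. ennreal (2 powr (real_of_int (j - k) * \<beta>) * wgt (- lam) ((2 powi j) *\<^sub>R y) * norm (F k (x - y)))"
  have S: "esssup lborel ?g \<le> peetre_sup lam \<beta> F j x"
    unfolding peetre_sup_def by (rule SUP_upper) (use assms in simp)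
  show ?thesis using esssup_AE[where f="?g" and M=lborel] by eventually_elim (rule order_trans[OF _ S])
qed

lemma peetre_sup_least:
  assumes [measurable]: "\<And>k. F k \<in> borel_measurable borel"
    and "\<And>k. j \<le> k \<Longrightarrow> AE y in lborel. ennreal (2 powr (real_of_int (j - k) * \<beta>) * wgt (- lam) ((2 powi j) *\<^sub>R y) * norm (F k (x - y))) \<le> B"
  shows "peetre_sup lam \<beta> F j x \<le> B"
  unfolding peetre_sup_def by (intro SUP_least esssup_I assms(2)) auto

lemma powr_interpolate:
  fixes a \<nu> :: real
  assumes "0 \<le> a" "a \<le> \<nu>" "r \<le> 1"
  shows "a \<le> \<nu> powr (1 - r) * a powr r"
proof (cases "a = 0")
  case False
  have "a = a powr (1 - r) * a powr r" using assms False by (simp add: powr_add[symmetric])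
  also have "\<dots> \<le> \<nu> powr (1 - r) * a powr r" using assms by (intro mult_right_mono powr_mono2) auto
  finally show ?thesis .
qed simp

text \<open>The weighted values a(y) of |F k| are almost everywhere at most \<nu>, hence a \<le>
  \<nu>^(1-r) a^r. The r-th power also falls on the weights, turning lam and \<beta> into lam * r
  and \<beta> * r, but not on the factor 2^(k n).\<close>

lemma decay_sum_interpolate:
  fixes F :: "int \<Rightarrow> real ^ 'n \<Rightarrow> complex"
  assumes [measurable]: "\<And>k. F k \<in> borel_measurable borel"
    and r: "0 < r" "r \<le> 1" and N: "peetre_sup lam \<beta> F j x = ennreal \<nu>" and \<nu>: "0 \<le> \<nu>"
  shows "decay_sum lam \<beta> (\<lambda>k x. ennreal (norm (F k x))) j x \<le>
    ennreal (\<nu> powr (1 - r)) * decay_sum (lam * r) (\<beta> * r) (\<lambda>k x. ennreal (norm (F k x) powr r)) j x"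
  unfolding decay_sum_def ennreal_suminf_cmult[symmetric]
proof (intro suminf_le summableI)
  fix i :: nat
  let ?k = "j + int i"
  define a where "a y = 2 powr (- real i * \<beta>) * wgt (- lam) ((2 powi j) *\<^sub>R y) * norm (F ?k (x - y))" for y
  let ?P = "2 powi (?k * int CARD('n)) :: real"
  have l: "ennreal (2 powr (- real i * \<beta>) * ?P) * decay_integral lam (\<lambda>k x. ennreal (norm (F k x))) j x ?k = ennreal ?P * (\<integral>\<^sup>+ y. ennreal (a y) \<partial>lborel)"
  proof -
    have "ennreal (2 powr (- real i * \<beta>) * ?P) * decay_integral lam (\<lambda>k x. ennreal (norm (F k x))) j x ?k =
      ennreal ?P * (ennreal (2 powr (- real i * \<beta>)) * decay_integral lam (\<lambda>k x. ennreal (norm (F k x))) j x ?k)"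
      by (simp add: ennreal_mult mult_ac)
    also have "ennreal (2 powr (- real i * \<beta>)) * decay_integral lam (\<lambda>k x. ennreal (norm (F k x))) j x ?k = (\<integral>\<^sup>+ y. ennreal (a y) \<partial>lborel)"
      unfolding decay_integral_def
      by (subst nn_integral_cmult[symmetric]) (auto simp: a_def ennreal_mult mult_ac)
    finally show ?thesis .
  qed
  have rr: "ennreal (2 powr (- real i * (\<beta> * r)) * ?P) * decay_integral (lam * r) (\<lambda>k x. ennreal (norm (F k x) powr r)) j x ?k = ennreal ?P * (\<integral>\<^sup>+ y. ennreal (a y powr r) \<partial>lborel)"
  proof -
    have ar: "a y powr r = 2 powr (- real i * (\<beta> * r)) * (norm (F ?k (x - y)) powr r * wgt (- (lam * r)) ((2 powi j) *\<^sub>R y))" for y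
      unfolding a_def by (simp add: powr_mult powr_powr wgt_powr mult_ac)
    have "ennreal (2 powr (- real i * (\<beta> * r)) * ?P) * decay_integral (lam * r) (\<lambda>k x. ennreal (norm (F k x) powr r)) j x ?k =
      ennreal ?P * (ennreal (2 powr (- real i * (\<beta> * r))) * decay_integral (lam * r) (\<lambda>k x. ennreal (norm (F k x) powr r)) j x ?k)"
      by (simp add: ennreal_mult mult_ac)
    also have "ennreal (2 powr (- real i * (\<beta> * r))) * decay_integral (lam * r) (\<lambda>k x. ennreal (norm (F k x) powr r)) j x ?k = (\<integral>\<^sup>+ y. ennreal (a y powr r) \<partial>lborel)"
      unfolding decay_integral_def ar
      by (subst nn_integral_cmult[symmetric]) (auto simp: ennreal_mult mult_ac)
    finally show ?thesis .
  qed
  have [measurable]: "a \<in> borel_measurable borel" unfolding a_def by measurable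
  have a0: "0 \<le> a y" for y by (simp add: a_def)
  have "AE y in lborel. ennreal (a y) \<le> ennreal \<nu>"
    using peetre_sup_upper[of j ?k \<beta> lam F x] by (simp add: N a_def)
  then have "(\<integral>\<^sup>+ y. ennreal (a y) \<partial>lborel) \<le> (\<integral>\<^sup>+ y. ennreal (\<nu> powr (1 - r)) * ennreal (a y powr r) \<partial>lborel)"
  proof (intro nn_integral_mono_AE, eventually_elim)
    case (elim y)
    then show ?case using powr_interpolate[OF a0 _ r(2), of y \<nu>] \<nu> by (simp add: ennreal_mult[symmetric] ennreal_leI)
  qed
  also have "\<dots> = ennreal (\<nu> powr (1 - r)) * (\<integral>\<^sup>+ y. ennreal (a y powr r) \<partial>lborel)"
    by (rule nn_integral_cmult) measurable
  finally have "ennreal ?P * (\<integral>\<^sup>+ y. ennreal (a y) \<partial>lborel) \<le> ennreal ?P * (ennreal (\<nu> powr (1 - r)) * (\<integral>\<^sup>+ y. ennreal (a y powr r) \<partial>lborel))"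
    by (rule mult_left_mono) simp
  then show "ennreal (2 powr (- real i * \<beta>) * ?P) * decay_integral lam (\<lambda>k x. ennreal (norm (F k x))) j x ?k \<le>
    ennreal (\<nu> powr (1 - r)) * (ennreal (2 powr (- real i * (\<beta> * r)) * ?P) * decay_integral (lam * r) (\<lambda>k x. ennreal (norm (F k x) powr r)) j x ?k)"
    unfolding l rr by (simp add: mult_ac)
qed

text \<open>Finiteness of the maximal function allows its power \<open>1 - r\<close> to be absorbed on the left.\<close>

lemma maximal_absorption:
  fixes F :: "int \<Rightarrow> real ^ 'n \<Rightarrow> complex"
  assumes m[measurable]: "\<And>k. F k \<in> borel_measurable borel"
    and r: "0 < r" "r \<le> 1" and lam: "0 \<le> lam" and C: "0 \<le> C"
    and star: "\<And>k. AE x in lborel. ennreal (norm (F k x)) \<le> ennreal C * decay_sum lam \<beta> (\<lambda>k x. ennreal (norm (F k x))) k x"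
    and fin: "peetre_sup lam \<beta> F j x < \<infinity>"
  defines "R \<equiv> decay_sum (lam * r) (\<beta> * r) (\<lambda>k x. ennreal (norm (F k x) powr r)) j x"
  shows "ennreal (enn2real (peetre_sup lam \<beta> F j x) powr r) \<le> ennreal C * R" (is ?A)
    and "ennreal (norm (F j x)) \<le> ennreal C * decay_sum lam \<beta> (\<lambda>k x. ennreal (norm (F k x))) j x \<Longrightarrow>
      ennreal (norm (F j x) powr r) \<le> ennreal C * R"
proof -
  let ?G = "\<lambda>k x. ennreal (norm (F k x))"
  let ?D = "decay_sum lam \<beta> ?G j x"
  define \<nu> where "\<nu> = enn2real (peetre_sup lam \<beta> F j x)"
  have \<nu>: "0 \<le> \<nu>" "peetre_sup lam \<beta> F j x = ennreal \<nu>" using fin by (simp_all add: \<nu>_def)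
  \<comment> \<open>Multiplying the estimate at (k, x - y) by the weights of the maximal function
    and shifting the sum back to (j, x) yields a bound that is independent of k and y.\<close>
  have N: "ennreal \<nu> \<le> ennreal C * ?D"
    unfolding \<nu>(2)[symmetric]
  proof (rule peetre_sup_least[OF m])
    fix k assume k: "j \<le> k"
    show "AE y in lborel. ennreal (2 powr (real_of_int (j - k) * \<beta>) * wgt (- lam) ((2 powi j) *\<^sub>R y) * norm (F k (x - y))) \<le> ennreal C * ?D"
      using AE_lborel_reflect[OF star[of k], of x]
    proof eventually_elim
      case (elim y)
      let ?c = "2 powr (real_of_int (j - k) * \<beta>) * wgt (- lam) ((2 powi j) *\<^sub>R y)"
      have "ennreal (?c * norm (F k (x - y))) = ennreal ?c * ennreal (norm (F k (x - y)))" by (simp add: ennreal_mult)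
      also have "\<dots> \<le> ennreal ?c * (ennreal C * decay_sum lam \<beta> ?G k (x - y))" by (rule mult_left_mono[OF elim]) simp
      also have "\<dots> = ennreal C * (ennreal ?c * decay_sum lam \<beta> ?G k (x - y))" by (simp add: mult_ac)
      also have "\<dots> \<le> ennreal C * ?D"
        by (intro mult_left_mono decay_sum_shift k lam) auto
      finally show ?case .
    qed
  qed
  have D: "?D \<le> ennreal (\<nu> powr (1 - r)) * R"
    unfolding R_def by (rule decay_sum_interpolate[OF m r \<nu>(2,1)])
  \<comment> \<open>Cancelling \<nu>^(1-r) requires \<nu> > 0 and a finite R. The degenerate cases
    are separate because 0 * \<infinity> = 0 in \<open>ennreal\<close>; if C = 0, then \<nu> =
    0.\<close>
  show A: ?A
  proof (cases "\<nu> = 0 \<or> R = \<infinity> \<or> C = 0")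
    case True
    then consider "\<nu> = 0" | "\<nu> \<noteq> 0" "C = 0" | "\<nu> \<noteq> 0" "C \<noteq> 0" "R = \<infinity>" by blast
    then show ?thesis
    proof cases
      case 1 then show ?thesis by (simp add: \<nu>_def[symmetric])
    next
      case 2 then show ?thesis using N \<nu>(1) by simp
    next
      case 3 then show ?thesis using C by (simp add: ennreal_mult_top)
    qed
  next
    case False
    then obtain \<rho> where \<rho>: "0 \<le> \<rho>" "R = ennreal \<rho>" by (cases R) auto
    have "ennreal \<nu> \<le> ennreal C * (ennreal (\<nu> powr (1 - r)) * R)"
      by (rule order_trans[OF N mult_left_mono[OF D]]) simp
    then have "ennreal \<nu> \<le> ennreal (C * (\<nu> powr (1 - r) * \<rho>))"
      using C \<rho> by (simp add: ennreal_mult)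
    then have "\<nu> \<le> C * (\<nu> powr (1 - r) * \<rho>)"
      by (subst (asm) ennreal_le_iff) (use C \<rho> in auto)
    moreover have "\<nu> = \<nu> powr r * \<nu> powr (1 - r)" using False \<nu>(1) by (simp add: powr_add[symmetric])
    moreover have "0 < \<nu> powr (1 - r)" using False \<nu>(1) by simp
    ultimately have "\<nu> powr r \<le> C * \<rho>"
      by (metis mult.assoc mult.commute mult_le_cancel_right_pos)
    then show ?thesis using C \<rho> by (simp add: \<nu>_def[symmetric] ennreal_mult[symmetric] ennreal_leI)
  qed
  \<comment> \<open>An essential supremum says nothing about the value at the given x, so the
    estimate is assumed there. With R = \<rho> it gives |F j x| \<le> \<nu>^(1-r) C \<rho>, and
    \<nu>^r \<le> C \<rho> from the first part turns the r-th power into (C \<rho>)^(1-r) (C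
    \<rho>)^r.\<close>
  assume F: "ennreal (norm (F j x)) \<le> ennreal C * ?D"
  show "ennreal (norm (F j x) powr r) \<le> ennreal C * R"
  proof (cases "R = \<infinity>")
    case True
    show ?thesis
    proof (cases "C = 0")
      case True then show ?thesis using F r by simp
    next
      case False then show ?thesis using \<open>R = \<infinity>\<close> C by (simp add: ennreal_mult_top)
    qed
  next
    case False
    then obtain \<rho> where \<rho>: "0 \<le> \<rho>" "R = ennreal \<rho>" by (cases R) auto
    have "ennreal (norm (F j x)) \<le> ennreal C * (ennreal (\<nu> powr (1 - r)) * R)"
      by (rule order_trans[OF F mult_left_mono[OF D]]) simp
    then have "ennreal (norm (F j x)) \<le> ennreal (C * (\<nu> powr (1 - r) * \<rho>))"
      using C \<rho> by (simp add: ennreal_mult)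
    then have a: "norm (F j x) \<le> \<nu> powr (1 - r) * (C * \<rho>)"
      by (subst (asm) ennreal_le_iff) (use C \<rho> in \<open>auto simp: mult_ac\<close>)
    have "\<nu> powr r \<le> C * \<rho>"
      using A C \<rho> by (simp add: \<nu>_def[symmetric] ennreal_mult[symmetric])
    then have "(\<nu> powr r) powr (1 - r) \<le> (C * \<rho>) powr (1 - r)"
      using r by (intro powr_mono2) auto
    then have b: "(\<nu> powr (1 - r)) powr r \<le> (C * \<rho>) powr (1 - r)"
      by (simp add: powr_powr mult.commute)
    have "norm (F j x) powr r \<le> (\<nu> powr (1 - r) * (C * \<rho>)) powr r"
      using a r by (intro powr_mono2) auto
    also have "\<dots> = (\<nu> powr (1 - r)) powr r * (C * \<rho>) powr r"
      by (rule powr_mult)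
    also have "\<dots> \<le> (C * \<rho>) powr (1 - r) * (C * \<rho>) powr r" by (intro mult_right_mono b) auto
    also have "\<dots> = C * \<rho>" using C \<rho> by (simp add: powr_add[symmetric])
    finally show ?thesis using C \<rho> by (simp add: ennreal_mult[symmetric] ennreal_leI)
  qed
qed

text \<open>A first application of the absorption argument, with parameters for which finiteness is
  known, shows that the maximal function for the other parameters is finite; the second application
  then gives the constant of the latter.\<close>

lemma maximal_bootstrap:
  fixes F :: "int \<Rightarrow> real ^ 'n \<Rightarrow> complex"
  assumes m[measurable]: "\<And>k. F k \<in> borel_measurable borel"
    and r: "0 < r" "r \<le> 1" and lam: "0 \<le> lam" "lam \<le> lam0" and \<beta>: "\<beta> \<le> \<beta>0"
    and C0: "0 \<le> C0" and C: "0 < C"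
    and star0: "\<And>k. AE x in lborel. ennreal (norm (F k x)) \<le> ennreal C0 * decay_sum lam0 \<beta>0 (\<lambda>k x. ennreal (norm (F k x))) k x"
    and star: "\<And>k. AE x in lborel. ennreal (norm (F k x)) \<le> ennreal C * decay_sum lam \<beta> (\<lambda>k x. ennreal (norm (F k x))) k x"
    and fin: "\<And>k x. peetre_sup lam0 \<beta>0 F k x < \<infinity>"
  shows "\<exists>\<nu>\<ge>0. peetre_sup lam \<beta> F j x \<le> ennreal \<nu> \<and>
      ennreal (\<nu> powr r) \<le> ennreal C * decay_sum (lam * r) (\<beta> * r) (\<lambda>k x. ennreal (norm (F k x) powr r)) j x
    \<or> decay_sum (lam * r) (\<beta> * r) (\<lambda>k x. ennreal (norm (F k x) powr r)) j x = \<infinity>"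
proof (cases "decay_sum (lam * r) (\<beta> * r) (\<lambda>k x. ennreal (norm (F k x) powr r)) j x = \<infinity>")
  case False
  let ?Gr = "\<lambda>k x. ennreal (norm (F k x) powr r)"
  let ?R = "decay_sum (lam * r) (\<beta> * r) ?Gr"
  obtain \<rho> where \<rho>: "0 \<le> \<rho>" "?R j x = ennreal \<rho>" using False by (cases "?R j x") auto
  \<comment> \<open>The first pass, at every scale k. Larger exponents make \<open>decay_sum\<close>
    smaller, so its right-hand side may be enlarged to the exponents lam and \<beta>; only the
    constant C0 still remembers the others.\<close>
  have pw: "AE y in lborel. ennreal (norm (F k y) powr r) \<le> ennreal C0 * ?R k y" for k
    using star0[of k]
  proof eventually_elim
    case (elim y)
    have "ennreal (norm (F k y) powr r) \<le> ennreal C0 * decay_sum (lam0 * r) (\<beta>0 * r) ?Gr k y"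
      by (rule maximal_absorption(2)[OF m r _ C0 star0 fin elim]) (use lam in auto)
    also have "\<dots> \<le> ennreal C0 * ?R k y"
      using lam \<beta> r by (intro mult_left_mono decay_sum_anti) (auto intro: mult_right_mono)
    finally show ?case .
  qed
  \<comment> \<open>The r-th powers are shifted back to (j, x), where R is the finite \<rho>, and
    the root of order r is taken. The bound serves only to establish finiteness.\<close>
  have "peetre_sup lam \<beta> F j x \<le> ennreal ((C0 * \<rho>) powr (1 / r))"
  proof (rule peetre_sup_least[OF m])
    fix k assume k: "j \<le> k"
    show "AE y in lborel. ennreal (2 powr (real_of_int (j - k) * \<beta>) * wgt (- lam) ((2 powi j) *\<^sub>R y) * norm (F k (x - y))) \<le> ennreal ((C0 * \<rho>) powr (1 / r))"
      using AE_lborel_reflect[OF pw[of k], of x]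
    proof eventually_elim
      case (elim y)
      let ?a = "2 powr (real_of_int (j - k) * \<beta>) * wgt (- lam) ((2 powi j) *\<^sub>R y) * norm (F k (x - y))"
      let ?c = "2 powr (real_of_int (j - k) * (\<beta> * r)) * wgt (- (lam * r)) ((2 powi j) *\<^sub>R y)"
      have "?a powr r = ?c * norm (F k (x - y)) powr r"
        by (simp add: powr_mult powr_powr wgt_powr mult_ac)
      then have "ennreal (?a powr r) = ennreal ?c * ennreal (norm (F k (x - y)) powr r)" by (simp add: ennreal_mult)
      also have "\<dots> \<le> ennreal ?c * (ennreal C0 * ?R k (x - y))" by (rule mult_left_mono[OF elim]) simp
      also have "\<dots> = ennreal C0 * (ennreal ?c * ?R k (x - y))" by (simp add: mult_ac)
      also have "\<dots> \<le> ennreal C0 * ?R j x"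
        using lam r by (intro mult_left_mono decay_sum_shift k) auto
      also have "\<dots> = ennreal (C0 * \<rho>)" using C0 \<rho> by (simp add: ennreal_mult)
      finally have "?a powr r \<le> C0 * \<rho>" using C0 \<rho> by (subst (asm) ennreal_le_iff) auto
      then have "(?a powr r) powr (1 / r) \<le> (C0 * \<rho>) powr (1 / r)" using r by (intro powr_mono2) auto
      then show ?case using r by (simp add: powr_powr ennreal_leI)
    qed
  qed
  then have f: "peetre_sup lam \<beta> F j x < \<infinity>" by (rule order_le_less_trans) simp
  have "ennreal (enn2real (peetre_sup lam \<beta> F j x) powr r) \<le> ennreal C * ?R j x"
    by (rule maximal_absorption(1)[OF m r lam(1) _ star f]) (use C in simp)
  then show ?thesis using f by (intro exI[of _ "enn2real (peetre_sup lam \<beta> F j x)"]) auto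
qed (auto intro: exI[of _ 0])


subsection \<open>The theorem\<close>

lemma kernel_constants:
  fixes p :: "real ^ 'n \<Rightarrow> complex"
  assumes p: "Ck M (- {0}) p" and cov: "covers p L" and lam: "0 \<le> lam" "lam \<le> real M"
    and O: "\<And>\<kappa>. length \<kappa> \<le> M \<Longrightarrow> (\<lambda>\<xi>. norm (pderivs \<kappa> p \<xi>)) \<in> O[at_infinity](\<lambda>\<xi>. norm \<xi> powr (- \<beta>))"
  obtains C where "0 \<le> C" "\<And>x. norm (ift cutoff (x :: real ^ 'n)) \<le> C * wgt (- lam) x"
    "\<And>k s x. k \<in> {- int L..int L} \<Longrightarrow> norm (ift (\<lambda>\<xi>. p ((2 ^ s) *\<^sub>R \<xi>) * freq_part p L k \<xi>) x) \<le>
      C * 2 powr (- real s * \<beta>) * wgt (- lam) ((1 / 2 ^ s) *\<^sub>R x)"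
proof -
  obtain c0 where c0: "0 \<le> c0" "\<And>x. norm (ift cutoff (x :: real ^ 'n)) \<le> c0 * wgt (- lam) x"
    by (rule ift_wgt_bound[OF Ck_cutoff[OF open_UNIV, of M] cutoff_eq_0 lam(2)]) auto
  have "\<forall>k. \<exists>c. 0 \<le> c \<and> (\<forall>s x. norm (ift (\<lambda>\<xi>. p ((2 ^ s) *\<^sub>R \<xi>) * freq_part p L k \<xi>) x) \<le>
      c * 2 powr (- real s * \<beta>) * wgt (- lam) ((1 / 2 ^ s) *\<^sub>R x))"
    using scaled_kernel_bound[OF p cov lam O] by simp
  from choice[OF this] obtain c where c: "\<And>k. 0 \<le> c k"
    "\<And>k s x. norm (ift (\<lambda>\<xi>. p ((2 ^ s) *\<^sub>R \<xi>) * freq_part p L k \<xi>) x) \<le>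
      c k * 2 powr (- real s * \<beta>) * wgt (- lam) ((1 / 2 ^ s) *\<^sub>R x)"
    by auto
  \<comment> \<open>Only finitely many k occur, so the sum of their constants serves all of
    them.\<close>
  define C where "C = c0 + (\<Sum>k\<in>{- int L..int L}. c k)"
  have s0: "0 \<le> (\<Sum>k\<in>{- int L..int L}. c k)" by (intro sum_nonneg c)
  show ?thesis
  proof
    show "0 \<le> C" using c0 s0 by (simp add: C_def)
    show "norm (ift cutoff x) \<le> C * wgt (- lam) x" for x :: "real ^ 'n"
      by (rule order_trans[OF c0(2)]) (use s0 in \<open>auto simp: C_def intro: mult_right_mono\<close>)
    fix k s and x :: "real ^ 'n" assume k: "k \<in> {- int L..int L}"
    have "c k \<le> C" using member_le_sum[OF k, of c] c(1) c0(1) by (simp add: C_def)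
    then show "norm (ift (\<lambda>\<xi>. p ((2 ^ s) *\<^sub>R \<xi>) * freq_part p L k \<xi>) x) \<le>
      C * 2 powr (- real s * \<beta>) * wgt (- lam) ((1 / 2 ^ s) *\<^sub>R x)"
      by (intro order_trans[OF c(2)] mult_right_mono) auto
  qed
qed

section \<open>Comparison with the maximal functions and the sum of the theorem\<close>

lemma bigo_powr_weaken:
  fixes g :: "'a::real_normed_vector \<Rightarrow> real"
  assumes "g \<in> O[at_infinity](\<lambda>\<xi>. norm \<xi> powr (- b))" "a \<le> b"
  shows "g \<in> O[at_infinity](\<lambda>\<xi>. norm \<xi> powr (- a))"
proof (rule landau_o.big_trans[OF assms(1)], rule landau_o.bigI[of 1])
  show "\<forall>\<^sub>F \<xi> :: 'a in at_infinity. norm (norm \<xi> powr (- b)) \<le> 1 * norm (norm \<xi> powr (- a))"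
    unfolding eventually_at_infinity using assms(2) by (intro exI[of _ 1]) (auto intro: powr_mono)
qed simp

lemma decay_sum_cong_AE:
  assumes "\<And>k. AE x in lborel. G k x = H k x"
  shows "decay_sum p q G j x = decay_sum p q H j x"
  unfolding decay_sum_def decay_integral_def
proof (intro suminf_cong arg_cong2[where f="(*)"] refl nn_integral_cong_AE)
  fix i :: nat
  show "AE y in lborel. G (j + int i) (x - y) * ennreal (wgt (- p) ((2 powi j) *\<^sub>R y)) = H (j + int i) (x - y) * ennreal (wgt (- p) ((2 powi j) *\<^sub>R y))"
    using AE_lborel_reflect[OF assms[of "j + int i"], of x] by eventually_elim simp
qed

lemma M_max_AE:
  assumes "j \<le> k"
  shows "AE y in lborel. ennreal (norm (F k y) / (1 + 2 powi j * norm (x - y)) powr l * 2 powr (real_of_int (j - k) * m)) \<le> M_max l m F x j"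
proof -
  let ?g = "\<lambda>y. ennreal (norm (F k y) / (1 + 2 powi j * norm (x - y)) powr l * 2 powr (real_of_int (j - k) * m))"
  have S: "esssup lborel ?g \<le> M_max l m F x j"
    unfolding M_max_def by (rule SUP_upper) (use assms in simp)
  show ?thesis using esssup_AE[where f="?g" and M=lborel] by eventually_elim (rule order_trans[OF _ S])
qed

lemma wgt_scaled: "0 \<le> c \<Longrightarrow> wgt p (c *\<^sub>R x) = (1 + c * norm x) powr p"
  by (simp add: wgt_def)

text \<open>For k \<ge> j the factor 2^((j-k) m) decreases in m, and the weight decreases in its
  exponent, so raising both exponents keeps the maximal function finite.\<close>

lemma peetre_sup_finite:
  fixes F :: "int \<Rightarrow> real ^ 'n \<Rightarrow> complex"
  assumes m: "\<And>k. F k \<in> borel_measurable borel" and M: "M_max l m F x j < \<infinity>" and le: "l \<le> lam" "m \<le> \<beta>"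
  shows "peetre_sup lam \<beta> F j x < \<infinity>"
proof -
  have "peetre_sup lam \<beta> F j x \<le> M_max l m F x j"
  proof (rule peetre_sup_least[OF m])
    fix k assume k: "j \<le> k"
    show "AE y in lborel. ennreal (2 powr (real_of_int (j - k) * \<beta>) * wgt (- lam) ((2 powi j) *\<^sub>R y) * norm (F k (x - y))) \<le> M_max l m F x j"
      using AE_lborel_reflect[OF M_max_AE[OF k, of F x l m], of x]
    proof eventually_elim
      case (elim y)
      have "2 powr (real_of_int (j - k) * \<beta>) * wgt (- lam) ((2 powi j) *\<^sub>R y) * norm (F k (x - y)) \<le>
         2 powr (real_of_int (j - k) * m) * wgt (- l) ((2 powi j) *\<^sub>R y) * norm (F k (x - y))"
        using k le by (intro mult_right_mono mult_mono powr_mono wgt_mono mult_left_mono_neg) auto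
      also have "\<dots> = norm (F k (x - y)) / (1 + 2 powi j * norm (x - (x - y))) powr l * 2 powr (real_of_int (j - k) * m)"
        by (simp add: wgt_scaled powr_minus divide_inverse mult_ac)
      finally show ?case using elim by (meson ennreal_leI order_trans)
    qed
  qed
  then show ?thesis using M by (rule order_le_less_trans)
qed

text \<open>The term k = j at x = 0 already bounds F j by a weight at scale j; max(1, 2^j)^l
  converts it into the unscaled weight.\<close>

lemma M_max_poly_bound:
  fixes F :: "int \<Rightarrow> real ^ 'n \<Rightarrow> complex"
  assumes M: "M_max l m F 0 j < \<infinity>" and l: "0 \<le> l"
  shows "\<exists>A. AE y in lborel. norm (F j y) \<le> A * wgt l y"
proof -
  obtain B where B: "0 \<le> B" "M_max l m F 0 j = ennreal B" using M by (cases "M_max l m F 0 j") auto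
  let ?c = "max 1 (2 powi j :: real)"
  have "AE y in lborel. norm (F j y) \<le> B * ?c powr l * wgt l y"
    using M_max_AE[OF order_refl, of F j 0 l m]
  proof eventually_elim
    case (elim y)
    let ?w = "(1 + 2 powi j * norm y) powr l"
    have pos: "0 < 1 + 2 powi j * norm y" by (simp add: add_pos_nonneg)
    have "ennreal (norm (F j y) / ?w) \<le> ennreal B" using elim by (simp add: B)
    then have "norm (F j y) / ?w \<le> B" using B by (subst (asm) ennreal_le_iff) auto
    then have "norm (F j y) \<le> B * ?w" using pos by (simp add: divide_le_eq)
    also have "\<dots> \<le> B * (?c powr l * wgt l y)"
    proof (rule mult_left_mono[OF _ B(1)])
      have "1 + 2 powi j * norm y \<le> ?c * (1 + norm y)"
        unfolding distrib_left by (intro add_mono mult_right_mono) auto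
      then have "?w \<le> (?c * (1 + norm y)) powr l" using l pos by (intro powr_mono2) auto
      then show "?w \<le> ?c powr l * wgt l y" by (simp add: powr_mult wgt_def)
    qed
    finally show ?case by (simp add: mult.assoc)
  qed
  then show ?thesis ..
qed

text \<open>From 1 + 2^k |y| \<le> 2^(k-j) (1 + 2^j |y|), passing from the weight at scale j to that
  at scale k costs 2^((k-j) lam r). This loss turns the exponent \<beta> into \<beta> - lam.\<close>

lemma decay_sum_le_mean_sum:
  fixes F :: "int \<Rightarrow> real ^ 'n \<Rightarrow> complex"
  assumes [measurable]: "\<And>k. F k \<in> borel_measurable borel" and lam: "0 \<le> lam" and r: "0 < r"
  shows "decay_sum (lam * r) (\<beta> * r) (\<lambda>k x. ennreal (norm (F k x) powr r)) j x \<le> mean_sum r lam \<beta> F j x"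
  unfolding decay_sum_def mean_sum_def Let_def
proof (intro suminf_le summableI)
  fix i :: nat
  let ?k = "j + int i"
  let ?P = "2 powi (?k * int CARD('n)) :: real"
  have "ennreal (2 powr (- real i * (\<beta> * r)) * ?P) * decay_integral (lam * r) (\<lambda>k x. ennreal (norm (F k x) powr r)) j x ?k
     = (\<integral>\<^sup>+ y. ennreal (2 powr (- real i * (\<beta> * r)) * ?P * (norm (F ?k (x - y)) powr r * wgt (- (lam * r)) ((2 powi j) *\<^sub>R y))) \<partial>lborel)"
    unfolding decay_integral_def
    by (subst nn_integral_cmult[symmetric]) (auto simp: ennreal_mult)
  also have "\<dots> \<le> (\<integral>\<^sup>+ y. ennreal (2 powr (real_of_int (j - ?k) * (\<beta> - lam) * r)) *
      ennreal (norm (F ?k (x - y)) powr r / (1 + 2 powi ?k * norm y) powr (lam * r) * 2 powi (?k * int CARD('n))) \<partial>lborel)"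
  proof (rule nn_integral_mono)
    fix y :: "real ^ 'n"
    have i: "(2::real) powi ?k = 2 ^ i * 2 powi j" by (simp add: power_int_add)
    have one: "1 + 2 powi ?k * norm y \<le> 2 ^ i * (1 + 2 powi j * norm y)"
      unfolding i distrib_left by (intro add_mono) (auto simp: mult.assoc)
    have pos: "0 < 1 + 2 powi ?k * norm y" "0 < 1 + 2 powi j * norm y" by (auto simp: add_pos_nonneg)
    have "(1 + 2 powi ?k * norm y) powr (lam * r) \<le> (2 ^ i * (1 + 2 powi j * norm y)) powr (lam * r)"
      using one pos lam r by (intro powr_mono2) auto
    also have "\<dots> = 2 powr (real i * (lam * r)) * (1 + 2 powi j * norm y) powr (lam * r)"
      by (simp add: powr_mult powr_realpow[symmetric] powr_powr)
    finally have "wgt (- (lam * r)) ((2 powi j) *\<^sub>R y) \<le> 2 powr (real i * (lam * r)) / (1 + 2 powi ?k * norm y) powr (lam * r)"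
      using pos by (simp add: wgt_scaled powr_minus divide_simps mult_ac)
    then have "2 powr (- real i * (\<beta> * r)) * ?P * (norm (F ?k (x - y)) powr r * wgt (- (lam * r)) ((2 powi j) *\<^sub>R y)) \<le>
       2 powr (- real i * (\<beta> * r)) * ?P * (norm (F ?k (x - y)) powr r * (2 powr (real i * (lam * r)) / (1 + 2 powi ?k * norm y) powr (lam * r)))"
      by (intro mult_left_mono) auto
    also have "\<dots> = (2 powr (- real i * (\<beta> * r)) * 2 powr (real i * (lam * r))) * (norm (F ?k (x - y)) powr r / (1 + 2 powi ?k * norm y) powr (lam * r) * ?P)"
      by simp
    also have "2 powr (- real i * (\<beta> * r)) * 2 powr (real i * (lam * r)) = (2::real) powr (real_of_int (j - ?k) * (\<beta> - lam) * r)"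
      unfolding powr_add[symmetric] by (simp add: algebra_simps)
    finally show "ennreal (2 powr (- real i * (\<beta> * r)) * ?P * (norm (F ?k (x - y)) powr r * wgt (- (lam * r)) ((2 powi j) *\<^sub>R y))) \<le>
      ennreal (2 powr (real_of_int (j - ?k) * (\<beta> - lam) * r)) *
      ennreal (norm (F ?k (x - y)) powr r / (1 + 2 powi ?k * norm y) powr (lam * r) * 2 powi (?k * int CARD('n)))"
      by (simp add: ennreal_mult[symmetric] ennreal_leI)
  qed
  also have "\<dots> = ennreal (2 powr (real_of_int (j - ?k) * (\<beta> - lam) * r)) *
      (\<integral>\<^sup>+ y. ennreal (norm (F ?k (x - y)) powr r / (1 + 2 powi ?k * norm y) powr (lam * r) * 2 powi (?k * int CARD('n))) \<partial>lborel)"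
    by (rule nn_integral_cmult) measurable
  finally show "ennreal (2 powr (- real i * (\<beta> * r)) * ?P) * decay_integral (lam * r) (\<lambda>k x. ennreal (norm (F k x) powr r)) j x ?k \<le> \<dots>" .
qed

lemma peetre_max_le_sup: "peetre_max lam F j x \<le> peetre_sup lam \<beta> F j x"
proof -
  have "peetre_max lam F j x = esssup lborel (\<lambda>y. ennreal
     (2 powr (real_of_int (j - j) * \<beta>) * wgt (- lam) ((2 powi j) *\<^sub>R y) * norm (F j (x - y))))"
    unfolding peetre_max_def by (simp add: wgt_scaled powr_minus divide_inverse mult.commute)
  also have "\<dots> \<le> peetre_sup lam \<beta> F j x" unfolding peetre_sup_def by (rule SUP_upper) simp
  finally show ?thesis .
qed

lemma ennreal_powr_le:
  assumes "a \<le> ennreal \<nu>" "0 \<le> \<nu>" "0 < r"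
  shows "ennreal_powr a r \<le> ennreal (\<nu> powr r)"
proof -
  have "a \<noteq> top" using assms(1) by (auto simp: top_unique)
  moreover have "enn2real a \<le> \<nu>" using assms by (metis enn2real_leI)
  ultimately show ?thesis using assms(3) by (simp add: ennreal_powr_def ennreal_leI powr_mono2)
qed

theorem theorem4p2:
  fixes \<psi> :: "real ^ 'n \<Rightarrow> complex" and r lam \<beta> :: real
  assumes "0 < r" "r \<le> 1" "0 < lam"
    and "integrable lborel \<psi>"
    and "tauberian \<psi>"
  shows "\<exists>C>0. \<forall>l m :: real.
      l \<ge> 0 \<longrightarrow>
      integrable lborel (\<lambda>x. ((1 + norm x) powr l) *\<^sub>R \<psi> x) \<longrightarrow>
      C_on (max (CARD('n) + 1 + nat \<lfloor>l\<rfloor>) (nat \<lfloor>lam\<rfloor> + 1)) (- {0}) (fourier \<psi>) \<longrightarrow>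
      (\<forall>\<kappa>. length \<kappa> \<le> max (nat \<lfloor>l\<rfloor>) (nat \<lfloor>lam\<rfloor>) + 1 \<longrightarrow>
         (\<lambda>\<xi>. norm (pderivs \<kappa> (fourier \<psi>) \<xi>)) \<in> O[at_infinity](\<lambda>\<xi>. norm \<xi> powr (- max m \<beta>))) \<longrightarrow>
      (\<forall>f F. has_growth f l \<longrightarrow>
         (\<forall>j. is_loc_int_function (dist_conv (dilate j \<psi>) f) (F j)) \<longrightarrow>
         (\<forall>j x. M_max l m F x j < \<infinity>) \<longrightarrow>
         (\<forall>j x. ennreal_powr (peetre_max lam F j x) r \<le> ennreal C * mean_sum r lam \<beta> F j x))"
proof -
  let ?p = "fourier \<psi>"
  let ?M = "nat \<lfloor>lam\<rfloor> + 1"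
  \<comment> \<open>The consequences of the hypotheses that mention neither l nor m: the constant
    has to be built from these alone.\<close>
  let ?good = "Ck ?M (- {0}) ?p \<and>
    (\<forall>\<kappa>. length \<kappa> \<le> ?M \<longrightarrow> (\<lambda>\<xi>. norm (pderivs \<kappa> ?p \<xi>)) \<in> O[at_infinity](\<lambda>\<xi>. norm \<xi> powr (- \<beta>)))"
  have good: ?good
    if "C_on (max (CARD('n) + 1 + nat \<lfloor>l\<rfloor>) ?M) (- {0}) ?p"
      "\<forall>\<kappa>. length \<kappa> \<le> max (nat \<lfloor>l\<rfloor>) (nat \<lfloor>lam\<rfloor>) + 1 \<longrightarrow>
         (\<lambda>\<xi>. norm (pderivs \<kappa> ?p \<xi>)) \<in> O[at_infinity](\<lambda>\<xi>. norm \<xi> powr (- max m \<beta>))" for l m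
    using that by (auto simp: C_on_iff_Ck intro: Ck_mono[rotated] bigo_powr_weaken[where b="max m \<beta>"])
  show ?thesis
  proof (cases ?good)
    \<comment> \<open>Here the hypotheses fail for every l and m, so any positive constant will
      do.\<close>
    case False
    then show ?thesis
      by (intro exI[of _ 1] conjI allI impI zero_less_one) (use good in blast)
  next
    case True
    then obtain L where cov: "covers ?p L"
      using tauberian_covers[OF assms(5)] Ck_continuous by blast
    have lamM: "lam \<le> real ?M" using assms(3) by linarith
    obtain C1 where C1: "0 \<le> C1" "\<And>x. norm (ift cutoff (x :: real ^ 'n)) \<le> C1 * wgt (- lam) x"
      "\<And>k s x. k \<in> {- int L..int L} \<Longrightarrow> norm (ift (\<lambda>\<xi>. ?p ((2 ^ s) *\<^sub>R \<xi>) * freq_part ?p L k \<xi>) x) \<le>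
        C1 * 2 powr (- real s * \<beta>) * wgt (- lam) ((1 / 2 ^ s) *\<^sub>R x)"
      by (rule kernel_constants[OF _ cov _ lamM, of \<beta>]) (use True assms(3) in auto)
    have rc: "0 \<le> repro_const TYPE('n) L b" for b by (simp add: repro_const_def)
    \<comment> \<open>The summand 1 makes C positive even if C1 vanishes, so that C * \<infinity> =
      \<infinity> when the sum diverges.\<close>
    define C where "C = C1 * repro_const TYPE('n) L \<beta> + 1"
    have C: "0 < C" using C1(1) rc[of \<beta>] by (simp add: C_def add_nonneg_pos)
    show ?thesis
    proof (intro exI[of _ C] conjI C allI impI)
      fix l m :: real and f :: "(real ^ 'n \<Rightarrow> complex) \<Rightarrow> complex" and F :: "int \<Rightarrow> real ^ 'n \<Rightarrow> complex" and j :: int and x :: "real ^ 'n"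
      assume l: "0 \<le> l" and int: "integrable lborel (\<lambda>x. ((1 + norm x) powr l) *\<^sub>R \<psi> x)"
        and reg: "C_on (max (CARD('n) + 1 + nat \<lfloor>l\<rfloor>) ?M) (- {0}) ?p"
        and O: "\<forall>\<kappa>. length \<kappa> \<le> max (nat \<lfloor>l\<rfloor>) (nat \<lfloor>lam\<rfloor>) + 1 \<longrightarrow>
          (\<lambda>\<xi>. norm (pderivs \<kappa> ?p \<xi>)) \<in> O[at_infinity](\<lambda>\<xi>. norm \<xi> powr (- max m \<beta>))"
        and f: "has_growth f l" and F: "\<forall>j. is_loc_int_function (dist_conv (dilate j \<psi>) f) (F j)"
        and fin: "\<forall>j x. M_max l m F x j < \<infinity>"
      let ?N = "max (CARD('n) + 1 + nat \<lfloor>l\<rfloor>) ?M" and ?M0 = "max (nat \<lfloor>l\<rfloor>) (nat \<lfloor>lam\<rfloor>) + 1"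
      let ?lam0 = "max l lam" and ?\<beta>0 = "max m \<beta>"
      have pN: "Ck ?N (- {0}) ?p" using reg by (simp add: C_on_iff_Ck)
      have N: "real CARD('n) + l < real ?N"
      proof -
        have "l < real (nat \<lfloor>l\<rfloor>) + 1" using l by linarith
        then show ?thesis by linarith
      qed
      have w: "wint l \<psi>"
        unfolding wint_def using integrable_norm[OF int] borel_measurable_integrable[OF assms(4)] by (simp add: wgt_def)
      have "1 \<le> CARD('n)" by (simp add: Suc_le_eq)
      then have pM0: "Ck ?M0 (- {0}) ?p" by (intro Ck_mono[OF _ pN]) auto
      have lam0: "0 \<le> ?lam0" "?lam0 \<le> real ?M0" using l assms(3) by linarith+
      \<comment> \<open>C2 depends on l and m. It feeds only the first pass, which proves
        finiteness, and does not enter C.\<close>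
      obtain C2 where C2: "0 \<le> C2" "\<And>x. norm (ift cutoff (x :: real ^ 'n)) \<le> C2 * wgt (- ?lam0) x"
        "\<And>k s x. k \<in> {- int L..int L} \<Longrightarrow> norm (ift (\<lambda>\<xi>. ?p ((2 ^ s) *\<^sub>R \<xi>) * freq_part ?p L k \<xi>) x) \<le>
          C2 * 2 powr (- real s * ?\<beta>0) * wgt (- ?lam0) ((1 / 2 ^ s) *\<^sub>R x)"
        by (rule kernel_constants[OF pM0 cov lam0, of ?\<beta>0]) (use O in auto)
      have Fm[measurable]: "F k \<in> borel_measurable borel" for k
        using F by (intro locally_integrable_measurable) (simp add: is_loc_int_function_def)
      have "\<forall>k. \<exists>A. AE y in lborel. norm (F k y) \<le> A * wgt l y"
        using fin by (intro allI M_max_poly_bound[OF _ l]) blast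
      from choice[OF this] obtain A where A: "\<And>k. AE y in lborel. norm (F k y) \<le> A k * wgt l y" by blast
      \<comment> \<open>A representative that obeys the polynomial bound everywhere, as absolute
        convergence of the correlations requires. It agrees with F almost everywhere and represents
        the same distribution.\<close>
      define F' where "F' k y = (if norm (F k y) \<le> A k * wgt l y then F k y else 0)" for k y
      have FF': "AE y in lborel. F' k y = F k y" for k using A[of k] by eventually_elim (simp add: F'_def)
      have F'm[measurable]: "F' k \<in> borel_measurable borel" for k unfolding F'_def by measurable
      have pb: "poly_bounded l (F' k)" for k
      proof -
        have "norm (F' k y) \<le> \<bar>A k\<bar> * wgt l y" for y
          by (auto simp: F'_def intro: order_trans mult_right_mono)
        then show ?thesis unfolding poly_bounded_def using F'm by blast
      qed
      have F': "is_loc_int_function (dist_conv (dilate k \<psi>) f) (F' k)" for k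
        unfolding is_loc_int_function_def
      proof (intro conjI allI impI locally_integrable_poly_bounded[OF l pb])
        fix \<phi> :: "real ^ 'n \<Rightarrow> complex" assume t: "test_function \<phi>"
        have [measurable]: "\<phi> \<in> borel_measurable borel" using wint_test_function[OF t order_refl] by (simp add: wint_def)
        have "dist_conv (dilate k \<psi>) f \<phi> = (\<integral>x. F k x * \<phi> x \<partial>lborel)" using F t by (simp add: is_loc_int_function_def)
        also have "\<dots> = (\<integral>x. F' k x * \<phi> x \<partial>lborel)"
          using FF'[of k] by (intro integral_cong_AE) (auto elim: eventually_mono)
        finally show "dist_conv (dilate k \<psi>) f \<phi> = (\<integral>x. F' k x * \<phi> x \<partial>lborel)" .
      qed
      let ?G = "\<lambda>k x. ennreal (norm (F k x))"
      have transfer: "AE y in lborel. ennreal (norm (F k y)) \<le> B * decay_sum a b ?G k y"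
        if "AE y in lborel. ennreal (norm (F' k y)) \<le> B * decay_sum a b (\<lambda>k x. ennreal (norm (F' k x))) k y" for k B a b
      proof -
        have e: "decay_sum a b (\<lambda>k x. ennreal (norm (F' k x))) k y = decay_sum a b ?G k y" for y
        proof (rule decay_sum_cong_AE)
          show "AE x in lborel. ennreal (norm (F' i x)) = ennreal (norm (F i x))" for i
            using FF'[of i] by eventually_elim simp
        qed
        show ?thesis using that[unfolded e] FF'[of k] by eventually_elim simp
      qed
      have star0: "AE y in lborel. ennreal (norm (F k y)) \<le> ennreal (C2 * repro_const TYPE('n) L ?\<beta>0) * decay_sum ?lam0 ?\<beta>0 ?G k y" for k
        by (rule transfer[OF reproducing_estimate[OF l w pN N cov f F' pb lam0(1) C2]])
      have star1: "AE y in lborel. ennreal (norm (F k y)) \<le> ennreal (C1 * repro_const TYPE('n) L \<beta>) * decay_sum lam \<beta> ?G k y" for k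
        by (rule transfer[OF reproducing_estimate[OF l w pN N cov f F' pb _ C1]]) (use assms(3) in auto)
      have star: "AE y in lborel. ennreal (norm (F k y)) \<le> ennreal C * decay_sum lam \<beta> ?G k y" for k
        using star1[of k]
      proof eventually_elim
        case (elim y)
        also have "ennreal (C1 * repro_const TYPE('n) L \<beta>) * decay_sum lam \<beta> ?G k y \<le> ennreal C * decay_sum lam \<beta> ?G k y"
          by (intro mult_right_mono ennreal_leI) (auto simp: C_def)
        finally show ?case .
      qed
      have pf: "peetre_sup ?lam0 ?\<beta>0 F k y < \<infinity>" for k y
        by (rule peetre_sup_finite[OF Fm]) (use fin in auto)
      let ?R = "decay_sum (lam * r) (\<beta> * r) (\<lambda>k x. ennreal (norm (F k x) powr r)) j x"
      have R: "?R \<le> mean_sum r lam \<beta> F j x" using assms by (intro decay_sum_le_mean_sum Fm) auto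
      consider \<nu> where "0 \<le> \<nu>" "peetre_sup lam \<beta> F j x \<le> ennreal \<nu>" "ennreal (\<nu> powr r) \<le> ennreal C * ?R" | "?R = \<infinity>"
        using maximal_bootstrap[OF Fm assms(1,2) _ _ _ _ C star0 star pf, of j x] assms(3) C2(1) rc by auto
      then show "ennreal_powr (peetre_max lam F j x) r \<le> ennreal C * mean_sum r lam \<beta> F j x"
      proof cases
        case 1
        have "ennreal_powr (peetre_max lam F j x) r \<le> ennreal (\<nu> powr r)"
          by (rule ennreal_powr_le[OF order_trans[OF peetre_max_le_sup 1(2)] 1(1) assms(1)])
        also have "\<dots> \<le> ennreal C * mean_sum r lam \<beta> F j x"
          by (rule order_trans[OF 1(3) mult_left_mono[OF R]]) simp
        finally show ?thesis .
      next
        case 2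
        then have "mean_sum r lam \<beta> F j x = \<infinity>" using R by (simp add: top_unique)
        then show ?thesis using C by (simp add: ennreal_mult_top)
      qed
    qed
  qed
qed


end
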